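(* Consider the Gaussian non-random many-access channel in which, at blocklength $n$, there are $k_n$ users, all active with probability one, with noise variance $N_0/2$ per symbol. The largest rate per unit-energy $\dot{C}_{\bot\bot}$ achievable (under the joint probability of error, with symmetric codes) with an orthogonal-access scheme and orthogonal codebooks has the following behaviour: 1) If $k_n=o(n^c)$ for every $c>0$, then $\dot{C}_{\bot\bot}=\frac{\log e}{N_0}$. 2) If $k_n=\Theta(n^c)$, then $$\dot{C}_{\bot\bot}=\begin{cases}\dfrac{\log e}{N_0}\,\dfrac{1}{\left(1+\sqrt{\frac{c}{1-c}}\right)^2}, & \text{if } 0<c\le 1/2,\\[2mm] \dfrac{\log e}{2N_0}(1-c), & \text{if } 1/2<c<1.\end{cases}$$
   Context: Logarithms $\log$ are to base 2. For nonnegative sequences: $a_n=o(b_n)$ means $\lim a_n/b_n=0$; $a_n=\Theta(b_n)$ means $\limsup a_n/b_n<\infty$ and $\liminf a_n/b_n>0$. Channel. At blocklength $n$ there are $k_n$ users (a positive integer depending on $n$). User $i$ has a message $W_i$; the messages are independent and uniform on $\{1,\ldots,M_n\}$. User $i$ sends a codeword $\mathbf{x}_i(W_i)\in\mathbb{R}^n$ and the receiver observes $\mathbf{Y}=\sum_{i=1}^{k_n}\mathbf{x}_i(W_i)+\mathbf{Z}$, where $\mathbf{Z}$ has $n$ i.i.d. $\mathcal{N}(0,N_0/2)$ components, independent of the messages; $N_0>0$ is fixed. Codes. A symmetric $(n,M_n,E_n,\epsilon)$ code consists of encoding functions $w\mapsto\mathbf{x}_i(w)$, $i=1,\ldots,k_n$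 (one codebook per user), with $\sum_{j=1}^n x_{ij}(w)^2\le E_n$ for all $w$, and a decoding function mapping $\mathbf{Y}$ to $(\hat W_1,\ldots,\hat W_{k_n})$ whose joint probability of error satisfies $P_e^{(n)}=\Pr\{(\hat W_1,\ldots,\hat W_{k_n})\ne(W_1,\ldots,W_{k_n})\}\le\epsilon$. A code uses orthogonal codebooks if for every user $i$ the inner product between $\mathbf{x}_i(w)$ and $\mathbf{x}_i(w')$ is zero for all $w\ne w'$ in $\{1,\ldots,M_n\}$. It uses an orthogonal-access scheme if, for any two distinct users $i$ and $j$, the inner product between $\mathbf{x}_i(w)$ and $\mathbf{x}_j(w')$ is zero for all $w,w'\in\{1,\ldots,M_n\}$. A rate per unit-energy $\dot R$ is achievable with a class of codes if for every $0<\epsilon<1$ and every $\delta>0$ there exists $n_0$ such that for every $n\ge n_0$ there is an $(n,M_n,E_n,\epsilon)$ code in the class with $\frac{\log M_n}{E_n}>\dot R-\delta$. $\dot{C}_{\bot\bot}$ is the supremum of the rates per unit-energy achievable with codes that use both an orthogonal-access scheme and orthogonal codebooks. *)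

theory Defs
  imports "HOL-Probability.Probability" "HOL-Library.Landau_Symbols"
begin

text \<open>
  Users, messages and channel uses are numbered from \<open>1\<close>: for codebooks \<open>x\<close>, the real number
  \<open>x i w j\<close> is the \<open>j\<close>-th component of the codeword that user \<open>i\<close> sends for message \<open>w\<close>.
  Only indices in \<open>{1..k}\<close>, \<open>{1..M}\<close> and \<open>{1..n}\<close> are relevant.
\<close>

type_synonym codebooks = "nat \<Rightarrow> nat \<Rightarrow> nat \<Rightarrow> real"

definition dot :: "nat \<Rightarrow> (nat \<Rightarrow> real) \<Rightarrow> (nat \<Rightarrow> real) \<Rightarrow> real" where
  "dot n u v = (\<Sum>j=1..n. u j * v j)"

definition message_measure :: "nat \<Rightarrow> nat \<Rightarrow> (nat \<Rightarrow> nat) measure" where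
  "message_measure k M = Pi\<^sub>M {1..k} (\<lambda>_. uniform_count_measure {1..M})"

text \<open>The second argument of \<^const>\<open>normal_density\<close> is the standard deviation, so the variance
  of each noise component is \<open>N0 / 2\<close>.\<close>

definition noise_measure :: "real \<Rightarrow> nat \<Rightarrow> (nat \<Rightarrow> real) measure" where
  "noise_measure N0 n = Pi\<^sub>M {1..n} (\<lambda>_. density lborel (normal_density 0 (sqrt (N0 / 2))))"

definition channel_output ::
  "nat \<Rightarrow> nat \<Rightarrow> codebooks \<Rightarrow> (nat \<Rightarrow> nat) \<Rightarrow> (nat \<Rightarrow> real) \<Rightarrow> nat \<Rightarrow> real" where
  "channel_output k n x W Z = (\<lambda>j\<in>{1..n}. (\<Sum>i=1..k. x i (W i) j) + Z j)"

definition is_decoder ::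
  "nat \<Rightarrow> nat \<Rightarrow> nat \<Rightarrow> ((nat \<Rightarrow> real) \<Rightarrow> nat \<Rightarrow> nat) \<Rightarrow> bool" where
  "is_decoder k n M g \<longleftrightarrow>
     g \<in> measurable (Pi\<^sub>M {1..n} (\<lambda>_. borel)) (Pi\<^sub>M {1..k} (\<lambda>_. count_space {1..M}))"

definition error_event ::
  "real \<Rightarrow> nat \<Rightarrow> nat \<Rightarrow> nat \<Rightarrow> codebooks \<Rightarrow> ((nat \<Rightarrow> real) \<Rightarrow> nat \<Rightarrow> nat) \<Rightarrow>
    ((nat \<Rightarrow> nat) \<times> (nat \<Rightarrow> real)) set" where
  "error_event N0 k n M x g =
     {(W, Z) \<in> space (message_measure k M \<Otimes>\<^sub>M noise_measure N0 n).
        g (channel_output k n x W Z) \<noteq> W}"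

definition error_prob ::
  "real \<Rightarrow> nat \<Rightarrow> nat \<Rightarrow> nat \<Rightarrow> codebooks \<Rightarrow> ((nat \<Rightarrow> real) \<Rightarrow> nat \<Rightarrow> nat) \<Rightarrow> real" where
  "error_prob N0 k n M x g =
     measure (message_measure k M \<Otimes>\<^sub>M noise_measure N0 n) (error_event N0 k n M x g)"

text \<open>\<open>E > 0\<close> is required so that the rate per unit-energy \<open>log 2 M / E\<close> is a genuine quotient.\<close>

definition symmetric_code ::
  "real \<Rightarrow> nat \<Rightarrow> nat \<Rightarrow> nat \<Rightarrow> real \<Rightarrow> real \<Rightarrow> codebooks \<Rightarrow>
    ((nat \<Rightarrow> real) \<Rightarrow> nat \<Rightarrow> nat) \<Rightarrow> bool" where
  "symmetric_code N0 k n M E \<epsilon> x g \<longleftrightarrow>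
     M \<ge> 1 \<and> E > 0 \<and>
     (\<forall>i\<in>{1..k}. \<forall>w\<in>{1..M}. (\<Sum>j=1..n. (x i w j)\<^sup>2) \<le> E) \<and>
     is_decoder k n M g \<and>
     error_prob N0 k n M x g \<le> \<epsilon>"

definition orthogonal_codebooks :: "nat \<Rightarrow> nat \<Rightarrow> nat \<Rightarrow> codebooks \<Rightarrow> bool" where
  "orthogonal_codebooks k n M x \<longleftrightarrow>
     (\<forall>i\<in>{1..k}. \<forall>w\<in>{1..M}. \<forall>w'\<in>{1..M}. w \<noteq> w' \<longrightarrow> dot n (x i w) (x i w') = 0)"

definition orthogonal_access :: "nat \<Rightarrow> nat \<Rightarrow> nat \<Rightarrow> codebooks \<Rightarrow> bool" where
  "orthogonal_access k n M x \<longleftrightarrow>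
     (\<forall>i\<in>{1..k}. \<forall>j\<in>{1..k}. i \<noteq> j \<longrightarrow>
        (\<forall>w\<in>{1..M}. \<forall>w'\<in>{1..M}. dot n (x i w) (x j w') = 0))"

text \<open>A class of codes is given by a predicate on the number of users, the blocklength, the number
  of messages and the codebooks.\<close>

definition achievable_rate ::
  "(nat \<Rightarrow> nat \<Rightarrow> nat \<Rightarrow> codebooks \<Rightarrow> bool) \<Rightarrow> real \<Rightarrow> (nat \<Rightarrow> nat) \<Rightarrow> real \<Rightarrow> bool" where
  "achievable_rate cls N0 k R \<longleftrightarrow>
     (\<forall>\<epsilon> \<delta>. 0 < \<epsilon> \<and> \<epsilon> < 1 \<and> \<delta> > 0 \<longrightarrow>
        (\<exists>n0. \<forall>n\<ge>n0. \<exists>M E x g.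
           symmetric_code N0 (k n) n M E \<epsilon> x g \<and> cls (k n) n M x \<and>
           log 2 (real M) / E > R - \<delta>))"

text \<open>The supremum is taken in \<^typ>\<open>ereal\<close>, so that it is meaningful without knowing
  beforehand that the achievable rates are bounded.\<close>

definition orthogonal_capacity :: "real \<Rightarrow> (nat \<Rightarrow> nat) \<Rightarrow> ereal" where
  "orthogonal_capacity N0 k =
     (SUP R \<in> {R. achievable_rate
        (\<lambda>k n M x. orthogonal_access k n M x \<and> orthogonal_codebooks k n M x) N0 k R}. ereal R)"

text \<open>The joint law of messages and noise is a probability measure, and the error event is
  measurable, so \<^const>\<open>error_prob\<close> is the probability of a genuine event.\<close>

lemma prob_space_message_noise:
  assumes "N0 > 0" "M \<ge> 1"
  shows "prob_space (message_measure k M \<Otimes>\<^sub>M noise_measure N0 n)"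
proof -
  interpret A: prob_space "uniform_count_measure {1..M}"
    using assms by (intro prob_space_uniform_count_measure) auto
  interpret B: prob_space "density lborel (normal_density 0 (sqrt (N0 / 2)))"
    using assms by (intro prob_space_normal_density) auto
  interpret PA: product_prob_space "\<lambda>_::nat. uniform_count_measure {1..M}" "{1..k}" ..
  interpret PB: product_prob_space
    "\<lambda>_::nat. density lborel (normal_density 0 (sqrt (N0 / 2)))" "{1..n}" ..
  interpret pair_prob_space "message_measure k M" "noise_measure N0 n"
    unfolding message_measure_def noise_measure_def ..
  show ?thesis by (fact P.prob_space_axioms)
qed

lemma sets_message_measure:
  "sets (message_measure k M) = sets (count_space ({1..k} \<rightarrow>\<^sub>E {1..M}))"
proof -
  have "sets (message_measure k M) = sets (Pi\<^sub>M {1..k} (\<lambda>_. count_space {1..M}))"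
    unfolding message_measure_def
    by (intro sets_PiM_cong) (auto simp: sets_uniform_count_measure)
  also have "\<dots> = sets (count_space ({1..k} \<rightarrow>\<^sub>E {1..M}))"
    by (subst count_space_PiM_finite) auto
  finally show ?thesis .
qed

lemma error_event_measurable:
  assumes "is_decoder k n M g"
  shows "error_event N0 k n M x g \<in> sets (message_measure k M \<Otimes>\<^sub>M noise_measure N0 n)"
proof -
  let ?S = "{1..k} \<rightarrow>\<^sub>E {1..M}"
  let ?P = "message_measure k M \<Otimes>\<^sub>M noise_measure N0 n"
  have sp: "space (message_measure k M) = ?S"
    using sets_eq_imp_space_eq[OF sets_message_measure] by simp
  have fin: "finite ?S" by (intro finite_PiE) auto
  have g: "g \<in> measurable (Pi\<^sub>M {1..n} (\<lambda>_. borel)) (count_space ?S)"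
    using assms unfolding is_decoder_def by (subst (asm) count_space_PiM_finite) auto
  have out: "channel_output k n x W \<in> measurable (noise_measure N0 n) (Pi\<^sub>M {1..n} (\<lambda>_. borel))" for W
    unfolding channel_output_def noise_measure_def
  proof (rule measurable_restrict)
    fix j assume "j \<in> {1..n}"
    then have "(\<lambda>Z. Z j) \<in> borel_measurable
        (Pi\<^sub>M {1..n} (\<lambda>_. density lborel (normal_density 0 (sqrt (N0 / 2)))))"
      using measurable_component_singleton[of j "{1..n}"
        "\<lambda>_. density lborel (normal_density 0 (sqrt (N0 / 2)))"] by simp
    then show "(\<lambda>Z. (\<Sum>i=1..k. x i (W i) j) + Z j) \<in> borel_measurable
        (Pi\<^sub>M {1..n} (\<lambda>_. density lborel (normal_density 0 (sqrt (N0 / 2)))))"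
      by simp
  qed
  have slice: "{W} \<times> {Z \<in> space (noise_measure N0 n). g (channel_output k n x W Z) \<noteq> W} \<in> sets ?P"
    if "W \<in> ?S" for W
  proof (rule pair_measureI)
    show "{W} \<in> sets (message_measure k M)"
      using that by (simp add: sets_message_measure)
    have "(\<lambda>Z. g (channel_output k n x W Z)) \<in> measurable (noise_measure N0 n) (count_space ?S)"
      by (rule measurable_compose[OF out g])
    from measurable_sets[OF this, of "?S - {W}"]
    have "(\<lambda>Z. g (channel_output k n x W Z)) -` (?S - {W}) \<inter> space (noise_measure N0 n)
        \<in> sets (noise_measure N0 n)" by simp
    also have "(\<lambda>Z. g (channel_output k n x W Z)) -` (?S - {W}) \<inter> space (noise_measure N0 n)
        = {Z \<in> space (noise_measure N0 n). g (channel_output k n x W Z) \<noteq> W}"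
      using measurable_space[OF measurable_compose[OF out g]] by auto
    finally show "{Z \<in> space (noise_measure N0 n). g (channel_output k n x W Z) \<noteq> W}
        \<in> sets (noise_measure N0 n)" .
  qed
  have "error_event N0 k n M x g =
      (\<Union>W\<in>?S. {W} \<times> {Z \<in> space (noise_measure N0 n). g (channel_output k n x W Z) \<noteq> W})"
    unfolding error_event_def by (auto simp: space_pair_measure sp)
  also have "\<dots> \<in> sets ?P"
    using slice fin by (intro sets.finite_UN) auto
  finally show ?thesis .
qed

end

theory Submission
  imports Defs
begin

text \<open>
  Achievability: with \<open>M = n div k\<close> messages, energy concentrated on a single channel use per codeword
  and per-user maximum detection, Gallager's bound gives a joint error probability of at most
  \<open>k * M powr \<rho> * exp (- E / N0 * \<rho> / (1 + \<rho>))\<close> for every \<open>0 \<le> \<rho> \<le> 1\<close>.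

  Converse: let \<open>X i w\<close> be the likelihood ratio of codeword \<open>w\<close> of user \<open>i\<close> against pure noise. Under
  pure noise orthogonality makes all \<open>X i w\<close> independent, and the probability of correct joint decoding
  is at most the expectation of \<open>\<Prod>i. (Max w. X i w) / M\<close>, hence a product over the users. Lower bounds
  on the expectation of \<open>(\<Sum>w. X i w) - (Max w. X i w)\<close> bound each factor by
  \<open>1 - C * M powr (- a)\<close>. Orthogonality in \<open>n\<close> dimensions forces \<open>k * M\<close> to be of order at most \<open>n\<close>,
  so that \<open>k * M powr (- a)\<close> is unbounded when \<open>k\<close> grows like \<open>n powr c\<close> with \<open>a < c / (1 - c)\<close>.
\<close>

section \<open>Gaussian vectors\<close>

text \<open>The formula is the error exponent of orthogonal signalling solved for the energy. At
  energy \<kappa> N0 ln M one user errs with probability about M^(-a), where a = (sqrt \<kappa> -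
  1)^2 for 1 \<le> \<kappa> \<le> 4 and a = \<kappa>/2 - 1 for \<kappa> \<ge> 4: Gallager's exponent
  at its maximizer \<rho> = sqrt \<kappa> - 1, respectively at the end point \<rho> = 1. With M of
  order n/k, hence n^(1-c), k users can succeed together if a exceeds c/(1-c) and fail if it is
  smaller. The branches meet at \<kappa> = 4, a = 1, that is c = 1/2. Subpolynomial k needs only a >
  0, that is \<kappa> > 1. The obstacle in the converse is the freedom of the code: M need not grow
  or be of order n/k, and codewords may be short or zero. So each bound needs one constant for all M
  \<ge> 2, must tolerate shorter codewords, and the number of nonzero codewords has to be derived
  from the error probability before the dimension can limit k M. Under pure noise each likelihood
  ratio has mean 1, so the sum over w has mean M, and what the maximum misses of it is the loss of
  that user.\<close>

definition gauss :: "real \<Rightarrow> real measure" where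
  "gauss N0 = density lborel (normal_density 0 (sqrt (N0 / 2)))"

abbreviation gauss_vec :: "real \<Rightarrow> 'i set \<Rightarrow> ('i \<Rightarrow> real) measure" where
  "gauss_vec N0 I \<equiv> Pi\<^sub>M I (\<lambda>_. gauss N0)"

abbreviation lborel_vec :: "'i set \<Rightarrow> ('i \<Rightarrow> real) measure" where
  "lborel_vec I \<equiv> Pi\<^sub>M I (\<lambda>_. lborel)"

lemma noise_measure_eq: "noise_measure N0 n = gauss_vec N0 {1..n}"
  by (simp add: noise_measure_def gauss_def)

lemma sets_gauss [measurable_cong, simp]: "sets (gauss N0) = sets borel"
  by (simp add: gauss_def)

lemma space_gauss [simp]: "space (gauss N0) = UNIV"
  by (simp add: gauss_def)

lemma prob_space_gauss: "N0 > 0 \<Longrightarrow> prob_space (gauss N0)"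
  unfolding gauss_def by (intro prob_space_normal_density) auto

lemma product_prob_space_gauss: "N0 > 0 \<Longrightarrow> product_prob_space (\<lambda>_. gauss N0)"
  by (intro product_prob_spaceI prob_space_gauss)

lemma prob_space_gauss_vec: "N0 > 0 \<Longrightarrow> prob_space (gauss_vec N0 I)"
  by (intro prob_space_PiM prob_space_gauss)

lemma product_sigma_finite_lborel: "product_sigma_finite (\<lambda>_. lborel :: real measure)"
  by unfold_locales

lemma sigma_finite_lborel_vec: "finite I \<Longrightarrow> sigma_finite_measure (lborel_vec I)"
  by (rule product_sigma_finite.sigma_finite[OF product_sigma_finite_lborel])

lemma gauss_density:
  assumes "N0 > 0"
  shows "normal_density 0 (sqrt (N0 / 2)) x = exp (- (x\<^sup>2 / N0)) / sqrt (pi * N0)"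
  using assms by (simp add: normal_density_def)

definition gauss_dens :: "real \<Rightarrow> 'i set \<Rightarrow> ('i \<Rightarrow> real) \<Rightarrow> real" where
  "gauss_dens N0 I z = exp (- (\<Sum>i\<in>I. (z i)\<^sup>2) / N0) / sqrt (pi * N0) ^ card I"

lemma borel_measurable_gauss_dens [measurable]:
  "gauss_dens N0 I \<in> borel_measurable (lborel_vec I)"
  unfolding gauss_dens_def by measurable

lemma gauss_vec_eq_density:
  assumes "N0 > 0" "finite I"
  shows "gauss_vec N0 I = density (lborel_vec I) (\<lambda>z. ennreal (gauss_dens N0 I z))"
proof -
  interpret L: product_sigma_finite "\<lambda>_. lborel :: real measure"
    by (rule product_sigma_finite_lborel)
  interpret G: product_prob_space "\<lambda>_. gauss N0"
    by (rule product_prob_space_gauss[OF assms(1)])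
  let ?f = "normal_density 0 (sqrt (N0 / 2))"
  have dens: "ennreal (gauss_dens N0 I z) = (\<Prod>i\<in>I. ennreal (?f (z i)))" for z
    using assms by (simp add: gauss_dens_def prod_ennreal gauss_density prod_dividef exp_sum
        sum_negf sum_divide_distrib flip: sum_negf)
  have "density (lborel_vec I) (\<lambda>z. ennreal (gauss_dens N0 I z)) = gauss_vec N0 I"
  proof (rule G.PiM_eqI[OF assms(2)])
    show "sets (density (lborel_vec I) (\<lambda>z. ennreal (gauss_dens N0 I z))) = sets (gauss_vec N0 I)"
      by (simp cong: sets_PiM_cong)
  next
    fix A assume "\<And>i. i \<in> I \<Longrightarrow> A i \<in> sets (gauss N0)"
    then have A: "\<And>i. i \<in> I \<Longrightarrow> A i \<in> sets lborel" by simp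
    have [measurable]: "Pi\<^sub>E I A \<in> sets (lborel_vec I)"
      using A assms(2) by (intro sets_PiM_I_finite) auto
    have "emeasure (density (lborel_vec I) (\<lambda>z. ennreal (gauss_dens N0 I z))) (Pi\<^sub>E I A)
        = (\<integral>\<^sup>+z. ennreal (gauss_dens N0 I z) * indicator (Pi\<^sub>E I A) z \<partial>lborel_vec I)"
      by (subst emeasure_density) auto
    also have "\<dots> = (\<integral>\<^sup>+z. (\<Prod>i\<in>I. ennreal (?f (z i)) * indicator (A i) (z i)) \<partial>lborel_vec I)"
    proof (rule nn_integral_cong)
      fix z assume z: "z \<in> space (lborel_vec I)"
      have "indicator (Pi\<^sub>E I A) z = (\<Prod>i\<in>I. indicator (A i) (z i) :: ennreal)"
      proof (cases "z \<in> Pi\<^sub>E I A")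
        case False
        then obtain i where "i \<in> I" "z i \<notin> A i"
          using z by (auto simp: space_PiM PiE_iff)
        with False assms(2) show ?thesis by (simp add: prod_zero_iff) (metis indicator_simps(2))
      qed (auto simp: PiE_iff)
      then show "ennreal (gauss_dens N0 I z) * indicator (Pi\<^sub>E I A) z
          = (\<Prod>i\<in>I. ennreal (?f (z i)) * indicator (A i) (z i))"
        by (simp add: dens prod.distrib)
    qed
    also have "\<dots> = (\<Prod>i\<in>I. \<integral>\<^sup>+x. ennreal (?f x) * indicator (A i) x \<partial>lborel)"
      using A assms(2) by (intro L.product_nn_integral_prod) auto
    also have "\<dots> = (\<Prod>i\<in>I. emeasure (gauss N0) (A i))"
      using A by (intro prod.cong refl) (simp add: gauss_def emeasure_density)
    finally show "emeasure (density (lborel_vec I) (\<lambda>z. ennreal (gauss_dens N0 I z))) (Pi\<^sub>E I A)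
      = (\<Prod>i\<in>I. emeasure (gauss N0) (A i))" .
  qed
  then show ?thesis ..
qed

lemma nn_integral_gauss_vec:
  assumes "N0 > 0" "finite I" and [measurable]: "f \<in> borel_measurable (lborel_vec I)"
  shows "(\<integral>\<^sup>+z. f z \<partial>gauss_vec N0 I) = (\<integral>\<^sup>+z. ennreal (gauss_dens N0 I z) * f z \<partial>lborel_vec I)"
  unfolding gauss_vec_eq_density[OF assms(1,2)] by (rule nn_integral_density) measurable

lemma nn_integral_lborel_vec_shift:
  fixes v :: "'i \<Rightarrow> real"
  assumes "finite I" and [measurable]: "f \<in> borel_measurable (lborel_vec I)"
  shows "(\<integral>\<^sup>+z. f (\<lambda>i\<in>I. z i + v i) \<partial>lborel_vec I) = (\<integral>\<^sup>+z. f z \<partial>lborel_vec I)"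
proof -
  interpret L: product_sigma_finite "\<lambda>_. lborel :: real measure"
    by (rule product_sigma_finite_lborel)
  let ?T = "\<lambda>z. \<lambda>i\<in>I. z i + v i"
  have T [measurable]: "?T \<in> measurable (lborel_vec I) (lborel_vec I)" by measurable
  have "distr (lborel_vec I) (lborel_vec I) ?T = lborel_vec I"
  proof (rule L.PiM_eqI[OF assms(1)])
    fix A assume A: "\<And>i. i \<in> I \<Longrightarrow> A i \<in> sets (lborel :: real measure)"
    have pre: "(\<lambda>x. v i + x) -` A i \<in> sets lborel" if "i \<in> I" for i
      using measurable_sets[of "\<lambda>x. v i + x" lborel lborel, OF _ A[OF that]] by simp
    have "emeasure (distr (lborel_vec I) (lborel_vec I) ?T) (Pi\<^sub>E I A)
        = emeasure (lborel_vec I) (Pi\<^sub>E I (\<lambda>i. (\<lambda>x. v i + x) -` A i))"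
    proof (subst emeasure_distr[OF T])
      show "Pi\<^sub>E I A \<in> sets (lborel_vec I)" using A assms(1) by (intro sets_PiM_I_finite) auto
      have "?T -` Pi\<^sub>E I A \<inter> space (lborel_vec I) = Pi\<^sub>E I (\<lambda>i. (\<lambda>x. v i + x) -` A i)"
        by (auto simp: space_PiM PiE_iff add.commute)
      then show "emeasure (lborel_vec I) (?T -` Pi\<^sub>E I A \<inter> space (lborel_vec I))
          = emeasure (lborel_vec I) (Pi\<^sub>E I (\<lambda>i. (\<lambda>x. v i + x) -` A i))" by simp
    qed
    also have "\<dots> = (\<Prod>i\<in>I. emeasure lborel ((\<lambda>x. v i + x) -` A i))"
      using pre assms(1) by (intro L.emeasure_PiM) auto
    also have "\<dots> = (\<Prod>i\<in>I. emeasure lborel (A i))"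
    proof (rule prod.cong[OF refl])
      fix i assume "i \<in> I"
      have "emeasure lborel (A i) = emeasure (distr lborel borel ((+) (v i))) (A i)"
        by (simp add: lborel_distr_plus)
      then show "emeasure lborel ((\<lambda>x. v i + x) -` A i) = emeasure lborel (A i)"
        using A[OF \<open>i \<in> I\<close>] by (simp add: emeasure_distr)
    qed
    finally show "emeasure (distr (lborel_vec I) (lborel_vec I) ?T) (Pi\<^sub>E I A)
      = (\<Prod>i\<in>I. emeasure lborel (A i))" .
  qed simp
  then have "(\<integral>\<^sup>+z. f z \<partial>lborel_vec I) = (\<integral>\<^sup>+z. f z \<partial>distr (lborel_vec I) (lborel_vec I) ?T)"
    by simp
  also have "\<dots> = (\<integral>\<^sup>+z. f (?T z) \<partial>lborel_vec I)"
    by (rule nn_integral_distr) measurable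
  finally show ?thesis ..
qed

text \<open>Completing the square: the noise density at \<open>z\<close> is the density at
  \<open>z + v\<close> times the likelihood ratio of signal \<open>v\<close> against pure noise,
  evaluated at \<open>z + v\<close>; translation invariance of Lebesgue measure then removes the
  shift. This change of measure is behind both the converse and the exponential moments.\<close>

lemma nn_integral_gauss_vec_shift:
  fixes v :: "'i \<Rightarrow> real"
  assumes N0: "N0 > 0" and I: "finite I" and f [measurable]: "f \<in> borel_measurable (lborel_vec I)"
  shows "(\<integral>\<^sup>+z. f (\<lambda>i\<in>I. z i + v i) \<partial>gauss_vec N0 I) =
    (\<integral>\<^sup>+z. f z * ennreal (exp ((2 * (\<Sum>i\<in>I. v i * z i) - (\<Sum>i\<in>I. (v i)\<^sup>2)) / N0)) \<partial>gauss_vec N0 I)"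
    (is "_ = (\<integral>\<^sup>+z. f z * ennreal (?e z) \<partial>_)")
proof -
  let ?T = "\<lambda>z. \<lambda>i\<in>I. z i + v i"
  have [measurable]: "?T \<in> measurable (lborel_vec I) (lborel_vec I)" by measurable
  have e [measurable]: "?e \<in> borel_measurable (lborel_vec I)" by measurable
  have eq: "gauss_dens N0 I z = gauss_dens N0 I (?T z) * ?e (?T z)" for z
  proof -
    have "- (\<Sum>i\<in>I. (z i)\<^sup>2) = - (\<Sum>i\<in>I. (z i + v i)\<^sup>2) + (2 * (\<Sum>i\<in>I. v i * (z i + v i)) - (\<Sum>i\<in>I. (v i)\<^sup>2))"
      by (simp add: power2_eq_square algebra_simps sum.distrib sum_distrib_left)
    then have "- (\<Sum>i\<in>I. (z i)\<^sup>2) / N0 =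
        - (\<Sum>i\<in>I. (?T z i)\<^sup>2) / N0 + (2 * (\<Sum>i\<in>I. v i * ?T z i) - (\<Sum>i\<in>I. (v i)\<^sup>2)) / N0"
      by (simp add: add_divide_distrib diff_divide_distrib)
    then show ?thesis
      by (simp add: gauss_dens_def exp_add[symmetric])
  qed
  have nn: "0 \<le> gauss_dens N0 I z" for z using N0 by (simp add: gauss_dens_def)
  have "(\<integral>\<^sup>+z. f (?T z) \<partial>gauss_vec N0 I)
      = (\<integral>\<^sup>+z. ennreal (gauss_dens N0 I z) * f (?T z) \<partial>lborel_vec I)"
    by (rule nn_integral_gauss_vec[OF N0 I]) measurable
  also have "\<dots> = (\<integral>\<^sup>+z. ennreal (gauss_dens N0 I (?T z)) * (f (?T z) * ennreal (?e (?T z))) \<partial>lborel_vec I)"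
    by (intro nn_integral_cong, subst eq) (simp add: ennreal_mult nn mult_ac)
  also have "\<dots> = (\<integral>\<^sup>+z. ennreal (gauss_dens N0 I z) * (f z * ennreal (?e z)) \<partial>lborel_vec I)"
    by (rule nn_integral_lborel_vec_shift[OF I, where f="\<lambda>z. ennreal (gauss_dens N0 I z) * (f z * ennreal (?e z))"])
       measurable
  also have "\<dots> = (\<integral>\<^sup>+z. f z * ennreal (?e z) \<partial>gauss_vec N0 I)"
    by (rule nn_integral_gauss_vec[OF N0 I, symmetric]) measurable
  finally show ?thesis .
qed

text \<open>With \<open>f\<close> constant 1 and \<open>v = N0 / 2 * a\<close>, the change of
  measure says that a likelihood ratio integrates to 1; its constant factor is the reciprocal of the
  claimed value.\<close>

lemma nn_integral_gauss_vec_exp: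
  assumes N0: "N0 > 0" and I: "finite I"
  shows "(\<integral>\<^sup>+z. ennreal (exp (\<Sum>i\<in>I. a i * z i)) \<partial>gauss_vec N0 I) = ennreal (exp (N0 / 4 * (\<Sum>i\<in>I. (a i)\<^sup>2)))"
proof -
  interpret prob_space "gauss_vec N0 I" by (rule prob_space_gauss_vec[OF N0])
  let ?v = "\<lambda>i. N0 / 2 * a i"
  have "1 = (\<integral>\<^sup>+z. ennreal (exp ((2 * (\<Sum>i\<in>I. ?v i * z i) - (\<Sum>i\<in>I. (?v i)\<^sup>2)) / N0)) \<partial>gauss_vec N0 I)"
    using nn_integral_gauss_vec_shift[OF N0 I, of "\<lambda>_. 1" ?v] by (simp add: emeasure_space_1)
  also have "\<dots> = (\<integral>\<^sup>+z. ennreal (exp (\<Sum>i\<in>I. a i * z i)) * ennreal (exp (- (N0 / 4 * (\<Sum>i\<in>I. (a i)\<^sup>2)))) \<partial>gauss_vec N0 I)"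
  proof (intro nn_integral_cong)
    fix z
    have "(2 * (\<Sum>i\<in>I. ?v i * z i) - (\<Sum>i\<in>I. (?v i)\<^sup>2)) / N0 = (\<Sum>i\<in>I. a i * z i) - N0 / 4 * (\<Sum>i\<in>I. (a i)\<^sup>2)"
    proof -
      have *: "(2 * (N0 / 2 * A) - (N0 / 2)\<^sup>2 * B) / N0 = A - N0 / 4 * B" for A B
        using N0 by (simp add: field_simps power2_eq_square)
      have "(\<Sum>i\<in>I. ?v i * z i) = N0 / 2 * (\<Sum>i\<in>I. a i * z i)"
        by (simp add: sum_distrib_left mult_ac)
      moreover have "(\<Sum>i\<in>I. (?v i)\<^sup>2) = (N0 / 2)\<^sup>2 * (\<Sum>i\<in>I. (a i)\<^sup>2)"
        by (simp only: power_mult_distrib sum_distrib_left)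
      ultimately show ?thesis
        using *[of "\<Sum>i\<in>I. a i * z i" "\<Sum>i\<in>I. (a i)\<^sup>2"] by (simp only:)
    qed
    moreover have "ennreal (exp (A - B)) = ennreal (exp A) * ennreal (exp (- B))" for A B :: real
      by (simp add: exp_add ennreal_mult diff_conv_add_uminus del: add_uminus_conv_diff)
    ultimately show "ennreal (exp ((2 * (\<Sum>i\<in>I. ?v i * z i) - (\<Sum>i\<in>I. (?v i)\<^sup>2)) / N0)) =
      ennreal (exp (\<Sum>i\<in>I. a i * z i)) * ennreal (exp (- (N0 / 4 * (\<Sum>i\<in>I. (a i)\<^sup>2))))"
      by (simp only:)
  qed
  also have "\<dots> = (\<integral>\<^sup>+z. ennreal (exp (\<Sum>i\<in>I. a i * z i)) \<partial>gauss_vec N0 I) * ennreal (exp (- (N0 / 4 * (\<Sum>i\<in>I. (a i)\<^sup>2))))"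
    by (rule nn_integral_multc) measurable
  finally have *: "1 =
    (\<integral>\<^sup>+z. ennreal (exp (\<Sum>i\<in>I. a i * z i)) \<partial>gauss_vec N0 I) * ennreal (exp (- (N0 / 4 * (\<Sum>i\<in>I. (a i)\<^sup>2))))" .
  have "ennreal (exp (- A)) * ennreal (exp A) = 1" for A :: real
    by (simp add: exp_minus flip: ennreal_mult)
  then show ?thesis
    using arg_cong[OF *, of "\<lambda>x. x * ennreal (exp (N0 / 4 * (\<Sum>i\<in>I. (a i)\<^sup>2)))"]
    by (simp only: mult.assoc mult_1_left mult_1_right)
qed

text \<open>The orthonormality hypothesis allows vanishing \<open>v j\<close> (those with \<open>j \<notin> K\<close>), on whose coordinates
  \<open>f\<close> must not depend. With \<open>V u = (\<Sum>j. u j * v j)\<close> and \<open>V\<^sup>T\<close> its transpose, the quarter turn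
  exchanging \<open>u\<close> with \<open>V\<^sup>T z\<close> is a product of three shears of \<open>(z, u)\<close>; each shear preserves
  Lebesgue measure by Fubini and translation invariance, and the product preserves the norm.\<close>

lemma nn_integral_gauss_vec_orthonormal:
  fixes v :: "'j \<Rightarrow> 'i \<Rightarrow> real" and f :: "('j \<Rightarrow> real) \<Rightarrow> ennreal"
  assumes N0: "N0 > 0" and I: "finite I" and J: "finite J"
    and f [measurable]: "f \<in> borel_measurable (lborel_vec J)"
    and orth: "\<And>j l. j \<in> J \<Longrightarrow> l \<in> J \<Longrightarrow>
      (\<Sum>i\<in>I. v j i * v l i) = (if j = l \<and> j \<in> K then 1 else 0)"
    and indep: "\<And>u u'. (\<And>j. j \<in> J \<inter> K \<Longrightarrow> u j = u' j) \<Longrightarrow> f u = f u'"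
  shows "(\<integral>\<^sup>+z. f (\<lambda>j\<in>J. \<Sum>i\<in>I. v j i * z i) \<partial>gauss_vec N0 I) = (\<integral>\<^sup>+u. f u \<partial>gauss_vec N0 J)"
proof -
  interpret SI: sigma_finite_measure "lborel_vec I" by (rule sigma_finite_lborel_vec[OF I])
  interpret SJ: sigma_finite_measure "lborel_vec J" by (rule sigma_finite_lborel_vec[OF J])
  interpret P: pair_sigma_finite "lborel_vec I" "lborel_vec J" ..
  interpret GI: prob_space "gauss_vec N0 I" by (rule prob_space_gauss_vec[OF N0])
  interpret GJ: prob_space "gauss_vec N0 J" by (rule prob_space_gauss_vec[OF N0])
  define pr where "pr z j = (\<Sum>i\<in>I. v j i * z i)" for z :: "'i \<Rightarrow> real" and j
  define em where "em u i = (\<Sum>j\<in>J. v j i * u j)" for u :: "'j \<Rightarrow> real" and i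
  \<comment> \<open>The double integral of \<open>F\<close> is evaluated twice: as it stands,
    \<open>z\<close> integrates out and leaves the right-hand side; after the shears,
    \<open>u\<close> integrates out and leaves the left-hand side.\<close>
  define F where "F z u = ennreal (gauss_dens N0 I z) * (ennreal (gauss_dens N0 J u) * f u)" for z u
  define F1 where "F1 z u = F (\<lambda>i\<in>I. z i - em u i) u" for z u
  define F2 where "F2 z u = F1 z (\<lambda>j\<in>J. u j + pr z j)" for z u
  define F3 where "F3 z u = F2 (\<lambda>i\<in>I. z i - em u i) u" for z u
  have mI [measurable]: "(\<lambda>p. \<lambda>i\<in>I. fst p i - em (snd p) i) \<in> measurable (lborel_vec I \<Otimes>\<^sub>M lborel_vec J) (lborel_vec I)"
    unfolding em_def by measurable
  have mJ [measurable]: "(\<lambda>p. \<lambda>j\<in>J. snd p j + pr (fst p) j) \<in> measurable (lborel_vec I \<Otimes>\<^sub>M lborel_vec J) (lborel_vec J)"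
    unfolding pr_def by measurable
  have mF [measurable]: "(\<lambda>p. F (fst p) (snd p)) \<in> borel_measurable (lborel_vec I \<Otimes>\<^sub>M lborel_vec J)"
    unfolding F_def by measurable
  have mF1 [measurable]: "(\<lambda>p. F1 (fst p) (snd p)) \<in> borel_measurable (lborel_vec I \<Otimes>\<^sub>M lborel_vec J)"
    unfolding F1_def using measurable_compose[OF measurable_Pair[OF mI measurable_snd] mF] by simp
  have mF2 [measurable]: "(\<lambda>p. F2 (fst p) (snd p)) \<in> borel_measurable (lborel_vec I \<Otimes>\<^sub>M lborel_vec J)"
    unfolding F2_def using measurable_compose[OF measurable_Pair[OF measurable_fst mJ] mF1] by simp
  have secI: "(\<lambda>z. G z u) \<in> borel_measurable (lborel_vec I)"
    if "(\<lambda>p. G (fst p) (snd p)) \<in> borel_measurable (lborel_vec I \<Otimes>\<^sub>M lborel_vec J)"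
      "u \<in> space (lborel_vec J)" for G :: "('i \<Rightarrow> real) \<Rightarrow> ('j \<Rightarrow> real) \<Rightarrow> ennreal" and u
    using measurable_compose[OF measurable_Pair2'[OF that(2)] that(1)] by simp
  have secJ: "(\<lambda>u. G z u) \<in> borel_measurable (lborel_vec J)"
    if "(\<lambda>p. G (fst p) (snd p)) \<in> borel_measurable (lborel_vec I \<Otimes>\<^sub>M lborel_vec J)"
      "z \<in> space (lborel_vec I)" for G :: "('i \<Rightarrow> real) \<Rightarrow> ('j \<Rightarrow> real) \<Rightarrow> ennreal" and z
    using measurable_compose[OF measurable_Pair1'[OF that(2)] that(1)] by simp
  have swap: "(\<integral>\<^sup>+u. \<integral>\<^sup>+z. G z u \<partial>lborel_vec I \<partial>lborel_vec J) = (\<integral>\<^sup>+z. \<integral>\<^sup>+u. G z u \<partial>lborel_vec J \<partial>lborel_vec I)"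
    if "(\<lambda>p. G (fst p) (snd p)) \<in> borel_measurable (lborel_vec I \<Otimes>\<^sub>M lborel_vec J)"
    for G :: "('i \<Rightarrow> real) \<Rightarrow> ('j \<Rightarrow> real) \<Rightarrow> ennreal"
    using P.Fubini[OF that] by simp
  have shiftI: "(\<integral>\<^sup>+z. G (\<lambda>i\<in>I. z i - em u i) \<partial>lborel_vec I) = (\<integral>\<^sup>+z. G z \<partial>lborel_vec I)"
    if "G \<in> borel_measurable (lborel_vec I)" for G u
    using nn_integral_lborel_vec_shift[OF I that, of "\<lambda>i. - em u i"] by simp

  have "(\<integral>\<^sup>+u. \<integral>\<^sup>+z. F z u \<partial>lborel_vec I \<partial>lborel_vec J) = (\<integral>\<^sup>+u. \<integral>\<^sup>+z. F1 z u \<partial>lborel_vec I \<partial>lborel_vec J)"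
    unfolding F1_def by (intro nn_integral_cong shiftI[symmetric] secI mF)
  also have "\<dots> = (\<integral>\<^sup>+z. \<integral>\<^sup>+u. F1 z u \<partial>lborel_vec J \<partial>lborel_vec I)"
    by (rule swap[OF mF1])
  also have "\<dots> = (\<integral>\<^sup>+z. \<integral>\<^sup>+u. F2 z u \<partial>lborel_vec J \<partial>lborel_vec I)"
    unfolding F2_def by (intro nn_integral_cong nn_integral_lborel_vec_shift[OF J, symmetric] secJ mF1)
  also have "\<dots> = (\<integral>\<^sup>+u. \<integral>\<^sup>+z. F2 z u \<partial>lborel_vec I \<partial>lborel_vec J)"
    by (rule swap[OF mF2, symmetric])
  also have "\<dots> = (\<integral>\<^sup>+u. \<integral>\<^sup>+z. F3 z u \<partial>lborel_vec I \<partial>lborel_vec J)"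
    unfolding F3_def by (intro nn_integral_cong shiftI[symmetric] secI mF2)
  also have "\<dots> = (\<integral>\<^sup>+u. \<integral>\<^sup>+z. ennreal (gauss_dens N0 J u) *
      (ennreal (gauss_dens N0 I z) * f (\<lambda>j\<in>J. pr z j)) \<partial>lborel_vec I \<partial>lborel_vec J)"
  proof (intro nn_integral_cong)
    fix u :: "'j \<Rightarrow> real" and z :: "'i \<Rightarrow> real"
    \<comment> \<open>\<open>y\<close> and \<open>w\<close> are the arguments of the two densities
      after the shears. Since V V^T is the coordinate projection onto \<open>K\<close>,
      \<open>w\<close> agrees with V z on \<open>K\<close> and still carries \<open>u\<close> off
      \<open>K\<close>, where \<open>f\<close> must not look.\<close>
    define w where "w j = (if j \<in> K then 0 else u j) + pr z j" for j
    define y where "y i = z i - em u i - em (pr z) i" for i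
    have null: "v j i = 0" if "j \<in> J" "j \<notin> K" "i \<in> I" for j i
      using orth[of j j] that I by (simp add: sum_nonneg_eq_0_iff)
    have pr_em: "pr (\<lambda>i\<in>I. em u i) j = (if j \<in> K then u j else 0)" if "j \<in> J" for u j
    proof -
      have "pr (\<lambda>i\<in>I. em u i) j = (\<Sum>i\<in>I. \<Sum>l\<in>J. v j i * v l i * u l)"
        by (simp add: pr_def em_def sum_distrib_left mult.assoc)
      also have "\<dots> = (\<Sum>l\<in>J. (\<Sum>i\<in>I. v j i * v l i) * u l)"
        by (subst sum.swap) (simp add: sum_distrib_right)
      also have "\<dots> = (\<Sum>l\<in>J. if j = l \<and> j \<in> K then u l else 0)"
        using that by (intro sum.cong refl) (auto simp: orth)
      also have "\<dots> = (\<Sum>l\<in>J. if j = l then (if j \<in> K then u j else 0) else 0)"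
        by (intro sum.cong refl) auto
      finally show ?thesis using J that by simp
    qed
    have pr_diff: "pr (\<lambda>i\<in>I. z i - em u i) j = pr z j - (if j \<in> K then u j else 0)" if "j \<in> J" for j
      using pr_em[OF that, of u] by (simp add: pr_def sum_subtractf right_diff_distrib)
    have em_cong: "em a i = em b i" if "i \<in> I" "\<And>j. j \<in> J \<Longrightarrow> j \<in> K \<Longrightarrow> a j = b j" for a b i
      unfolding em_def using that null by (intro sum.cong refl) (metis mult_eq_0_iff)
    have arg1: "(\<lambda>j\<in>J. u j + pr (\<lambda>i\<in>I. z i - em u i) j) = (\<lambda>j\<in>J. w j)"
      by (rule restrict_ext) (simp add: pr_diff w_def)
    have "em (\<lambda>j\<in>J. w j) i = em (pr z) i" if "i \<in> I" for i
      by (rule em_cong[OF that]) (simp add: w_def)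
    then have arg2: "(\<lambda>i\<in>I. (\<lambda>i\<in>I. z i - em u i) i - em (\<lambda>j\<in>J. w j) i) = (\<lambda>i\<in>I. y i)"
      by (intro restrict_ext) (simp add: y_def)
    have inner: "(\<Sum>i\<in>I. em a i * em b i) = (\<Sum>j\<in>J\<inter>K. a j * b j)" for a b
    proof -
      have "(\<Sum>i\<in>I. em a i * em b i) = (\<Sum>j\<in>J. a j * pr (\<lambda>i\<in>I. em b i) j)"
        unfolding pr_def em_def[of a]
        by (simp add: sum_distrib_right sum_distrib_left, subst sum.swap) (simp add: mult_ac)
      also have "\<dots> = (\<Sum>j\<in>J. if j \<in> K then a j * b j else 0)"
        by (intro sum.cong refl) (simp add: pr_em)
      finally show ?thesis using J by (simp add: sum.inter_restrict)
    qed
    have zem: "(\<Sum>i\<in>I. z i * em a i) = (\<Sum>j\<in>J\<inter>K. a j * pr z j)" for a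
    proof -
      have "(\<Sum>i\<in>I. z i * em a i) = (\<Sum>j\<in>J. a j * pr z j)"
        unfolding pr_def em_def
        by (simp add: sum_distrib_right sum_distrib_left, subst sum.swap) (simp add: mult_ac)
      also have "\<dots> = (\<Sum>j\<in>J. if j \<in> K then a j * pr z j else 0)"
        by (intro sum.cong refl) (simp add: pr_def null)
      finally show ?thesis using J by (simp add: sum.inter_restrict)
    qed
    have "(\<Sum>i\<in>I. (y i)\<^sup>2) = (\<Sum>i\<in>I. z i * z i + em u i * em u i + em (pr z) i * em (pr z) i
        + 2 * (em u i * em (pr z) i) - 2 * (z i * em u i) - 2 * (z i * em (pr z) i))"
      by (intro sum.cong refl) (simp add: y_def power2_eq_square algebra_simps)
    also have "\<dots> = (\<Sum>i\<in>I. (z i)\<^sup>2) + (\<Sum>j\<in>J\<inter>K. (u j)\<^sup>2) - (\<Sum>j\<in>J\<inter>K. (pr z j)\<^sup>2)"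
      by (simp only: sum.distrib sum_subtractf inner zem flip: sum_distrib_left)
        (simp add: power2_eq_square)
    finally have y2: "(\<Sum>i\<in>I. (y i)\<^sup>2) = (\<Sum>i\<in>I. (z i)\<^sup>2) + (\<Sum>j\<in>J\<inter>K. (u j)\<^sup>2) - (\<Sum>j\<in>J\<inter>K. (pr z j)\<^sup>2)" .
    have split: "(\<Sum>j\<in>J. (h j)\<^sup>2) = (\<Sum>j\<in>J\<inter>K. (h j)\<^sup>2) + (\<Sum>j\<in>J-K. (h j)\<^sup>2)" for h :: "'j \<Rightarrow> real"
      using sum.Int_Diff[OF J, of "\<lambda>j. (h j)\<^sup>2" K] by simp
    have "(\<Sum>j\<in>J-K. (w j)\<^sup>2) = (\<Sum>j\<in>J-K. (u j)\<^sup>2)"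
      by (intro sum.cong refl) (simp add: w_def pr_def null)
    moreover have "(\<Sum>j\<in>J\<inter>K. (w j)\<^sup>2) = (\<Sum>j\<in>J\<inter>K. (pr z j)\<^sup>2)"
      by (intro sum.cong refl) (simp add: w_def)
    ultimately have norm: "(\<Sum>i\<in>I. (y i)\<^sup>2) + (\<Sum>j\<in>J. (w j)\<^sup>2) = (\<Sum>i\<in>I. (z i)\<^sup>2) + (\<Sum>j\<in>J. (u j)\<^sup>2)"
      by (simp add: y2 split)
    have dens: "gauss_dens N0 I (\<lambda>i\<in>I. y i) * gauss_dens N0 J (\<lambda>j\<in>J. w j) = gauss_dens N0 J u * gauss_dens N0 I z"
    proof -
      have *: "exp (- A / N0) * exp (- B / N0) = exp (- ((A + B) / N0))" for A B
        by (simp add: exp_add[symmetric] add_divide_distrib)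
      have "exp (- (\<Sum>i\<in>I. (y i)\<^sup>2) / N0) * exp (- (\<Sum>j\<in>J. (w j)\<^sup>2) / N0)
          = exp (- (\<Sum>j\<in>J. (u j)\<^sup>2) / N0) * exp (- (\<Sum>i\<in>I. (z i)\<^sup>2) / N0)"
        unfolding * norm by (simp only: add.commute)
      then show ?thesis by (simp add: gauss_dens_def)
    qed
    have fw: "f (\<lambda>j\<in>J. w j) = f (\<lambda>j\<in>J. pr z j)"
      by (rule indep) (simp add: w_def)
    have nn: "0 \<le> gauss_dens N0 A h" for A :: "'c set" and h
      using N0 by (simp add: gauss_dens_def)
    have "F3 z u = ennreal (gauss_dens N0 I (\<lambda>i\<in>I. y i)) * (ennreal (gauss_dens N0 J (\<lambda>j\<in>J. w j)) * f (\<lambda>j\<in>J. w j))"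
      unfolding F3_def F2_def F1_def F_def arg1 arg2 ..
    also have "\<dots> = ennreal (gauss_dens N0 I (\<lambda>i\<in>I. y i) * gauss_dens N0 J (\<lambda>j\<in>J. w j)) * f (\<lambda>j\<in>J. pr z j)"
      by (simp add: fw ennreal_mult nn mult.assoc)
    also have "\<dots> = ennreal (gauss_dens N0 J u) * (ennreal (gauss_dens N0 I z) * f (\<lambda>j\<in>J. pr z j))"
      unfolding dens by (simp add: ennreal_mult nn mult.assoc)
    finally show "F3 z u = ennreal (gauss_dens N0 J u) * (ennreal (gauss_dens N0 I z) * f (\<lambda>j\<in>J. pr z j))" .
  qed
  also have "\<dots> = (\<integral>\<^sup>+u. ennreal (gauss_dens N0 J u) *
      (\<integral>\<^sup>+z. ennreal (gauss_dens N0 I z) * f (\<lambda>j\<in>J. pr z j) \<partial>lborel_vec I) \<partial>lborel_vec J)"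
    unfolding pr_def by (intro nn_integral_cong nn_integral_cmult) measurable
  also have "\<dots> = (\<integral>\<^sup>+u. ennreal (gauss_dens N0 J u) * 1 \<partial>lborel_vec J) *
      (\<integral>\<^sup>+z. ennreal (gauss_dens N0 I z) * f (\<lambda>j\<in>J. pr z j) \<partial>lborel_vec I)"
    by (subst nn_integral_multc) simp_all
  also have "(\<integral>\<^sup>+u. ennreal (gauss_dens N0 J u) * 1 \<partial>lborel_vec J) = 1"
    using nn_integral_gauss_vec[OF N0 J, of "\<lambda>_. 1"] by (simp add: GJ.emeasure_space_1)
  also have "(\<integral>\<^sup>+z. ennreal (gauss_dens N0 I z) * f (\<lambda>j\<in>J. pr z j) \<partial>lborel_vec I)
      = (\<integral>\<^sup>+z. f (\<lambda>j\<in>J. pr z j) \<partial>gauss_vec N0 I)"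
    unfolding pr_def by (rule nn_integral_gauss_vec[OF N0 I, symmetric]) measurable
  finally have lhs: "(\<integral>\<^sup>+u. \<integral>\<^sup>+z. F z u \<partial>lborel_vec I \<partial>lborel_vec J) = (\<integral>\<^sup>+z. f (\<lambda>j\<in>J. pr z j) \<partial>gauss_vec N0 I)"
    by simp
  have "(\<integral>\<^sup>+u. \<integral>\<^sup>+z. F z u \<partial>lborel_vec I \<partial>lborel_vec J) =
    (\<integral>\<^sup>+u. (\<integral>\<^sup>+z. ennreal (gauss_dens N0 I z) * 1 \<partial>lborel_vec I) * (ennreal (gauss_dens N0 J u) * f u) \<partial>lborel_vec J)"
    unfolding F_def by (intro nn_integral_cong, subst nn_integral_multc) simp_all
  also have "(\<integral>\<^sup>+z. ennreal (gauss_dens N0 I z) * 1 \<partial>lborel_vec I) = 1"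
    using nn_integral_gauss_vec[OF N0 I, of "\<lambda>_. 1"] by (simp add: GI.emeasure_space_1)
  also have "(\<integral>\<^sup>+u. 1 * (ennreal (gauss_dens N0 J u) * f u) \<partial>lborel_vec J) = (\<integral>\<^sup>+u. f u \<partial>gauss_vec N0 J)"
    by (simp add: nn_integral_gauss_vec[OF N0 J f])
  finally show ?thesis
    using lhs by (simp add: pr_def)
qed

section \<open>Likelihood ratios of orthogonal signals\<close>

lemma nn_integral_gauss_shift:
  assumes N0: "N0 > 0" and f: "f \<in> borel_measurable borel"
  shows "(\<integral>\<^sup>+u. f (u + a) \<partial>gauss N0) = (\<integral>\<^sup>+u. f u * ennreal (exp ((2 * a * u - a\<^sup>2) / N0)) \<partial>gauss N0)"
proof -
  interpret G: product_prob_space "\<lambda>_::unit. gauss N0"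
    by (rule product_prob_space_gauss[OF N0])
  note [measurable] = f
  have "(\<integral>\<^sup>+u. f (u + a) \<partial>gauss N0) = (\<integral>\<^sup>+z. f (z () + a) \<partial>gauss_vec N0 {()})"
    by (rule G.product_nn_integral_singleton[symmetric]) measurable
  also have "\<dots> = (\<integral>\<^sup>+z. f ((\<lambda>i\<in>{()}. z i + a) ()) \<partial>gauss_vec N0 {()})" by simp
  also have "\<dots> = (\<integral>\<^sup>+z. f (z ()) * ennreal (exp ((2 * a * z () - a\<^sup>2) / N0)) \<partial>gauss_vec N0 {()})"
    by (subst nn_integral_gauss_vec_shift[OF N0, where f="\<lambda>z. f (z ())" and v="\<lambda>_. a"])
       (simp_all add: mult.assoc)
  also have "\<dots> = (\<integral>\<^sup>+u. f u * ennreal (exp ((2 * a * u - a\<^sup>2) / N0)) \<partial>gauss N0)"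
    by (rule G.product_nn_integral_singleton) measurable
  finally show ?thesis .
qed

text \<open>The interval of length \<open>sqrt N0\<close> starting at the threshold, with the
  density at its right end. Replacing x^2 by (x + 1)^2 is harmless: \<open>x\<close> will be of
  order sqrt (ln M), so the extra linear term is negligible against ln M in the exponent.\<close>

lemma gauss_upper_tail_ge:
  assumes N0: "N0 > 0" and x: "x \<ge> 0"
  shows "measure (gauss N0) {x * sqrt N0..} \<ge> exp (- (x + 1)\<^sup>2) / sqrt pi"
proof -
  interpret prob_space "gauss N0" by (rule prob_space_gauss[OF N0])
  let ?I = "{x * sqrt N0..(x + 1) * sqrt N0}"
  let ?c = "exp (- (x + 1)\<^sup>2) / sqrt (pi * N0)"
  have "ennreal (exp (- (x + 1)\<^sup>2) / sqrt pi) = ennreal ?c * emeasure lborel ?I"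
    using N0 x by (simp add: algebra_simps real_sqrt_mult flip: ennreal_mult)
  also have "\<dots> = (\<integral>\<^sup>+u. ennreal ?c * indicator ?I u \<partial>lborel)"
    by (subst nn_integral_cmult_indicator) auto
  also have "\<dots> \<le> (\<integral>\<^sup>+u. ennreal (normal_density 0 (sqrt (N0 / 2)) u) * indicator ?I u \<partial>lborel)"
  proof (intro nn_integral_mono)
    fix u
    show "ennreal ?c * indicator ?I u \<le> ennreal (normal_density 0 (sqrt (N0 / 2)) u) * indicator ?I u"
    proof (cases "u \<in> ?I")
      case True
      then have "0 \<le> u" "u \<le> (x + 1) * sqrt N0"
        using x N0 by (auto intro: order_trans[rotated])
      then have "u\<^sup>2 \<le> ((x + 1) * sqrt N0)\<^sup>2" by (intro power_mono) auto
      then have "u\<^sup>2 / N0 \<le> (x + 1)\<^sup>2"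
        using N0 by (simp add: power_mult_distrib divide_le_eq)
      then have "?c \<le> normal_density 0 (sqrt (N0 / 2)) u"
        using N0 by (simp add: gauss_density divide_right_mono)
      then show ?thesis using True by (simp add: ennreal_leI)
    qed simp
  qed
  also have "\<dots> = emeasure (gauss N0) ?I"
    unfolding gauss_def by (subst emeasure_density) auto
  also have "\<dots> \<le> emeasure (gauss N0) {x * sqrt N0..}"
    by (intro emeasure_mono) auto
  finally show ?thesis by (simp add: emeasure_eq_measure)
qed

lemma gauss_reflect:
  assumes N0: "N0 > 0"
  shows "measure (gauss N0) {..- x} = measure (gauss N0) {x..}"
proof -
  have "emeasure (gauss N0) {..- x} =
      (\<integral>\<^sup>+u. ennreal (normal_density 0 (sqrt (N0 / 2)) u) * indicator {..- x} u \<partial>lborel)"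
    unfolding gauss_def by (subst emeasure_density) auto
  also have "\<dots> = (\<integral>\<^sup>+u. ennreal (normal_density 0 (sqrt (N0 / 2)) (- u)) * indicator {..- x} (- u) \<partial>lborel)"
    by (subst nn_integral_real_affine[where c="-1" and t=0]) auto
  also have "\<dots> = (\<integral>\<^sup>+u. ennreal (normal_density 0 (sqrt (N0 / 2)) u) * indicator {x..} u \<partial>lborel)"
    by (intro nn_integral_cong) (auto simp: normal_density_def split: split_indicator)
  also have "\<dots> = emeasure (gauss N0) {x..}"
    unfolding gauss_def by (subst emeasure_density) auto
  finally show ?thesis by (simp add: measure_def)
qed

lemma gauss_lower_half:
  assumes N0: "N0 > 0" and "x \<ge> 0"
  shows "measure (gauss N0) {..x} \<ge> 1 / 2"
proof -
  interpret prob_space "gauss N0" by (rule prob_space_gauss[OF N0])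
  have "1 = measure (gauss N0) ({..0} \<union> {0..})"
  proof -
    have "{..0} \<union> {0..} = (UNIV :: real set)" by auto
    then show ?thesis using prob_space by simp
  qed
  also have "\<dots> \<le> measure (gauss N0) {..0} + measure (gauss N0) {0..}"
    by (intro measure_Un_le) auto
  also have "\<dots> = 2 * measure (gauss N0) {..0}"
    using gauss_reflect[OF N0, of 0] by simp
  also have "measure (gauss N0) {..0} \<le> measure (gauss N0) {..x}"
    using assms(2) by (intro finite_measure_mono) auto
  finally show ?thesis by simp
qed

text \<open>The likelihood ratio of a codeword of norm \<open>a\<close> against pure noise, as a function of the
  projection \<open>u\<close> of the channel output on the direction of the codeword.\<close>

definition lr :: "real \<Rightarrow> real \<Rightarrow> real \<Rightarrow> real" where
  "lr N0 a u = exp ((2 * a * u - a\<^sup>2) / N0)"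

lemma lr_pos [simp]: "0 < lr N0 a u" and lr_nonneg [simp]: "0 \<le> lr N0 a u"
  by (simp_all add: lr_def)

lemma borel_measurable_lr [measurable]: "lr N0 a \<in> borel_measurable borel"
  unfolding lr_def by measurable

text \<open>Weighting pure noise by the likelihood ratio gives noise centred at \<open>a\<close>, so
  the mean of a truncated ratio is the probability of \<open>A\<close> under that law. With
  \<open>A\<close> everything, a ratio has mean 1.\<close>

lemma nn_integral_lr_indicator:
  assumes "N0 > 0" "A \<in> sets borel"
  shows "(\<integral>\<^sup>+u. ennreal (lr N0 a u * indicator A u) \<partial>gauss N0) = emeasure (gauss N0) ((\<lambda>u. u + a) -` A)"
proof -
  have *: "(\<lambda>u. u + a) -` A \<in> sets (gauss N0)"
    using measurable_sets[of "\<lambda>u. u + a" borel borel A] assms(2) by simp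
  have "(\<integral>\<^sup>+u. ennreal (lr N0 a u * indicator A u) \<partial>gauss N0) = (\<integral>\<^sup>+u. indicator A u * ennreal (lr N0 a u) \<partial>gauss N0)"
    by (intro nn_integral_cong) (auto split: split_indicator)
  also have "\<dots> = (\<integral>\<^sup>+u. indicator A (u + a) \<partial>gauss N0)"
    unfolding lr_def using assms by (intro nn_integral_gauss_shift[symmetric]) auto
  also have "\<dots> = (\<integral>\<^sup>+u. indicator ((\<lambda>u. u + a) -` A) u \<partial>gauss N0)"
    by (intro nn_integral_cong) (auto split: split_indicator)
  finally show ?thesis using * by simp
qed

section \<open>Expected maximum of independent likelihood ratios\<close>

context prob_space
begin

lemma
  assumes N0: "N0 > 0" and [measurable]: "random_variable borel U" and U: "distr M borel U = gauss N0"
    and A: "A \<in> sets borel"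
  shows integrable_lr_indicator: "integrable M (\<lambda>\<omega>. lr N0 a (U \<omega>) * indicator A (U \<omega>))"
    and expectation_lr_indicator:
      "expectation (\<lambda>\<omega>. lr N0 a (U \<omega>) * indicator A (U \<omega>)) = measure (gauss N0) ((\<lambda>u. u + a) -` A)"
proof -
  interpret G: prob_space "gauss N0" by (rule prob_space_gauss[OF N0])
  note [measurable] = A
  have eq: "(\<integral>\<^sup>+\<omega>. ennreal (lr N0 a (U \<omega>) * indicator A (U \<omega>)) \<partial>M) = ennreal (measure (gauss N0) ((\<lambda>u. u + a) -` A))"
  proof -
    have "(\<integral>\<^sup>+\<omega>. ennreal (lr N0 a (U \<omega>) * indicator A (U \<omega>)) \<partial>M)
        = (\<integral>\<^sup>+u. ennreal (lr N0 a u * indicator A u) \<partial>distr M borel U)"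
      by (subst nn_integral_distr) auto
    then show ?thesis
      by (simp add: U nn_integral_lr_indicator[OF N0 A] G.emeasure_eq_measure)
  qed
  then show "integrable M (\<lambda>\<omega>. lr N0 a (U \<omega>) * indicator A (U \<omega>))"
    by (intro integrableI_nonneg) auto
  then have "ennreal (expectation (\<lambda>\<omega>. lr N0 a (U \<omega>) * indicator A (U \<omega>))) = ennreal (measure (gauss N0) ((\<lambda>u. u + a) -` A))"
    by (subst nn_integral_eq_integral[symmetric]) (auto simp: eq)
  then show "expectation (\<lambda>\<omega>. lr N0 a (U \<omega>) * indicator A (U \<omega>)) = measure (gauss N0) ((\<lambda>u. u + a) -` A)"
    by (subst (asm) ennreal_inj) (auto intro!: integral_nonneg)
qed

lemma
  assumes N0: "N0 > 0" and U1: "random_variable borel U" and U: "distr M borel U = gauss N0"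
  shows integrable_lr: "integrable M (\<lambda>\<omega>. lr N0 a (U \<omega>))"
    and expectation_lr: "expectation (\<lambda>\<omega>. lr N0 a (U \<omega>)) = 1"
proof -
  interpret G: prob_space "gauss N0" by (rule prob_space_gauss[OF N0])
  show "integrable M (\<lambda>\<omega>. lr N0 a (U \<omega>))" "expectation (\<lambda>\<omega>. lr N0 a (U \<omega>)) = 1"
    using integrable_lr_indicator[OF N0 U1 U, of UNIV a] expectation_lr_indicator[OF N0 U1 U, of UNIV a] G.prob_space
    by simp_all
qed

lemma nn_integral_le_expectation_bound:
  assumes "integrable M g" "\<And>\<omega>. \<omega> \<in> space M \<Longrightarrow> 0 \<le> f \<omega>" "\<And>\<omega>. \<omega> \<in> space M \<Longrightarrow> f \<omega> \<le> g \<omega>" "expectation g \<le> B"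
  shows "(\<integral>\<^sup>+\<omega>. ennreal (f \<omega>) \<partial>M) \<le> ennreal B"
proof -
  have "(\<integral>\<^sup>+\<omega>. ennreal (f \<omega>) \<partial>M) \<le> (\<integral>\<^sup>+\<omega>. ennreal (g \<omega>) \<partial>M)"
    using assms(3) by (intro nn_integral_mono ennreal_leI)
  also have "\<dots> = ennreal (expectation g)"
    using assms by (intro nn_integral_eq_integral AE_I2) (auto intro: order_trans)
  also have "\<dots> \<le> ennreal B" using assms(4) by (rule ennreal_leI)
  finally show ?thesis .
qed

context
  fixes N0 :: real and S :: "'w set" and U :: "'w \<Rightarrow> 'a \<Rightarrow> real" and a :: "'w \<Rightarrow> real"
  assumes N0: "N0 > 0" and S: "finite S" "S \<noteq> {}"
    and indep: "indep_vars (\<lambda>_. borel) U S"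
    and U: "\<And>w. w \<in> S \<Longrightarrow> distr M borel (U w) = gauss N0"
begin

lemma U_measurable: "w \<in> S \<Longrightarrow> random_variable borel (U w)"
  using indep by (auto simp: indep_vars_def)

lemma Max_lr_attained:
  obtains w where "w \<in> S" "Max ((\<lambda>w. lr N0 (a w) (U w \<omega>)) ` S) = lr N0 (a w) (U w \<omega>)"
    "\<And>w'. w' \<in> S \<Longrightarrow> lr N0 (a w') (U w' \<omega>) \<le> lr N0 (a w) (U w \<omega>)"
proof -
  have "Max ((\<lambda>w. lr N0 (a w) (U w \<omega>)) ` S) \<in> (\<lambda>w. lr N0 (a w) (U w \<omega>)) ` S"
    using S by (intro Max_in) auto
  then obtain w where w: "w \<in> S" "Max ((\<lambda>w. lr N0 (a w) (U w \<omega>)) ` S) = lr N0 (a w) (U w \<omega>)" by auto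
  have "lr N0 (a w') (U w' \<omega>) \<le> lr N0 (a w) (U w \<omega>)" if "w' \<in> S" for w'
    unfolding w(2)[symmetric] using S that by (intro Max_ge) auto
  with w that show ?thesis by blast
qed

lemma Max_lr_nonneg: "0 \<le> Max ((\<lambda>w. lr N0 (a w) (U w \<omega>)) ` S)"
  by (rule Max_lr_attained[of \<omega>]) simp

lemma integrable_sum_lr: "T \<subseteq> S \<Longrightarrow> integrable M (\<lambda>\<omega>. \<Sum>w\<in>T. lr N0 (a w) (U w \<omega>))"
  using U_measurable U by (intro Bochner_Integration.integrable_sum integrable_lr[OF N0]) auto

lemma expectation_sum_lr: "T \<subseteq> S \<Longrightarrow> expectation (\<lambda>\<omega>. \<Sum>w\<in>T. lr N0 (a w) (U w \<omega>)) = card T"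
  using U_measurable U
  by (subst Bochner_Integration.integral_sum)
     (auto intro!: integrable_lr[OF N0] simp: expectation_lr[OF N0] subset_eq)

text \<open>All codewords of norm 0 share the ratio 1, so together they add at most 1 to the
  maximum, however many there are. This is what forces a user with small error probability to have
  many nonzero codewords.\<close>

lemma nn_integral_Max_lr_nonzero:
  "(\<integral>\<^sup>+\<omega>. ennreal (Max ((\<lambda>w. lr N0 (a w) (U w \<omega>)) ` S)) \<partial>M) \<le> ennreal (real (card {w \<in> S. a w \<noteq> 0}) + 1)"
proof (rule nn_integral_le_expectation_bound)
  let ?T = "{w \<in> S. a w \<noteq> 0}"
  show "integrable M (\<lambda>\<omega>. (\<Sum>w\<in>?T. lr N0 (a w) (U w \<omega>)) + 1)"
    by (intro Bochner_Integration.integrable_add integrable_sum_lr) auto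
  show "expectation (\<lambda>\<omega>. (\<Sum>w\<in>?T. lr N0 (a w) (U w \<omega>)) + 1) \<le> real (card ?T) + 1"
    using integrable_sum_lr[of ?T] expectation_sum_lr[of ?T] prob_space by simp
  fix \<omega>
  show "0 \<le> Max ((\<lambda>w. lr N0 (a w) (U w \<omega>)) ` S)" by (rule Max_lr_nonneg)
  obtain w where w: "w \<in> S" "Max ((\<lambda>w. lr N0 (a w) (U w \<omega>)) ` S) = lr N0 (a w) (U w \<omega>)"
    by (rule Max_lr_attained)
  show "Max ((\<lambda>w. lr N0 (a w) (U w \<omega>)) ` S) \<le> (\<Sum>w\<in>?T. lr N0 (a w) (U w \<omega>)) + 1"
  proof (cases "a w = 0")
    case True
    have "0 \<le> (\<Sum>w\<in>?T. lr N0 (a w) (U w \<omega>))" by (intro sum_nonneg) simp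
    then show ?thesis using w True by (simp add: lr_def)
  next
    case False
    have "lr N0 (a w) (U w \<omega>) \<le> (\<Sum>w\<in>?T. lr N0 (a w) (U w \<omega>))"
      using w False S by (intro member_le_sum) auto
    then show ?thesis using w by simp
  qed
qed

text \<open>Both bounds below estimate \<open>\<Sum>X - Max X\<close> from below: by \<open>\<Sum>(min X s) - s\<close>, respectively by the
  indicator of two of the \<open>X\<close> being at least \<open>1\<close>. The first is sharp at high rates, the second at
  low rates.\<close>

lemma nn_integral_Max_lr_sphere_packing:
  assumes a: "\<And>w. w \<in> S \<Longrightarrow> 0 \<le> a w \<and> a w \<le> D" and T: "D \<le> 2 * T"
  shows "(\<integral>\<^sup>+\<omega>. ennreal (Max ((\<lambda>w. lr N0 (a w) (U w \<omega>)) ` S)) \<partial>M) \<le>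
    ennreal (real (card S) - (real (card S) * measure (gauss N0) {..T - D} - exp ((2 * T * D - D\<^sup>2) / N0)))"
proof (rule nn_integral_le_expectation_bound)
  interpret G: prob_space "gauss N0" by (rule prob_space_gauss[OF N0])
  \<comment> \<open>The ratio \<open>lr N0 D T\<close> of a codeword of full norm \<open>D\<close>
    at the projection \<open>T\<close>; it serves as truncation level for all codewords.\<close>
  define s where "s = exp ((2 * T * D - D\<^sup>2) / N0)"
  let ?X = "\<lambda>w \<omega>. lr N0 (a w) (U w \<omega>)"
  define A where "A w = {u. lr N0 (a w) u \<le> s}" for w
  have A: "A w \<in> sets borel" for w unfolding A_def by measurable
  let ?Y = "\<lambda>w \<omega>. ?X w \<omega> * indicator (A w) (U w \<omega>)"
  have iY: "integrable M (?Y w)" if "w \<in> S" for w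
    using that by (intro integrable_lr_indicator[OF N0 U_measurable U A])
  have EY: "measure (gauss N0) {..T - D} \<le> expectation (?Y w)" if w: "w \<in> S" for w
  proof -
    have "{..T - D} \<subseteq> (\<lambda>u. u + a w) -` A w"
    proof
      fix u assume "u \<in> {..T - D}"
      then have "a w * u \<le> a w * (T - D)" using a[OF w] by (intro mult_left_mono) auto
      \<comment> \<open>This product is the slack of the next inequality at
        \<open>u = T - D\<close>. It is nonnegative because \<open>D \<le> 2 * T\<close>, so a
        codeword shorter than \<open>D\<close> is truncated no more often than one of norm
        \<open>D\<close>.\<close>
      moreover have "0 \<le> (D - a w) * (2 * T - D + a w)" using a[OF w] T by (intro mult_nonneg_nonneg) auto
      ultimately have "2 * a w * (u + a w) - (a w)\<^sup>2 \<le> 2 * T * D - D\<^sup>2"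
        by (simp add: algebra_simps power2_eq_square)
      then show "u \<in> (\<lambda>u. u + a w) -` A w"
        using N0 by (simp add: A_def lr_def s_def divide_right_mono)
    qed
    moreover have "(\<lambda>u. u + a w) -` A w \<in> sets (gauss N0)"
      using measurable_sets[of "\<lambda>u. u + a w" borel borel "A w"] A by simp
    ultimately show ?thesis
      unfolding expectation_lr_indicator[OF N0 U_measurable[OF w] U[OF w] A]
      by (intro G.finite_measure_mono)
  qed
  show "integrable M (\<lambda>\<omega>. (\<Sum>w\<in>S. ?X w \<omega>) - ((\<Sum>w\<in>S. ?Y w \<omega>) - s))"
    by (intro Bochner_Integration.integrable_diff integrable_sum_lr Bochner_Integration.integrable_sum iY) auto
  have "expectation (\<lambda>\<omega>. (\<Sum>w\<in>S. ?X w \<omega>) - ((\<Sum>w\<in>S. ?Y w \<omega>) - s))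
      = real (card S) - ((\<Sum>w\<in>S. expectation (?Y w)) - s)"
    using iY integrable_sum_lr[of S] expectation_sum_lr[of S] prob_space by simp
  also have "\<dots> \<le> real (card S) - (real (card S) * measure (gauss N0) {..T - D} - s)"
    using sum_mono[OF EY] by simp
  finally show "expectation (\<lambda>\<omega>. (\<Sum>w\<in>S. ?X w \<omega>) - ((\<Sum>w\<in>S. ?Y w \<omega>) - s))
      \<le> real (card S) - (real (card S) * measure (gauss N0) {..T - D} - exp ((2 * T * D - D\<^sup>2) / N0))"
    by (simp add: s_def)
  fix \<omega>
  show "0 \<le> Max ((\<lambda>w. ?X w \<omega>) ` S)" by (rule Max_lr_nonneg)
  obtain w where w: "w \<in> S" "Max ((\<lambda>w. ?X w \<omega>) ` S) = ?X w \<omega>"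
    by (rule Max_lr_attained)
  \<comment> \<open>Of the truncated ratios, that of the maximizer is bounded by \<open>s\<close>
    and all others by the ratios themselves. What is left of the sum after removing the maximum is
    therefore at least the truncated sum minus \<open>s\<close>.\<close>
  have "(\<Sum>w\<in>S. ?Y w \<omega>) = ?Y w \<omega> + (\<Sum>w\<in>S - {w}. ?Y w \<omega>)"
    by (rule sum.remove[OF S(1) w(1)])
  also have "\<dots> \<le> s + (\<Sum>w\<in>S - {w}. ?X w \<omega>)"
    by (intro add_mono sum_mono) (auto simp: A_def s_def split: split_indicator)
  also have "(\<Sum>w\<in>S - {w}. ?X w \<omega>) = (\<Sum>w\<in>S. ?X w \<omega>) - ?X w \<omega>"
    using S w by (simp add: sum_diff1)
  finally show "Max ((\<lambda>w. ?X w \<omega>) ` S) \<le> (\<Sum>w\<in>S. ?X w \<omega>) - ((\<Sum>w\<in>S. ?Y w \<omega>) - s)"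
    using w by simp
qed

lemma nn_integral_Max_lr_pairwise:
  assumes a: "\<And>w. w \<in> S \<Longrightarrow> 0 \<le> a w \<and> a w \<le> D"
    and AB: "A \<subseteq> S" "B \<subseteq> S" "A \<inter> B = {}"
    and q: "q = measure (gauss N0) {D / 2..}"
  shows "(\<integral>\<^sup>+\<omega>. ennreal (Max ((\<lambda>w. lr N0 (a w) (U w \<omega>)) ` S)) \<partial>M) \<le>
    ennreal (real (card S) - (1 - (1 - q) ^ card A) * (1 - (1 - q) ^ card B))"
proof (rule nn_integral_le_expectation_bound)
  interpret G: prob_space "gauss N0" by (rule prob_space_gauss[OF N0])
  let ?X = "\<lambda>w \<omega>. lr N0 (a w) (U w \<omega>)"
  define h where "h w u = indicat_real {..<a w / 2} u" for w u
  have h [measurable]: "h w \<in> borel_measurable borel" for w unfolding h_def by measurable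
  \<comment> \<open>\<open>f T\<close> is 1 when every projection with index in \<open>T\<close>
    stays below half the norm of its codeword, and 0 otherwise. From half the norm on the ratio is
    at least 1, so \<open>f T = 0\<close> yields such a ratio in \<open>T\<close>.\<close>
  define f where "f T \<omega> = (\<Prod>w\<in>T. h w (U w \<omega>))" for T \<omega>
  have ind: "indep_vars (\<lambda>_. borel) (\<lambda>w \<omega>. h w (U w \<omega>)) S"
    by (rule indep_vars_compose2[OF indep]) (rule h)
  have ih: "integrable M (\<lambda>\<omega>. h w (U w \<omega>))" if "w \<in> S" for w
  proof -
    have [measurable]: "random_variable borel (U w)" by (rule U_measurable[OF that])
    show ?thesis by (rule integrable_const_bound[of _ 1]) (auto simp: h_def split: split_indicator)
  qed
  have Eh: "0 \<le> expectation (\<lambda>\<omega>. h w (U w \<omega>))" "expectation (\<lambda>\<omega>. h w (U w \<omega>)) \<le> 1 - q" if "w \<in> S" for w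
  proof -
    have [measurable]: "random_variable borel (U w)" by (rule U_measurable[OF that])
    show "0 \<le> expectation (\<lambda>\<omega>. h w (U w \<omega>))" by (simp add: h_def)
    have "expectation (\<lambda>\<omega>. h w (U w \<omega>)) = (\<integral>u. h w u \<partial>gauss N0)"
      unfolding U[OF that, symmetric] by (rule integral_distr[symmetric]) measurable
    also have "\<dots> = measure (gauss N0) {..<a w / 2}" by (simp add: h_def)
    also have "\<dots> \<le> measure (gauss N0) (space (gauss N0) - {D / 2..})"
      using a[OF that] by (intro G.finite_measure_mono) auto
    also have "\<dots> = 1 - q" unfolding q by (rule G.prob_compl) simp
    finally show "expectation (\<lambda>\<omega>. h w (U w \<omega>)) \<le> 1 - q" .
  qed
  have f: "integrable M (f T)" "expectation (f T) = (\<Prod>w\<in>T. expectation (\<lambda>\<omega>. h w (U w \<omega>)))" if "T \<subseteq> S" for T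
    unfolding f_def using that S(1)
    by (auto intro!: indep_vars_integrable indep_vars_lebesgue_integral ih indep_vars_subset[OF ind]
        intro: finite_subset)
  have EfT: "0 \<le> expectation (f T)" "expectation (f T) \<le> (1 - q) ^ card T" if "T \<subseteq> S" for T
  proof -
    show "0 \<le> expectation (f T)" unfolding f(2)[OF that] using that Eh(1) by (intro prod_nonneg) auto
    have "(\<Prod>w\<in>T. expectation (\<lambda>\<omega>. h w (U w \<omega>))) \<le> (\<Prod>w\<in>T. 1 - q)"
      using Eh that by (intro prod_mono) auto
    then show "expectation (f T) \<le> (1 - q) ^ card T" by (simp add: f(2)[OF that])
  qed
  have fin: "finite A" "finite B" using AB S(1) by (auto intro: finite_subset)
  have fAB: "f A \<omega> * f B \<omega> = f (A \<union> B) \<omega>" for \<omega>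
    unfolding f_def by (rule prod.union_disjoint[OF fin AB(3), symmetric])
  have EfAB: "expectation (f (A \<union> B)) = expectation (f A) * expectation (f B)"
    using AB by (simp add: f prod.union_disjoint[OF fin AB(3)])
  let ?g = "\<lambda>\<omega>. (\<Sum>w\<in>S. ?X w \<omega>) - (1 - f A \<omega> - f B \<omega> + f (A \<union> B) \<omega>)"
  have int: "integrable M (f A)" "integrable M (f B)" "integrable M (f (A \<union> B))"
    using AB by (auto intro!: f(1))
  show "integrable M ?g"
    using int by (intro Bochner_Integration.integrable_diff Bochner_Integration.integrable_add integrable_sum_lr) auto
  have q1: "q \<le> 1" unfolding q by simp
  have "expectation ?g = real (card S) - (1 - expectation (f A)) * (1 - expectation (f B))"
    using int integrable_sum_lr[of S] expectation_sum_lr[of S] prob_space by (simp add: EfAB algebra_simps)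
  also have "\<dots> \<le> real (card S) - (1 - (1 - q) ^ card A) * (1 - (1 - q) ^ card B)"
    using EfT(2)[OF AB(1)] EfT(2)[OF AB(2)] q1 q power_le_one[of "1 - q"]
    by (intro diff_left_mono mult_mono) (auto simp: measure_nonneg intro: order_trans)
  finally show "expectation ?g \<le> real (card S) - (1 - (1 - q) ^ card A) * (1 - (1 - q) ^ card B)" .
  fix \<omega>
  show "0 \<le> Max ((\<lambda>w. ?X w \<omega>) ` S)" by (rule Max_lr_nonneg)
  obtain w where w: "w \<in> S" "Max ((\<lambda>w. ?X w \<omega>) ` S) = ?X w \<omega>"
    by (rule Max_lr_attained)
  have rest: "(\<Sum>w'\<in>S. ?X w' \<omega>) = ?X w \<omega> + (\<Sum>w'\<in>S - {w}. ?X w' \<omega>)"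
    by (rule sum.remove[OF S(1) w(1)])
  have one: "1 \<le> ?X w' \<omega>" if "w' \<in> S" "a w' / 2 \<le> U w' \<omega>" for w'
  proof -
    have "0 \<le> a w' * (2 * U w' \<omega> - a w')" using that a[of w'] by (intro mult_nonneg_nonneg) auto
    then show ?thesis using N0 by (simp add: lr_def power2_eq_square algebra_simps)
  qed
  have f01: "0 \<le> f T \<omega>" "f T \<omega> \<le> 1" for T
    unfolding f_def h_def by (auto intro!: prod_nonneg prod_le_1 split: split_indicator)
  \<comment> \<open>If both factors are 1, disjointness of \<open>A\<close> and \<open>B\<close>
    gives two different codewords with ratio at least 1; at most one of them is the maximizer, and
    the other stays in the sum.\<close>
  have "(1 - f A \<omega>) * (1 - f B \<omega>) \<le> (\<Sum>w'\<in>S - {w}. ?X w' \<omega>)"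
  proof (cases "\<exists>w'\<in>A. \<exists>w''\<in>B. a w' / 2 \<le> U w' \<omega> \<and> a w'' / 2 \<le> U w'' \<omega>")
    case True
    then obtain w' w'' where "w' \<in> A" "w'' \<in> B" "a w' / 2 \<le> U w' \<omega>" "a w'' / 2 \<le> U w'' \<omega>" by auto
    then obtain v where v: "v \<in> S - {w}" "1 \<le> ?X v \<omega>" using AB one by (metis DiffI disjoint_iff singletonD subsetD)
    have "(1 - f A \<omega>) * (1 - f B \<omega>) \<le> 1 * 1" using f01 by (intro mult_mono) auto
    also have "\<dots> \<le> ?X v \<omega>" using v by simp
    also have "\<dots> \<le> (\<Sum>w'\<in>S - {w}. ?X w' \<omega>)" using v S by (intro member_le_sum) auto
    finally show ?thesis .
  next
    case False
    then have "(\<forall>w'\<in>A. U w' \<omega> < a w' / 2) \<or> (\<forall>w'\<in>B. U w' \<omega> < a w' / 2)" by (meson not_less)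
    then have "f A \<omega> = 1 \<or> f B \<omega> = 1" unfolding f_def h_def by (auto intro!: prod.neutral)
    then have "(1 - f A \<omega>) * (1 - f B \<omega>) = 0" by auto
    also have "0 \<le> (\<Sum>w'\<in>S - {w}. ?X w' \<omega>)" by (intro sum_nonneg) simp
    finally show ?thesis .
  qed
  then show "Max ((\<lambda>w. ?X w \<omega>) ` S) \<le> ?g \<omega>"
    using w rest by (simp add: algebra_simps flip: fAB)
qed

end

end

section \<open>Detection error of orthogonal signals\<close>

text \<open>The right-hand side is the tangent at \<open>c\<close> of the concave function x^\<rho>,
  arranged so that all terms are nonnegative; in this form it is Young's inequality.\<close>

lemma powr_le_tangent:
  assumes "0 \<le> \<rho>" "\<rho> \<le> 1" "x > 0" "c > (0::real)"
  shows "x powr \<rho> \<le> c powr (\<rho> - 1) * (\<rho> * x + (1 - \<rho>) * c)"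
proof -
  have "x powr \<rho> * c powr (1 - \<rho>) \<le> \<rho> * x + (1 - \<rho>) * c"
    using assms by (intro Youngs_inequality_0) auto
  then have "c powr (\<rho> - 1) * (x powr \<rho> * c powr (1 - \<rho>)) \<le> c powr (\<rho> - 1) * (\<rho> * x + (1 - \<rho>) * c)"
    by (intro mult_left_mono) auto
  also have "c powr (\<rho> - 1) * (x powr \<rho> * c powr (1 - \<rho>)) = x powr \<rho> * (c powr (\<rho> - 1) * c powr (1 - \<rho>))"
    by (simp add: mult_ac)
  also have "c powr (\<rho> - 1) * c powr (1 - \<rho>) = 1"
    using assms by (simp flip: powr_add)
  finally show ?thesis by simp
qed

text \<open>Gallager's argument: on the error event the sum of the
  \<open>exp (2 * b * (Z j - a - Z j0) / N0)\<close> is at least \<open>1\<close>, and so is its \<open>\<rho>\<close>-th power, which is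
  bounded by its tangent at the mean. The value of \<open>b\<close> optimizes the resulting exponent.\<close>

lemma orthogonal_detection_error_le:
  assumes N0: "N0 > 0" and I: "finite I" and j0: "j0 \<in> I" and S: "S \<subseteq> I - {j0}" "S \<noteq> {}"
    and a: "a \<ge> 0" and \<rho>: "0 \<le> \<rho>" "\<rho> \<le> 1"
  shows "measure (gauss_vec N0 I) {Z \<in> space (gauss_vec N0 I). \<exists>j\<in>S. a + Z j0 \<le> Z j} \<le>
    real (card S) powr \<rho> * exp (- (a\<^sup>2 / N0 * (\<rho> / (1 + \<rho>))))"
    (is "measure ?G ?A \<le> ?B")
proof -
  interpret prob_space ?G by (rule prob_space_gauss_vec[OF N0])
  have fS: "finite S" using S I finite_subset by blast
  then have cS: "card S > 0" using S by (simp add: card_gt_0_iff)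
  define b where "b = a / (1 + \<rho>)"
  have b: "b \<ge> 0" and ab: "a = b * (1 + \<rho>)" using a \<rho> by (auto simp: b_def)
  \<comment> \<open>The mean of the sum over \<open>S\<close> of exp (2 b Z j / N0): each summand
    has mean exp (b^2 / N0) by the Gaussian moment generating function.\<close>
  define c where "c = real (card S) * exp (b\<^sup>2 / N0)"
  have c: "c > 0" using cS by (simp add: c_def)
  define e0 where "e0 = exp (- (2 * b * \<rho> * a / N0))"
  define \<beta> where "\<beta> i = (if i = j0 then - (2 * b * \<rho> / N0) else 0)" for i
  define \<alpha> where "\<alpha> j i = (if i = j then 2 * b / N0 else 0) + \<beta> i" for j i
  have sum\<beta>: "(\<Sum>i\<in>I. \<beta> i * Z i) = - (2 * b * \<rho> / N0) * Z j0" for Z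
    using I j0 by (simp add: \<beta>_def if_distrib[of "\<lambda>x. x * _"] cong: if_cong)
  have sum\<alpha>: "(\<Sum>i\<in>I. \<alpha> j i * Z i) = 2 * b / N0 * Z j - 2 * b * \<rho> / N0 * Z j0" if "j \<in> S" for Z j
    using I S that sum\<beta>[of Z]
    by (simp add: \<alpha>_def distrib_right sum.distrib if_distrib[of "\<lambda>x. x * _"] subset_eq cong: if_cong)
  have sq\<beta>: "N0 / 4 * (\<Sum>i\<in>I. (\<beta> i)\<^sup>2) = (b * \<rho>)\<^sup>2 / N0"
  proof -
    have "(\<Sum>i\<in>I. (\<beta> i)\<^sup>2) = (\<Sum>i\<in>I. if i = j0 then (2 * b * \<rho> / N0)\<^sup>2 else 0)"
      by (intro sum.cong refl) (simp add: \<beta>_def)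
    then show ?thesis using I j0 N0 by (simp add: power2_eq_square)
  qed
  have sq\<alpha>: "N0 / 4 * (\<Sum>i\<in>I. (\<alpha> j i)\<^sup>2) = (b * \<rho>)\<^sup>2 / N0 + b\<^sup>2 / N0" if "j \<in> S" for j
  proof -
    have "j \<in> I" "j \<noteq> j0" using S that by auto
    have "(\<Sum>i\<in>I. (\<alpha> j i)\<^sup>2) = (\<Sum>i\<in>I. (\<beta> i)\<^sup>2 + (if i = j then (2 * b / N0)\<^sup>2 else 0))"
      using \<open>j \<noteq> j0\<close> by (intro sum.cong refl) (auto simp: \<alpha>_def \<beta>_def)
    also have "\<dots> = (\<Sum>i\<in>I. (\<beta> i)\<^sup>2) + (2 * b / N0)\<^sup>2" using I \<open>j \<in> I\<close> by (simp add: sum.distrib)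
    finally have "N0 / 4 * (\<Sum>i\<in>I. (\<alpha> j i)\<^sup>2) = N0 / 4 * (\<Sum>i\<in>I. (\<beta> i)\<^sup>2) + N0 / 4 * (2 * b / N0)\<^sup>2"
      by (simp only: distrib_left)
    then show ?thesis using N0 by (simp only: sq\<beta>) (simp add: power2_eq_square)
  qed
  \<comment> \<open>The tangent bound multiplied by the \<rho>-th power of exp (- 2 b (a + Z j0) /
    N0). It is a combination of exponentials of the linear forms \<open>\<alpha> j\<close> and
    \<open>\<beta>\<close>, so its integral is explicit; the term with \<open>\<beta>\<close> comes
    from the constant term of the tangent.\<close>
  define F where "F Z = (\<Sum>j\<in>S. \<rho> * c powr (\<rho> - 1) * e0 * exp (\<Sum>i\<in>I. \<alpha> j i * Z i))
      + (1 - \<rho>) * c powr \<rho> * e0 * exp (\<Sum>i\<in>I. \<beta> i * Z i)" for Z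
  have ind: "indicator ?A Z \<le> ennreal (F Z)" for Z
  proof (cases "Z \<in> ?A")
    case True
    then obtain j where j: "j \<in> S" "a + Z j0 \<le> Z j" by auto
    define X where "X = (\<Sum>j\<in>S. exp (2 * b / N0 * Z j))"
    have X: "X > 0" unfolding X_def using fS S by (intro sum_pos) auto
    have "exp (2 * b / N0 * (a + Z j0)) \<le> exp (2 * b / N0 * Z j)"
      using b N0 j by (simp add: mult_left_mono divide_right_mono)
    also have "\<dots> \<le> X" unfolding X_def using j fS by (intro member_le_sum) auto
    finally have "exp (2 * b / N0 * (a + Z j0)) powr \<rho> \<le> X powr \<rho>" using \<rho> by (intro powr_mono2) auto
    also have "\<dots> \<le> c powr (\<rho> - 1) * (\<rho> * X + (1 - \<rho>) * c)"
      by (rule powr_le_tangent[OF \<rho> X c])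
    also have "\<dots> = \<rho> * c powr (\<rho> - 1) * X + (1 - \<rho>) * c powr \<rho>"
      
    proof -
      have "c powr (\<rho> - 1) * c = c powr \<rho>" using c by (simp add: powr_diff)
      then have "c powr (\<rho> - 1) * ((1 - \<rho>) * c) = (1 - \<rho>) * c powr \<rho>" by (simp add: mult.left_commute)
      then show ?thesis by (simp add: distrib_left mult_ac)
    qed
    finally have le: "exp (\<rho> * (2 * b / N0 * (a + Z j0))) \<le> \<rho> * c powr (\<rho> - 1) * X + (1 - \<rho>) * c powr \<rho>"
      by (simp add: powr_def)
    have e0b: "e0 * exp (\<Sum>i\<in>I. \<beta> i * Z i) = exp (- (\<rho> * (2 * b / N0 * (a + Z j0))))"
    proof -
      have "- (2 * b * \<rho> * a / N0) + - (2 * b * \<rho> / N0) * Z j0 = - (\<rho> * (2 * b / N0 * (a + Z j0)))"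
        by (simp add: algebra_simps add_divide_distrib)
      then show ?thesis unfolding e0_def sum\<beta> exp_add[symmetric] by simp
    qed
    have "F Z = (e0 * exp (\<Sum>i\<in>I. \<beta> i * Z i)) * (\<rho> * c powr (\<rho> - 1) * X + (1 - \<rho>) * c powr \<rho>)"
    proof -
      have "exp (\<Sum>i\<in>I. \<alpha> j i * Z i) = exp (\<Sum>i\<in>I. \<beta> i * Z i) * exp (2 * b / N0 * Z j)" if "j \<in> S" for j
        using that by (simp add: sum\<alpha> sum\<beta> flip: exp_add)
      then have "(\<Sum>j\<in>S. \<rho> * c powr (\<rho> - 1) * e0 * exp (\<Sum>i\<in>I. \<alpha> j i * Z i)) =
          (\<Sum>j\<in>S. (\<rho> * c powr (\<rho> - 1) * e0 * exp (\<Sum>i\<in>I. \<beta> i * Z i)) * exp (2 * b / N0 * Z j))"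
        by (intro sum.cong refl) simp
      also have "\<dots> = (\<rho> * c powr (\<rho> - 1) * e0 * exp (\<Sum>i\<in>I. \<beta> i * Z i)) * X"
        by (simp only: X_def sum_distrib_left)
      finally show ?thesis by (simp add: F_def algebra_simps)
    qed
    also have "\<dots> \<ge> (e0 * exp (\<Sum>i\<in>I. \<beta> i * Z i)) * exp (\<rho> * (2 * b / N0 * (a + Z j0)))"
      using le by (intro mult_left_mono) (auto simp: e0_def)
    finally have "1 \<le> F Z" unfolding e0b by (simp flip: exp_add)
    then show ?thesis using True by simp
  qed simp
  have A: "?A \<in> sets ?G"
  proof -
    have "{Z \<in> space ?G. a + Z j0 \<le> Z j} \<in> sets ?G" if "j \<in> S" for j
    proof -
      have "j \<in> I" using S that by auto
      then show ?thesis using j0 by measurable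
    qed
    then have "(\<Union>j\<in>S. {Z \<in> space ?G. a + Z j0 \<le> Z j}) \<in> sets ?G" using fS by (intro sets.finite_UN) auto
    moreover have "(\<Union>j\<in>S. {Z \<in> space ?G. a + Z j0 \<le> Z j}) = ?A" by auto
    ultimately show ?thesis by simp
  qed
  have "emeasure ?G ?A \<le> (\<integral>\<^sup>+Z. ennreal (F Z) \<partial>?G)"
    using ind by (subst nn_integral_indicator[OF A, symmetric]) (intro nn_integral_mono)
  also have "\<dots> = (\<integral>\<^sup>+Z. (\<Sum>j\<in>S. ennreal (\<rho> * c powr (\<rho> - 1) * e0) * ennreal (exp (\<Sum>i\<in>I. \<alpha> j i * Z i)))
      + ennreal ((1 - \<rho>) * c powr \<rho> * e0) * ennreal (exp (\<Sum>i\<in>I. \<beta> i * Z i)) \<partial>?G)"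
    using \<rho> by (intro nn_integral_cong)
      (simp add: F_def e0_def ennreal_plus sum_nonneg flip: ennreal_mult sum_ennreal)
  also have "\<dots> = (\<Sum>j\<in>S. ennreal (\<rho> * c powr (\<rho> - 1) * e0) * ennreal (exp (N0 / 4 * (\<Sum>i\<in>I. (\<alpha> j i)\<^sup>2))))
      + ennreal ((1 - \<rho>) * c powr \<rho> * e0) * ennreal (exp (N0 / 4 * (\<Sum>i\<in>I. (\<beta> i)\<^sup>2)))"
    by (simp add: nn_integral_add nn_integral_sum nn_integral_cmult nn_integral_gauss_vec_exp[OF N0 I])
  also have "\<dots> = ennreal ((\<Sum>j\<in>S. \<rho> * c powr (\<rho> - 1) * e0 * exp ((b * \<rho>)\<^sup>2 / N0 + b\<^sup>2 / N0))
      + (1 - \<rho>) * c powr \<rho> * e0 * exp ((b * \<rho>)\<^sup>2 / N0))"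
  proof -
    have K: "0 \<le> \<rho> * c powr (\<rho> - 1) * e0" "0 \<le> (1 - \<rho>) * c powr \<rho> * e0"
      using \<rho> by (auto simp: e0_def)
    have "(\<Sum>j\<in>S. ennreal (\<rho> * c powr (\<rho> - 1) * e0) * ennreal (exp (N0 / 4 * (\<Sum>i\<in>I. (\<alpha> j i)\<^sup>2))))
        = (\<Sum>j\<in>S. ennreal (\<rho> * c powr (\<rho> - 1) * e0 * exp ((b * \<rho>)\<^sup>2 / N0 + b\<^sup>2 / N0)))"
      by (intro sum.cong refl) (simp only: sq\<alpha> ennreal_mult[OF K(1) exp_ge_zero])
    also have "\<dots> = ennreal (\<Sum>j\<in>S. \<rho> * c powr (\<rho> - 1) * e0 * exp ((b * \<rho>)\<^sup>2 / N0 + b\<^sup>2 / N0))"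
      by (rule sum_ennreal) (rule mult_nonneg_nonneg[OF K(1) exp_ge_zero])
    finally show ?thesis
      by (simp only: sq\<beta> ennreal_mult[OF K(2) exp_ge_zero, symmetric])
        (rule ennreal_plus[symmetric], (intro sum_nonneg mult_nonneg_nonneg K exp_ge_zero)+)
  qed
  also have "(\<Sum>j\<in>S. \<rho> * c powr (\<rho> - 1) * e0 * exp ((b * \<rho>)\<^sup>2 / N0 + b\<^sup>2 / N0))
      + (1 - \<rho>) * c powr \<rho> * e0 * exp ((b * \<rho>)\<^sup>2 / N0)
      = e0 * exp ((b * \<rho>)\<^sup>2 / N0) * (\<rho> * (c powr (\<rho> - 1) * c) + (1 - \<rho>) * c powr \<rho>)"
    by (simp add: c_def exp_add algebra_simps)
  also have "c powr (\<rho> - 1) * c = c powr \<rho>" using c by (simp add: powr_diff)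
  also have "e0 * exp ((b * \<rho>)\<^sup>2 / N0) * (\<rho> * c powr \<rho> + (1 - \<rho>) * c powr \<rho>) = ?B"
  proof -
    have "c powr \<rho> = real (card S) powr \<rho> * exp (\<rho> * (b\<^sup>2 / N0))"
      using cS by (simp add: c_def powr_mult) (simp add: powr_def)
    moreover have "e0 * exp ((b * \<rho>)\<^sup>2 / N0) * exp (\<rho> * (b\<^sup>2 / N0)) = exp (- (a\<^sup>2 / N0 * (\<rho> / (1 + \<rho>))))"
    proof -
      have "- (2 * b * \<rho> * a / N0) + (b * \<rho>)\<^sup>2 / N0 + \<rho> * (b\<^sup>2 / N0) = (- 2 * b * \<rho> * a + (b * \<rho>)\<^sup>2 + \<rho> * b\<^sup>2) / N0"
        by (simp add: add_divide_distrib diff_divide_distrib)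
      also have "- 2 * b * \<rho> * a + (b * \<rho>)\<^sup>2 + \<rho> * b\<^sup>2 = - (b * \<rho> * a)"
        unfolding ab by (simp add: power2_eq_square algebra_simps)
      also have "b * \<rho> * a = a\<^sup>2 * (\<rho> / (1 + \<rho>))" by (simp add: b_def power2_eq_square)
      finally show ?thesis by (simp add: e0_def flip: exp_add)
    qed
    ultimately show ?thesis by (simp add: algebra_simps)
  qed
  finally have "ennreal (measure ?G ?A) \<le> ennreal ?B" by (simp only: emeasure_eq_measure)
  then show ?thesis by (subst (asm) ennreal_le_iff) auto
qed

section \<open>Error probabilities as averages over the messages\<close>

lemma message_measure_eq:
  assumes "M \<ge> 1"
  shows "message_measure k M = uniform_count_measure ({1..k} \<rightarrow>\<^sub>E {1..M})"
proof (rule measure_eqI_finite)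
  let ?S = "{1..k} \<rightarrow>\<^sub>E {1..M}"
  interpret A: prob_space "uniform_count_measure {1..M}"
    using assms by (intro prob_space_uniform_count_measure) auto
  interpret PA: product_prob_space "\<lambda>_::nat. uniform_count_measure {1..M}" "{1..k}" ..
  show "sets (message_measure k M) = Pow ?S"
    using sets_message_measure[of k M] by simp
  show "sets (uniform_count_measure ?S) = Pow ?S"
    by (simp add: sets_uniform_count_measure)
  show fin: "finite ?S" by (intro finite_PiE) auto
  fix W assume W: "W \<in> ?S"
  have "{W} = Pi\<^sub>E {1..k} (\<lambda>i. {W i})"
    using W by (intro PiE_singleton[symmetric]) (auto simp: PiE_def)
  then have "emeasure (message_measure k M) {W} = (\<Prod>i\<in>{1..k}. emeasure (uniform_count_measure {1..M}) {W i})"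
    unfolding message_measure_def using W
    by (simp only:, subst PA.emeasure_PiM) (auto simp: sets_uniform_count_measure PiE_iff)
  also have "\<dots> = (\<Prod>i\<in>{1..k}. ennreal (1 / real M))"
    using W by (intro prod.cong refl) (subst emeasure_uniform_count_measure, auto simp: PiE_iff)
  also have "\<dots> = ennreal (1 / real (card ?S))"
    by (simp add: card_PiE ennreal_power power_one_over)
  also have "\<dots> = emeasure (uniform_count_measure ?S) {W}"
    using W fin by (simp add: emeasure_uniform_count_measure)
  finally show "emeasure (message_measure k M) {W} = emeasure (uniform_count_measure ?S) {W}" .
qed

lemma channel_output_measurable:
  "channel_output k n x W \<in> measurable (noise_measure N0 n) (Pi\<^sub>M {1..n} (\<lambda>_. borel))"
  unfolding channel_output_def noise_measure_eq by measurable

lemma decoder_slice_measurable: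
  assumes "is_decoder k n M g"
  shows "{Z \<in> space (noise_measure N0 n). g (channel_output k n x W Z) = W} \<in> sets (noise_measure N0 n)"
proof -
  have g: "g \<in> measurable (Pi\<^sub>M {1..n} (\<lambda>_. borel)) (count_space ({1..k} \<rightarrow>\<^sub>E {1..M}))"
    using assms unfolding is_decoder_def by (subst (asm) count_space_PiM_finite) auto
  have gc: "(\<lambda>Z. g (channel_output k n x W Z)) \<in> measurable (noise_measure N0 n) (count_space ({1..k} \<rightarrow>\<^sub>E {1..M}))"
    by (rule measurable_compose[OF channel_output_measurable g])
  show ?thesis
  proof (cases "W \<in> {1..k} \<rightarrow>\<^sub>E {1..M}")
    case True
    have "{Z \<in> space (noise_measure N0 n). g (channel_output k n x W Z) = W}
        = (\<lambda>Z. g (channel_output k n x W Z)) -` {W} \<inter> space (noise_measure N0 n)" by auto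
    then show ?thesis using measurable_sets[OF gc, of "{W}"] True by simp
  next
    case False
    then have "{Z \<in> space (noise_measure N0 n). g (channel_output k n x W Z) = W} = {}"
      using measurable_space[OF gc] by (metis (mono_tags, lifting) Collect_empty_eq space_count_space)
    then show ?thesis by (simp only: sets.empty_sets)
  qed
qed

lemma error_prob_eq_average:
  assumes N0: "N0 > 0" and M: "M \<ge> 1" and dec: "is_decoder k n M g"
  shows "error_prob N0 k n M x g =
    (\<Sum>W\<in>{1..k} \<rightarrow>\<^sub>E {1..M}. measure (noise_measure N0 n)
      {Z \<in> space (noise_measure N0 n). g (channel_output k n x W Z) \<noteq> W}) / real M ^ k"
proof -
  let ?S = "{1..k} \<rightarrow>\<^sub>E {1..M}" and ?G = "noise_measure N0 n"
  let ?E = "\<lambda>W. {Z \<in> space ?G. g (channel_output k n x W Z) \<noteq> W}"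
  interpret G: prob_space ?G
    unfolding noise_measure_eq by (rule prob_space_gauss_vec[OF N0])
  interpret P: prob_space "message_measure k M \<Otimes>\<^sub>M ?G"
    by (rule prob_space_message_noise[OF N0 M])
  have fin: "finite ?S" by (intro finite_PiE) auto
  have sp: "space (message_measure k M) = ?S"
    using sets_eq_imp_space_eq[OF sets_message_measure] by simp
  have "emeasure (message_measure k M \<Otimes>\<^sub>M ?G) (error_event N0 k n M x g)
      = (\<integral>\<^sup>+W. emeasure ?G (Pair W -` error_event N0 k n M x g) \<partial>message_measure k M)"
    by (rule G.emeasure_pair_measure_alt[OF error_event_measurable[OF dec]])
  also have "\<dots> = (\<integral>\<^sup>+W. emeasure ?G (?E W) \<partial>message_measure k M)"
  proof (rule nn_integral_cong)
    fix W assume "W \<in> space (message_measure k M)"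
    then have "Pair W -` error_event N0 k n M x g = ?E W"
      by (auto simp: error_event_def space_pair_measure)
    then show "emeasure ?G (Pair W -` error_event N0 k n M x g) = emeasure ?G (?E W)" by simp
  qed
  also have "\<dots> = (\<Sum>W\<in>?S. ennreal (measure ?G (?E W) / real M ^ k))"
    unfolding message_measure_eq[OF M] uniform_count_measure_def
    by (subst nn_integral_point_measure_finite[OF fin])
       (simp add: card_PiE G.emeasure_eq_measure divide_inverse mult.commute flip: ennreal_mult)
  also have "\<dots> = ennreal ((\<Sum>W\<in>?S. measure ?G (?E W)) / real M ^ k)"
    by (simp add: sum_ennreal sum_divide_distrib)
  finally show ?thesis
    by (simp add: error_prob_def measure_def sum_nonneg)
qed

lemma correct_prob_eq_average:
  assumes N0: "N0 > 0" and M: "M \<ge> 1" and dec: "is_decoder k n M g"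
  shows "(1 - error_prob N0 k n M x g) * real M ^ k =
    (\<Sum>W\<in>{1..k} \<rightarrow>\<^sub>E {1..M}. measure (noise_measure N0 n)
      {Z \<in> space (noise_measure N0 n). g (channel_output k n x W Z) = W})"
proof -
  let ?S = "{1..k} \<rightarrow>\<^sub>E {1..M}" and ?G = "noise_measure N0 n"
  interpret G: prob_space ?G
    unfolding noise_measure_eq by (rule prob_space_gauss_vec[OF N0])
  have "measure ?G {Z \<in> space ?G. g (channel_output k n x W Z) \<noteq> W}
      = 1 - measure ?G {Z \<in> space ?G. g (channel_output k n x W Z) = W}" for W
    using G.prob_compl[OF decoder_slice_measurable[OF dec, of N0 x W]]
    by (simp add: set_diff_eq conj_commute cong: conj_cong)
  then have "error_prob N0 k n M x g * real M ^ k =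
      (\<Sum>W\<in>?S. 1 - measure ?G {Z \<in> space ?G. g (channel_output k n x W Z) = W})"
    using M by (simp add: error_prob_eq_average[OF assms])
  then show ?thesis
    by (simp add: sum_subtractf card_PiE algebra_simps)
qed

text \<open>Each message vector is moved to pure noise by the change of measure. Orthogonal access
  makes the energy of the sum signal additive, so its likelihood ratio factors over the users. For a
  given output the decoder selects a single message vector, and bounding each factor by its maximum
  over \<open>w\<close> removes the decoder.\<close>

lemma correct_prob_le_integral_Max:
  assumes N0: "N0 > 0" and M: "M \<ge> 1" and dec: "is_decoder k n M g"
    and acc: "orthogonal_access k n M x"
  shows "ennreal ((1 - error_prob N0 k n M x g) * real M ^ k) \<le>
    (\<integral>\<^sup>+Y. ennreal (\<Prod>i=1..k. Max ((\<lambda>w. exp ((2 * dot n (x i w) Y - dot n (x i w) (x i w)) / N0)) ` {1..M}))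
      \<partial>gauss_vec N0 {1..n})"
proof -
  let ?S = "{1..k} \<rightarrow>\<^sub>E {1..M}" and ?G = "gauss_vec N0 {1..n}"
  let ?L = "\<lambda>i w Y. (2 * dot n (x i w) Y - dot n (x i w) (x i w)) / N0"
  interpret G: prob_space ?G by (rule prob_space_gauss_vec[OF N0])
  have fin: "finite ?S" by (intro finite_PiE) auto
  have g: "g \<in> measurable (Pi\<^sub>M {1..n} (\<lambda>_. borel)) (count_space ?S)"
    using dec unfolding is_decoder_def by (subst (asm) count_space_PiM_finite) auto
  have setsL: "sets (lborel_vec {1..n}) = sets (Pi\<^sub>M {1..n} (\<lambda>_. borel :: real measure))"
    by (intro sets_PiM_cong) auto
  have g' [measurable]: "g \<in> measurable (lborel_vec {1..n}) (count_space ?S)"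
    using g by (simp add: measurable_cong_sets[OF setsL refl])
  have setsG: "sets ?G = sets (lborel_vec {1..n})"
    by (intro sets_PiM_cong) auto
  have slice: "emeasure ?G {Z \<in> space ?G. g (channel_output k n x W Z) = W} =
      (\<integral>\<^sup>+Y. indicator {W} (g Y) * ennreal (\<Prod>i=1..k. exp (?L i (W i) Y)) \<partial>?G)" if W: "W \<in> ?S" for W
  proof -
    define s where "s j = (\<Sum>i=1..k. x i (W i) j)" for j
    have out: "channel_output k n x W Z = (\<lambda>j\<in>{1..n}. Z j + s j)" for Z
      by (simp add: channel_output_def s_def add.commute)
    have dots: "dot n s Y = (\<Sum>i=1..k. dot n (x i (W i)) Y)" for Y
      unfolding dot_def s_def by (simp add: sum_distrib_right, subst sum.swap) simp
    have dotr: "dot n u s = (\<Sum>i=1..k. dot n u (x i (W i)))" for u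
      unfolding dot_def s_def by (simp add: sum_distrib_left, subst sum.swap) simp
    have "dot n s s = (\<Sum>i=1..k. \<Sum>j=1..k. dot n (x i (W i)) (x j (W j)))"
      by (simp only: dots dotr) (rule sum.swap)
    also have "\<dots> = (\<Sum>i=1..k. \<Sum>j=1..k. if i = j then dot n (x i (W i)) (x i (W i)) else 0)"
      using acc W unfolding orthogonal_access_def by (intro sum.cong refl) (auto simp: PiE_iff)
    also have "\<dots> = (\<Sum>i=1..k. dot n (x i (W i)) (x i (W i)))"
      by (intro sum.cong refl) (subst sum.delta', auto)
    finally have ss: "dot n s s = (\<Sum>i=1..k. dot n (x i (W i)) (x i (W i)))" .
    have ex: "(2 * (\<Sum>j=1..n. s j * Y j) - (\<Sum>j=1..n. (s j)\<^sup>2)) / N0 = (\<Sum>i=1..k. ?L i (W i) Y)" for Y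
      using dots[of Y] ss
      by (simp add: dot_def power2_eq_square sum_subtractf flip: sum_divide_distrib sum_distrib_left)
    have m: "(\<lambda>Y. indicator {W} (g Y) :: ennreal) \<in> borel_measurable (lborel_vec {1..n})"
      by (rule measurable_compose[OF g']) simp
    have m2: "{Z \<in> space ?G. g (channel_output k n x W Z) = W} \<in> sets ?G"
      using decoder_slice_measurable[OF dec, of N0 x W] by (simp add: noise_measure_eq)
    have "emeasure ?G {Z \<in> space ?G. g (channel_output k n x W Z) = W} =
        (\<integral>\<^sup>+Z. indicator {W} (g (\<lambda>j\<in>{1..n}. Z j + s j)) \<partial>?G)"
      by (subst nn_integral_indicator[OF m2, symmetric])
         (intro nn_integral_cong, auto simp: out split: split_indicator)
    also have "\<dots> = (\<integral>\<^sup>+Y. indicator {W} (g Y) * ennreal (exp (\<Sum>i=1..k. ?L i (W i) Y)) \<partial>?G)"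
      by (subst nn_integral_gauss_vec_shift[OF N0 _ m]) (simp_all only: ex finite_atLeastAtMost)
    finally show ?thesis by (simp add: exp_sum)
  qed
  have mint: "(\<lambda>Y. indicator {W} (g Y) * ennreal (\<Prod>i=1..k. exp (?L i (W i) Y))) \<in> borel_measurable ?G" for W
  proof (rule borel_measurable_times_ennreal)
    show "(\<lambda>Y. indicator {W} (g Y) :: ennreal) \<in> borel_measurable ?G"
      unfolding measurable_cong_sets[OF setsG refl] by (rule measurable_compose[OF g']) simp
    show "(\<lambda>Y. ennreal (\<Prod>i=1..k. exp (?L i (W i) Y))) \<in> borel_measurable ?G"
      unfolding dot_def by measurable
  qed
  have "ennreal ((1 - error_prob N0 k n M x g) * real M ^ k) =
      (\<Sum>W\<in>?S. emeasure ?G {Z \<in> space ?G. g (channel_output k n x W Z) = W})"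
    unfolding correct_prob_eq_average[OF N0 M dec] noise_measure_eq
    by (simp only: G.emeasure_eq_measure sum_ennreal measure_nonneg)
  also have "\<dots> = (\<integral>\<^sup>+Y. (\<Sum>W\<in>?S. indicator {W} (g Y) * ennreal (\<Prod>i=1..k. exp (?L i (W i) Y))) \<partial>?G)"
    by (simp only: slice cong: sum.cong) (rule nn_integral_sum[symmetric], rule mint)
  also have "\<dots> \<le> (\<integral>\<^sup>+Y. ennreal (\<Prod>i=1..k. Max ((\<lambda>w. exp (?L i w Y)) ` {1..M})) \<partial>?G)"
  proof (rule nn_integral_mono)
    fix Y assume Y: "Y \<in> space ?G"
    have gY: "g Y \<in> ?S"
      using measurable_space[OF g', of Y] Y sets_eq_imp_space_eq[OF setsG] by simp
    have "(\<Sum>W\<in>?S. indicator {W} (g Y) * ennreal (\<Prod>i=1..k. exp (?L i (W i) Y)))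
        = (\<Sum>W\<in>?S. if W = g Y then ennreal (\<Prod>i=1..k. exp (?L i (g Y i) Y)) else 0)"
      by (intro sum.cong refl) (auto split: split_indicator)
    also have "\<dots> = ennreal (\<Prod>i=1..k. exp (?L i (g Y i) Y))"
      using fin gY by simp
    also have "\<dots> \<le> ennreal (\<Prod>i=1..k. Max ((\<lambda>w. exp (?L i w Y)) ` {1..M}))"
      using gY by (intro ennreal_leI prod_mono conjI Max_ge) (auto simp: PiE_iff)
    finally show "(\<Sum>W\<in>?S. indicator {W} (g Y) * ennreal (\<Prod>i=1..k. exp (?L i (W i) Y)))
        \<le> ennreal (\<Prod>i=1..k. Max ((\<lambda>w. exp (?L i w Y)) ` {1..M}))" .
  qed
  finally show ?thesis .
qed

section \<open>Codeword directions and factorization over the users\<close>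

lemma
  assumes N0: "N0 > 0" and J: "finite J"
  shows indep_vars_gauss_vec: "prob_space.indep_vars (gauss_vec N0 J) (\<lambda>_. borel) (\<lambda>j u. u j) J"
    and distr_gauss_vec_component: "j \<in> J \<Longrightarrow> distr (gauss_vec N0 J) borel (\<lambda>u. u j) = gauss N0"
proof -
  interpret G: prob_space "gauss_vec N0 J" by (rule prob_space_gauss_vec[OF N0])
  have comp: "distr (gauss_vec N0 J) borel (\<lambda>u. u j) = gauss N0" if "j \<in> J" for j
    using distr_PiM_component[of J "\<lambda>_. gauss N0" j] that prob_space_gauss[OF N0]
    by (simp cong: distr_cong)
  then show "j \<in> J \<Longrightarrow> distr (gauss_vec N0 J) borel (\<lambda>u. u j) = gauss N0" .
  show "G.indep_vars (\<lambda>_. borel) (\<lambda>j u. u j) J"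
  proof (cases "J = {}")
    case True
    then show ?thesis unfolding G.indep_vars_def G.indep_sets_def by auto
  next
    case False
    have s: "sets (Pi\<^sub>M J (\<lambda>_. borel :: real measure)) = sets (gauss_vec N0 J)"
      by (intro sets_PiM_cong) auto
    have "distr (gauss_vec N0 J) (Pi\<^sub>M J (\<lambda>_. borel)) (\<lambda>u. \<lambda>j\<in>J. u j) =
        distr (gauss_vec N0 J) (gauss_vec N0 J) (\<lambda>u. u)"
      by (intro distr_cong s refl) (auto simp: space_PiM PiE_def extensional_restrict)
    also have "\<dots> = gauss_vec N0 J" by (rule distr_id)
    also have "\<dots> = (\<Pi>\<^sub>M j\<in>J. distr (gauss_vec N0 J) borel (\<lambda>u. u j))"
      by (intro PiM_cong refl) (simp add: comp)
    finally show ?thesis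
      by (subst G.indep_vars_iff_distr_eq_PiM'[OF False]) measurable
  qed
qed

text \<open>Bessel's inequality for the \<open>m\<close>-th standard basis vector and its projection
  \<open>p\<close> onto the span bounds the sum of the squared \<open>m\<close>-th components by 1;
  summing over \<open>m\<close> counts the unit vectors.\<close>

lemma card_orthonormal_le:
  fixes v :: "'j \<Rightarrow> 'i \<Rightarrow> real"
  assumes I: "finite I" and J: "finite J"
    and orth: "\<And>j l. j \<in> J \<Longrightarrow> l \<in> J \<Longrightarrow> (\<Sum>i\<in>I. v j i * v l i) = (if j = l then 1 else 0)"
  shows "card J \<le> card I"
proof -
  have bessel: "(\<Sum>j\<in>J. (v j m)\<^sup>2) \<le> 1" if "m \<in> I" for m
  proof -
    define p where "p i = (\<Sum>j\<in>J. v j m * v j i)" for i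
    define \<delta> where "\<delta> i = (if i = m then 1 else 0 :: real)" for i
    have pp: "(\<Sum>i\<in>I. p i * p i) = p m"
    proof -
      have "(\<Sum>i\<in>I. p i * p i) = (\<Sum>i\<in>I. \<Sum>j\<in>J. \<Sum>l\<in>J. v j m * v l m * (v j i * v l i))"
        by (simp add: p_def sum_distrib_left sum_distrib_right mult_ac)
      also have "\<dots> = (\<Sum>j\<in>J. \<Sum>l\<in>J. v j m * v l m * (\<Sum>i\<in>I. v j i * v l i))"
        by (subst sum.swap, subst sum.swap[of _ J I]) (simp add: sum_distrib_left sum.swap[of _ J I])
      also have "\<dots> = (\<Sum>j\<in>J. \<Sum>l\<in>J. if j = l then v j m * v l m else 0)"
        by (intro sum.cong refl) (simp add: orth)
      also have "\<dots> = p m" using J by (simp add: p_def)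
      finally show ?thesis .
    qed
    have "0 \<le> (\<Sum>i\<in>I. (\<delta> i - p i)\<^sup>2)" by (intro sum_nonneg) simp
    also have "\<dots> = (\<Sum>i\<in>I. \<delta> i * \<delta> i - 2 * (\<delta> i * p i) + p i * p i)"
      by (intro sum.cong refl) (simp add: power2_eq_square algebra_simps)
    also have "\<dots> = (\<Sum>i\<in>I. \<delta> i * \<delta> i) - 2 * (\<Sum>i\<in>I. \<delta> i * p i) + p m"
      by (simp only: sum.distrib sum_subtractf pp sum_distrib_left)
    also have "\<dots> = 1 - p m"
      using I that by (simp add: \<delta>_def if_distrib[of "\<lambda>x. x * _"] cong: if_cong)
    finally show ?thesis by (simp add: p_def power2_eq_square)
  qed
  have "real (card J) = (\<Sum>j\<in>J. \<Sum>i\<in>I. v j i * v j i)" by (simp add: orth)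
  also have "\<dots> = (\<Sum>i\<in>I. \<Sum>j\<in>J. (v j i)\<^sup>2)" by (subst sum.swap) (simp add: power2_eq_square)
  also have "\<dots> \<le> (\<Sum>i\<in>I. 1)" by (intro sum_mono bessel)
  finally show ?thesis by simp
qed

definition code_norm :: "nat \<Rightarrow> codebooks \<Rightarrow> nat \<Rightarrow> nat \<Rightarrow> real" where
  "code_norm n x i w = sqrt (dot n (x i w) (x i w))"

lemma dot_self_nonneg: "0 \<le> dot n u u"
  by (simp add: dot_def sum_nonneg)

lemma code_norm_nonneg [simp]: "0 \<le> code_norm n x i w"
  by (simp add: code_norm_def dot_self_nonneg)

lemma code_norm_square: "(code_norm n x i w)\<^sup>2 = dot n (x i w) (x i w)"
  by (simp add: code_norm_def dot_self_nonneg)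

text \<open>Division by zero gives the zero vector for a zero codeword. Such pairs fail to be unit
  vectors, which is the reason for the set \<open>K\<close> in
  \<open>nn_integral_gauss_vec_orthonormal\<close>.\<close>

definition unit_codeword :: "nat \<Rightarrow> codebooks \<Rightarrow> nat \<times> nat \<Rightarrow> nat \<Rightarrow> real" where
  "unit_codeword n x = (\<lambda>(i, w) j. x i w j / code_norm n x i w)"

lemma dot_unit_codeword:
  "code_norm n x i w * (\<Sum>j=1..n. unit_codeword n x (i, w) j * Y j) = dot n (x i w) Y"
proof (cases "code_norm n x i w = 0")
  case True
  then have "\<forall>j\<in>{1..n}. x i w j = 0"
    by (simp add: code_norm_def dot_def sum_nonneg_eq_0_iff)
  with True show ?thesis by (simp add: dot_def)
qed (simp add: unit_codeword_def dot_def sum_distrib_left)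

lemma unit_codeword_orthonormal:
  assumes acc: "orthogonal_access k n M x" and cb: "orthogonal_codebooks k n M x"
    and "p \<in> {1..k} \<times> {1..M}" "q \<in> {1..k} \<times> {1..M}"
  shows "(\<Sum>j=1..n. unit_codeword n x p j * unit_codeword n x q j) =
    (if p = q \<and> p \<in> {(i, w). code_norm n x i w \<noteq> 0} then 1 else 0)"
proof -
  obtain i w i' w' where pq: "p = (i, w)" "q = (i', w')" by (cases p, cases q)
  have "(\<Sum>j=1..n. unit_codeword n x p j * unit_codeword n x q j)
      = dot n (x i w) (x i' w') / (code_norm n x i w * code_norm n x i' w')"
    by (simp add: pq unit_codeword_def dot_def sum_divide_distrib)
  moreover have "dot n (x i w) (x i' w') = 0" if "p \<noteq> q"
    using acc cb assms(3,4) that unfolding orthogonal_access_def orthogonal_codebooks_def pq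
    by (cases "i = i'") auto
  moreover have "dot n (x i w) (x i w) = code_norm n x i w * code_norm n x i w"
    by (simp add: code_norm_square flip: power2_eq_square)
  ultimately show ?thesis using pq by auto
qed

text \<open>The projections of the noise on the codeword directions can be replaced by independent
  Gaussians, one for each pair of user and message; a zero codeword gets a fictitious one, on which
  its ratio 1 does not depend. The maxima of different users then involve disjoint blocks of
  coordinates, so the expectation of their product factors.\<close>

lemma correct_prob_le_prod:
  assumes N0: "N0 > 0" and M: "M \<ge> 1" and dec: "is_decoder k n M g"
    and acc: "orthogonal_access k n M x" and cb: "orthogonal_codebooks k n M x"
  shows "ennreal ((1 - error_prob N0 k n M x g) * real M ^ k) \<le>
    (\<Prod>i=1..k. \<integral>\<^sup>+u. ennreal (Max ((\<lambda>w. lr N0 (code_norm n x i w) (u (i, w))) ` {1..M}))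
      \<partial>gauss_vec N0 ({1..k} \<times> {1..M}))"
proof -
  let ?J = "{1..k} \<times> {1..M}"
  let ?G = "gauss_vec N0 ?J"
  let ?a = "code_norm n x"
  define m where "m i u = Max ((\<lambda>w. lr N0 (?a i w) (u (i, w))) ` {1..M})" for i :: nat and u :: "nat \<times> nat \<Rightarrow> real"
  interpret G: prob_space ?G by (rule prob_space_gauss_vec[OF N0])
  have m: "(\<lambda>u. ennreal (m i u)) \<in> borel_measurable (Pi\<^sub>M ({i} \<times> {1..M}) (\<lambda>_. borel))" for i
  proof -
    have "(\<lambda>u. Max ((\<lambda>w. lr N0 (?a i w) (u (i, w))) ` {1..M})) \<in> borel_measurable (Pi\<^sub>M ({i} \<times> {1..M}) (\<lambda>_. borel))"
      by (intro borel_measurable_Max) measurable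
    then show ?thesis unfolding m_def by measurable
  qed
  have m': "(\<lambda>u. m i u) \<in> borel_measurable (lborel_vec ?J)" if "i \<in> {1..k}" for i
    unfolding m_def using that by (intro borel_measurable_Max) measurable
  have m_nn: "0 \<le> m i u" for i u
  proof -
    have "m i u \<in> (\<lambda>w. lr N0 (?a i w) (u (i, w))) ` {1..M}" unfolding m_def using M by (intro Max_in) auto
    then show ?thesis by auto
  qed
  have "ennreal ((1 - error_prob N0 k n M x g) * real M ^ k) \<le>
      (\<integral>\<^sup>+Y. ennreal (\<Prod>i=1..k. m i (\<lambda>p\<in>?J. \<Sum>j=1..n. unit_codeword n x p j * Y j)) \<partial>gauss_vec N0 {1..n})"
  proof (rule order_trans[OF correct_prob_le_integral_Max[OF N0 M dec acc]], intro nn_integral_mono ennreal_leI eq_refl prod.cong refl)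
    fix Y :: "nat \<Rightarrow> real" and i assume i: "i \<in> {1..k}"
    have "exp ((2 * dot n (x i w) Y - dot n (x i w) (x i w)) / N0) =
        lr N0 (?a i w) (\<Sum>j=1..n. unit_codeword n x (i, w) j * Y j)" for w
      unfolding lr_def dot_unit_codeword[symmetric, of n x i w Y] code_norm_square
      by (simp add: mult.assoc)
    then show "Max ((\<lambda>w. exp ((2 * dot n (x i w) Y - dot n (x i w) (x i w)) / N0)) ` {1..M}) =
        m i (\<lambda>p\<in>?J. \<Sum>j=1..n. unit_codeword n x p j * Y j)"
      unfolding m_def using i by (intro arg_cong[where f=Max] image_cong refl) auto
  qed
  also have "\<dots> = (\<integral>\<^sup>+u. ennreal (\<Prod>i=1..k. m i u) \<partial>?G)"
  proof (rule nn_integral_gauss_vec_orthonormal[OF N0, where f="\<lambda>u. ennreal (\<Prod>i=1..k. m i u)"])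
    show "(\<lambda>u. ennreal (\<Prod>i=1..k. m i u)) \<in> borel_measurable (lborel_vec ?J)"
      using m' by (intro measurable_compose[OF borel_measurable_prod measurable_ennreal]) auto
    show "(\<Sum>j=1..n. unit_codeword n x p j * unit_codeword n x q j) =
      (if p = q \<and> p \<in> {(i, w). code_norm n x i w \<noteq> 0} then 1 else 0)" if "p \<in> ?J" "q \<in> ?J" for p q
      by (rule unit_codeword_orthonormal[OF acc cb that])
    fix u u' :: "nat \<times> nat \<Rightarrow> real"
    assume eq: "\<And>p. p \<in> ?J \<inter> {(i, w). code_norm n x i w \<noteq> 0} \<Longrightarrow> u p = u' p"
    have "m i u = m i u'" if "i \<in> {1..k}" for i
      unfolding m_def
    proof (intro arg_cong[where f=Max] image_cong refl)
      fix w assume "w \<in> {1..M}"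
      then show "lr N0 (?a i w) (u (i, w)) = lr N0 (?a i w) (u' (i, w))"
        using eq[of "(i, w)"] that by (cases "?a i w = 0") (auto simp: lr_def)
    qed
    then show "ennreal (\<Prod>i=1..k. m i u) = ennreal (\<Prod>i=1..k. m i u')" by simp
  qed auto
  also have "\<dots> = (\<integral>\<^sup>+u. (\<Prod>i=1..k. ennreal (m i (restrict u ({i} \<times> {1..M})))) \<partial>?G)"
    by (intro nn_integral_cong) (simp add: prod_ennreal m_nn, simp add: m_def)
  also have "\<dots> = (\<Prod>i=1..k. \<integral>\<^sup>+u. ennreal (m i (restrict u ({i} \<times> {1..M}))) \<partial>?G)"
  proof (rule G.indep_vars_nn_integral)
    have "G.indep_vars (\<lambda>i. Pi\<^sub>M ({i} \<times> {1..M}) (\<lambda>_. borel)) (\<lambda>i u. restrict (\<lambda>p. u p) ({i} \<times> {1..M})) {1..k}"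
      by (rule G.indep_vars_restrict[OF indep_vars_gauss_vec[OF N0]]) (auto simp: disjoint_family_on_def)
    from G.indep_vars_compose2[OF this m]
    show "G.indep_vars (\<lambda>_. borel) (\<lambda>i u. ennreal (m i (restrict u ({i} \<times> {1..M})))) {1..k}" by simp
  qed auto
  also have "\<dots> = (\<Prod>i=1..k. \<integral>\<^sup>+u. ennreal (m i u) \<partial>?G)"
    by (intro prod.cong nn_integral_cong refl) (simp add: m_def)
  finally show ?thesis by (simp only: m_def)
qed

section \<open>Converse bounds for a single code\<close>

locale orthogonal_code =
  fixes N0 :: real and k n M :: nat and E \<epsilon> :: real and x :: codebooks
    and g :: "(nat \<Rightarrow> real) \<Rightarrow> nat \<Rightarrow> nat"
  assumes N0: "N0 > 0" and k: "k \<ge> 1"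
    and code: "symmetric_code N0 k n M E \<epsilon> x g"
    and acc: "orthogonal_access k n M x" and cb: "orthogonal_codebooks k n M x"
begin

lemma size_pos: "M \<ge> 1" and dec: "is_decoder k n M g" and err: "error_prob N0 k n M x g \<le> \<epsilon>"
  using code by (auto simp: symmetric_code_def)

lemma code_norm_le:
  assumes "0 \<le> D" "E \<le> D\<^sup>2" "i \<in> {1..k}" "w \<in> {1..M}"
  shows "code_norm n x i w \<le> D"
proof -
  have "(code_norm n x i w)\<^sup>2 \<le> D\<^sup>2"
    using code assms unfolding code_norm_square symmetric_code_def dot_def
    by (force simp: power2_eq_square)
  then show ?thesis using assms(1) by (rule power2_le_imp_le)
qed

abbreviation "Gk \<equiv> gauss_vec N0 ({1..k} \<times> {1..M})"
abbreviation "max_lr i u \<equiv> Max ((\<lambda>w. lr N0 (code_norm n x i w) (u (i, w))) ` {1..M})"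

sublocale G: prob_space Gk by (rule prob_space_gauss_vec[OF N0])

lemma user_indep:
  assumes "i \<in> {1..k}"
  shows "G.indep_vars (\<lambda>_. borel) (\<lambda>w u. u (i, w)) {1..M}"
proof -
  have "G.indep_vars (\<lambda>w. Pi\<^sub>M {(i, w)} (\<lambda>_. borel)) (\<lambda>w u. restrict (\<lambda>p. u p) {(i, w)}) {1..M}"
    using assms
    by (intro G.indep_vars_restrict[OF indep_vars_gauss_vec[OF N0]]) (auto simp: disjoint_family_on_def)
  from G.indep_vars_compose2[OF this, of "\<lambda>w r. r (i, w)" "\<lambda>_. borel"]
  show ?thesis by simp
qed

lemmas user_distr = distr_gauss_vec_component[OF N0, of "{1..k} \<times> {1..M}"]

lemma correct_le_prod:
  assumes B: "\<And>i. i \<in> {1..k} \<Longrightarrow> (\<integral>\<^sup>+u. ennreal (max_lr i u) \<partial>Gk) \<le> ennreal (B i)"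
    and B0: "\<And>i. i \<in> {1..k} \<Longrightarrow> 0 \<le> B i"
  shows "(1 - \<epsilon>) * real M ^ k \<le> (\<Prod>i=1..k. B i)"
proof -
  have "ennreal ((1 - error_prob N0 k n M x g) * real M ^ k) \<le> (\<Prod>i=1..k. \<integral>\<^sup>+u. ennreal (max_lr i u) \<partial>Gk)"
    by (rule correct_prob_le_prod[OF N0 size_pos dec acc cb])
  also have "\<dots> \<le> (\<Prod>i=1..k. ennreal (B i))" by (intro prod_mono_ennreal B)
  also have "\<dots> = ennreal (\<Prod>i=1..k. B i)" by (intro prod_ennreal B0)
  finally have "(1 - error_prob N0 k n M x g) * real M ^ k \<le> (\<Prod>i=1..k. B i)"
    by (subst (asm) ennreal_le_iff) (auto intro!: prod_nonneg B0)
  moreover have "(1 - \<epsilon>) * real M ^ k \<le> (1 - error_prob N0 k n M x g) * real M ^ k"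
    using err by (intro mult_right_mono) auto
  ultimately show ?thesis by simp
qed

lemma correct_le_power:
  assumes "\<And>i. i \<in> {1..k} \<Longrightarrow> (\<integral>\<^sup>+u. ennreal (max_lr i u) \<partial>Gk) \<le> ennreal (real M - c)" and c: "c \<le> real M"
  shows "1 - \<epsilon> \<le> (1 - c / real M) ^ k"
proof -
  have "(1 - \<epsilon>) * real M ^ k \<le> (\<Prod>i=1..k. real M - c)"
    using assms by (intro correct_le_prod) auto
  also have "\<dots> = (1 - c / real M) ^ k * real M ^ k"
    using size_pos by (simp add: diff_divide_distrib flip: power_mult_distrib) (simp add: algebra_simps)
  finally show ?thesis using size_pos by simp
qed

lemma correct_le_sphere_packing:
  assumes D: "0 \<le> D" "E \<le> D\<^sup>2" and T: "D \<le> 2 * T"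
  shows "1 - \<epsilon> \<le> (1 - (measure (gauss N0) {..T - D} - exp ((2 * T * D - D\<^sup>2) / N0) / real M)) ^ k"
proof -
  interpret g: prob_space "gauss N0" by (rule prob_space_gauss[OF N0])
  let ?c = "real M * measure (gauss N0) {..T - D} - exp ((2 * T * D - D\<^sup>2) / N0)"
  have "1 - \<epsilon> \<le> (1 - ?c / real M) ^ k"
  proof (rule correct_le_power)
    show "(\<integral>\<^sup>+u. ennreal (max_lr i u) \<partial>Gk) \<le> ennreal (real M - ?c)" if i: "i \<in> {1..k}" for i
      using G.nn_integral_Max_lr_sphere_packing[OF N0, of "{1..M}" "\<lambda>w u. u (i, w)" "code_norm n x i" D T]
        size_pos user_indep[OF i] user_distr code_norm_le[OF D i] T i by auto
    have "real M * measure (gauss N0) {..T - D} \<le> real M * 1" by (intro mult_left_mono) auto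
    moreover have "0 \<le> exp ((2 * T * D - D\<^sup>2) / N0)" by simp
    ultimately show "?c \<le> real M" by linarith
  qed
  then show ?thesis using size_pos by (simp add: diff_divide_distrib)
qed

lemma correct_le_pairwise:
  assumes D: "0 \<le> D" "E \<le> D\<^sup>2" and h: "2 * h \<le> M"
    and q: "q = measure (gauss N0) {D / 2..}"
  shows "1 - \<epsilon> \<le> (1 - (1 - (1 - q) ^ h)\<^sup>2 / real M) ^ k"
proof (rule correct_le_power)
  interpret g: prob_space "gauss N0" by (rule prob_space_gauss[OF N0])
  show "(\<integral>\<^sup>+u. ennreal (max_lr i u) \<partial>Gk) \<le> ennreal (real M - (1 - (1 - q) ^ h)\<^sup>2)" if i: "i \<in> {1..k}" for i
    using G.nn_integral_Max_lr_pairwise[OF N0, of "{1..M}" "\<lambda>w u. u (i, w)" "code_norm n x i" D "{1..h}" "{h+1..2*h}" q]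
      size_pos user_indep[OF i] user_distr code_norm_le[OF D i] i h q by (auto simp: power2_eq_square)
  have "0 \<le> q" "q \<le> 1" by (auto simp: q)
  then have "0 \<le> (1 - q) ^ h" "(1 - q) ^ h \<le> 1" by (auto intro: power_le_one)
  then have "(1 - (1 - q) ^ h)\<^sup>2 \<le> 1" by (simp add: power_le_one)
  then show "(1 - (1 - q) ^ h)\<^sup>2 \<le> real M" using size_pos by simp
qed

text \<open>Dimension limits only the nonzero codewords, and the definition of orthogonality allows
  any number of zero ones. Keeping the factor of one user and bounding every other factor by
  \<open>M\<close> shows that each user has at least (1 - \<epsilon>) M - 1 nonzero codewords; those
  of all users together are orthogonal in n dimensions.\<close>

lemma codebook_size_le: "real k * ((1 - \<epsilon>) * real M - 1) \<le> real n"
proof -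
  let ?K = "{p \<in> {1..k} \<times> {1..M}. case p of (i, w) \<Rightarrow> code_norm n x i w \<noteq> 0}"
  let ?c = "\<lambda>i. card {w \<in> {1..M}. code_norm n x i w \<noteq> 0}"
  have user: "(1 - \<epsilon>) * real M - 1 \<le> real (?c i)" if i: "i \<in> {1..k}" for i
  proof -
    define B where "B l = (if l = i then real (?c i) + 1 else real M)" for l
    have "(1 - \<epsilon>) * real M ^ k \<le> (\<Prod>l=1..k. B l)"
    proof (rule correct_le_prod)
      show "(\<integral>\<^sup>+u. ennreal (max_lr l u) \<partial>Gk) \<le> ennreal (B l)" if l: "l \<in> {1..k}" for l
      proof (cases "l = i")
        case True
        then show ?thesis
          using G.nn_integral_Max_lr_nonzero[OF N0, of "{1..M}" "\<lambda>w u. u (i, w)" "code_norm n x i"]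
            size_pos user_indep[OF i] user_distr i by (auto simp: B_def)
      next
        \<comment> \<open>With both index sets empty the pairwise bound degenerates to the trivial
          bound \<open>M\<close>.\<close>
        case False
        then show ?thesis
          using G.nn_integral_Max_lr_pairwise[OF N0, of "{1..M}" "\<lambda>w u. u (l, w)" "code_norm n x l" "sqrt E" "{}" "{}"]
            size_pos user_indep[OF l] user_distr l code_norm_le[of "sqrt E" l] code by (auto simp: B_def symmetric_code_def)
      qed
    qed (simp add: B_def)
    also have "(\<Prod>l=1..k. B l) = (real (?c i) + 1) * (\<Prod>l\<in>{1..k} - {i}. B l)"
      using i by (subst prod.remove[of _ i]) (auto simp: B_def)
    also have "(\<Prod>l\<in>{1..k} - {i}. B l) = real M ^ (k - 1)"
      using i by (simp add: B_def)
    finally have "(1 - \<epsilon>) * real M * real M ^ (k - 1) \<le> (real (?c i) + 1) * real M ^ (k - 1)"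
      using k by (simp add: power_eq_if mult_ac)
    then show ?thesis using size_pos by simp
  qed
  have "real k * ((1 - \<epsilon>) * real M - 1) = (\<Sum>i=1..k. (1 - \<epsilon>) * real M - 1)" by simp
  also have "\<dots> \<le> (\<Sum>i=1..k. real (?c i))" by (intro sum_mono user)
  also have "\<dots> = real (card (SIGMA i:{1..k}. {w \<in> {1..M}. code_norm n x i w \<noteq> 0}))"
    by (subst card_SigmaI) auto
  also have "(SIGMA i:{1..k}. {w \<in> {1..M}. code_norm n x i w \<noteq> 0}) = ?K" by auto
  also have "card ?K \<le> card {1..n}"
    using unit_codeword_orthonormal[OF acc cb]
    by (intro card_orthonormal_le[where v="unit_codeword n x"]) auto
  finally show ?thesis by simp
qed

end

section \<open>Lower bounds on the error exponent\<close>

lemma quadratic_dominates: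
  fixes \<alpha> \<beta> \<gamma> :: real
  assumes "\<alpha> > 0"
  shows "eventually (\<lambda>b. \<beta> * b + \<gamma> \<le> \<alpha> * b\<^sup>2) at_top"
proof -
  have "eventually (\<lambda>b. b \<ge> max 1 ((\<bar>\<beta>\<bar> + \<bar>\<gamma>\<bar>) / \<alpha>)) at_top" by (rule eventually_ge_at_top)
  then show ?thesis
  proof eventually_elim
    case (elim b)
    have "\<beta> * b + \<gamma> \<le> \<bar>\<beta>\<bar> * b + \<bar>\<gamma>\<bar> * b"
      using elim mult_left_mono[of 1 b "\<bar>\<gamma>\<bar>"] by (intro add_mono mult_right_mono) auto
    also have "\<dots> = (\<bar>\<beta>\<bar> + \<bar>\<gamma>\<bar>) * b" by (simp add: algebra_simps)
    also have "\<dots> \<le> (\<alpha> * b) * b"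
      using elim assms by (intro mult_right_mono) (auto simp: divide_le_eq mult.commute)
    finally show ?case by (simp add: power2_eq_square)
  qed
qed

lemma sqrt_ln_at_top: "filterlim (\<lambda>M::nat. sqrt (ln (real M))) at_top at_top"
  by (intro filterlim_compose[OF sqrt_at_top] filterlim_compose[OF ln_at_top] filterlim_real_sequentially)

text \<open>\<open>\<kappa>\<close> is the energy in units of \<open>N0 * ln M\<close>, that is \<open>1 / (N0 * R)\<close> at rate \<open>R\<close> in nats; \<open>a\<close> is
  the exponent of \<open>1 / M\<close> in a lower bound on the error probability of a single user.\<close>

definition error_exponent_bound :: "real \<Rightarrow> real \<Rightarrow> real \<Rightarrow> bool" where
  "error_exponent_bound N0 \<kappa> a \<longleftrightarrow> (\<exists>C>0. \<forall>k n M E \<epsilon> x g.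
     orthogonal_code N0 k n M E \<epsilon> x g \<and> M \<ge> 2 \<and> E \<le> \<kappa> * N0 * ln (real M) \<longrightarrow>
     1 - \<epsilon> \<le> exp (- (C * real k * real M powr (- a))))"

text \<open>The loss per user in \<open>correct_le_pairwise\<close> for D^2 = \<kappa> N0 ln M and a
  codebook split into halves.\<close>

definition pairwise_error :: "real \<Rightarrow> real \<Rightarrow> nat \<Rightarrow> real" where
  "pairwise_error N0 \<kappa> M =
     (1 - (1 - measure (gauss N0) {sqrt \<kappa> * sqrt (ln (real M)) / 2 * sqrt N0..}) ^ (M div 2))\<^sup>2 / real M"

lemma
  assumes N0: "N0 > 0" and \<kappa>: "\<kappa> > 0" and M: "M \<ge> 2"
  shows pairwise_error_pos: "pairwise_error N0 \<kappa> M > 0"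
    and pairwise_error_le_1: "pairwise_error N0 \<kappa> M \<le> 1"
proof -
  interpret prob_space "gauss N0" by (rule prob_space_gauss[OF N0])
  let ?x = "sqrt \<kappa> * sqrt (ln (real M)) / 2"
  let ?q = "measure (gauss N0) {?x * sqrt N0..}"
  have "0 < exp (- (?x + 1)\<^sup>2) / sqrt pi" by simp
  also have "\<dots> \<le> ?q" using \<kappa> M by (intro gauss_upper_tail_ge[OF N0]) auto
  finally have q: "0 < ?q" "?q \<le> 1" by auto
  have h: "M div 2 > 0" using M by linarith
  have "(1 - ?q) ^ (M div 2) < 1" using q h by (intro power_less_one_iff[THEN iffD2]) auto
  moreover have "0 \<le> (1 - ?q) ^ (M div 2)" using q by simp
  ultimately show "pairwise_error N0 \<kappa> M > 0" "pairwise_error N0 \<kappa> M \<le> 1"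
    using M power_le_one[of "1 - (1 - ?q) ^ (M div 2)" 2] by (auto simp: pairwise_error_def divide_le_eq)
qed

lemma correct_le_pairwise_error:
  assumes code: "orthogonal_code N0 k n M E \<epsilon> x g" and \<kappa>: "\<kappa> > 0" and M: "M \<ge> 2"
    and E: "E \<le> \<kappa> * N0 * ln (real M)"
  shows "1 - \<epsilon> \<le> (1 - pairwise_error N0 \<kappa> M) ^ k"
proof -
  interpret orthogonal_code N0 k n M E \<epsilon> x g by (rule code)
  have "1 - \<epsilon> \<le> (1 - (1 - (1 - measure (gauss N0) {sqrt (\<kappa> * N0 * ln (real M)) / 2..}) ^ (M div 2))\<^sup>2 / real M) ^ k"
    using E \<kappa> M N0 by (intro correct_le_pairwise) auto
  then show ?thesis by (simp add: pairwise_error_def real_sqrt_mult mult_ac)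
qed

text \<open>A code need not have large \<open>M\<close>, while \<open>p M\<close> is controlled only
  eventually. For the finitely many smaller \<open>M \<ge> 2\<close> the pairwise error is positive,
  so a minimum over them gives one constant \<open>C\<close> for all. The step from a power to the
  exponential is 1 - y \<le> exp (- y).\<close>

lemma error_exponent_boundI:
  assumes N0: "N0 > 0" and \<kappa>: "\<kappa> > 0" and c: "c > 0"
    and ev: "eventually (\<lambda>M. c * real M powr (- a) \<le> p M) at_top"
    and p: "\<And>k n M E \<epsilon> x g. orthogonal_code N0 k n M E \<epsilon> x g \<Longrightarrow> M \<ge> 2 \<Longrightarrow> E \<le> \<kappa> * N0 * ln (real M) \<Longrightarrow>
      1 - \<epsilon> \<le> (1 - p M) ^ k"
    and p1: "\<And>M. p M \<le> 1"
  shows "error_exponent_bound N0 \<kappa> a"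
proof -
  from ev obtain M0 where M0: "\<And>M. M \<ge> M0 \<Longrightarrow> c * real M powr (- a) \<le> p M"
    by (auto simp: eventually_at_top_linorder)
  let ?r = "\<lambda>M. pairwise_error N0 \<kappa> M / real M powr (- a)"
  define C where "C = Min (insert c (?r ` {2..<M0 + 3}))"
  have Cpos: "C > 0"
    using c pairwise_error_pos[OF N0 \<kappa>] by (auto simp: C_def)
  have Cc: "C \<le> c" unfolding C_def by (intro Min_le) auto
  have Cr: "C \<le> ?r M" if "2 \<le> M" "M < M0" for M
    unfolding C_def using that by (intro Min_le) auto
  have powk: "1 - \<epsilon> \<le> exp (- (C * real k * real M powr (- a)))"
    if "1 - \<epsilon> \<le> (1 - y) ^ k" "C * real M powr (- a) \<le> y" "y \<le> 1" for \<epsilon> y k M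
  proof -
    have "1 - y \<le> exp (- y)" using exp_ge_add_one_self[of "- y"] by simp
    also have "\<dots> \<le> exp (- (C * real M powr (- a)))" using that by simp
    finally have "(1 - y) ^ k \<le> exp (- (C * real M powr (- a))) ^ k" using that by (intro power_mono) auto
    also have "\<dots> = exp (- (C * real k * real M powr (- a)))"
      by (simp add: mult_ac flip: exp_of_nat_mult)
    finally show ?thesis using that by simp
  qed
  show ?thesis
    unfolding error_exponent_bound_def
  proof (intro exI[of _ C] conjI allI impI Cpos)
    fix k n M E \<epsilon> x g
    assume "orthogonal_code N0 k n M E \<epsilon> x g \<and> M \<ge> 2 \<and> E \<le> \<kappa> * N0 * ln (real M)"
    then have A: "orthogonal_code N0 k n M E \<epsilon> x g" "M \<ge> 2" "E \<le> \<kappa> * N0 * ln (real M)" by auto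
    show "1 - \<epsilon> \<le> exp (- (C * real k * real M powr (- a)))"
    proof (cases "M < M0")
      case True
      show ?thesis
        using Cr[OF A(2) True] A(2) pairwise_error_le_1[OF N0 \<kappa> A(2)]
        by (intro powk[OF correct_le_pairwise_error[OF A(1) \<kappa> A(2,3)]]) (auto simp: le_divide_eq split: if_splits)
    next
      case False
      have "C * real M powr (- a) \<le> c * real M powr (- a)" using Cc by (intro mult_right_mono) auto
      also have "\<dots> \<le> p M" using False by (intro M0) auto
      finally show ?thesis using powk[OF p[OF A]] p1 by auto
    qed
  qed
qed

text \<open>The loss per user in \<open>correct_le_sphere_packing\<close> for D^2 = \<kappa> N0 ln M
  and T^2 = \<tau> N0 ln M. The second exponent is written so as to exceed (sqrt \<kappa> - sqrt
  \<tau>)^2, the exponent of the Gaussian tail for \<tau> < \<kappa>, visibly by 1 - \<tau>.\<close>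

definition sphere_packing_error :: "real \<Rightarrow> real \<Rightarrow> real \<Rightarrow> nat \<Rightarrow> real" where
  "sphere_packing_error N0 \<kappa> \<tau> M = measure (gauss N0) {..(sqrt \<tau> - sqrt \<kappa>) * sqrt (ln (real M)) * sqrt N0}
     - exp (- ((sqrt \<kappa> - sqrt \<tau>)\<^sup>2 + (1 - \<tau>)) * ln (real M))"

lemma sphere_packing_error_le_1: "N0 > 0 \<Longrightarrow> sphere_packing_error N0 \<kappa> \<tau> M \<le> 1"
proof -
  assume "N0 > 0"
  then interpret prob_space "gauss N0" by (rule prob_space_gauss)
  show ?thesis unfolding sphere_packing_error_def
    by (rule order_trans[OF diff_left_mono[of 0]]) auto
qed

lemma correct_le_sphere_packing_error:
  assumes code: "orthogonal_code N0 k n M E \<epsilon> x g" and \<kappa>: "\<kappa> > 0" and \<tau>: "\<kappa> \<le> 4 * \<tau>" and M: "M \<ge> 2"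
    and E: "E \<le> \<kappa> * N0 * ln (real M)"
  shows "1 - \<epsilon> \<le> (1 - sphere_packing_error N0 \<kappa> \<tau> M) ^ k"
proof -
  interpret orthogonal_code N0 k n M E \<epsilon> x g by (rule code)
  define s where "s = sqrt (ln (real M)) * sqrt N0"
  have \<tau>0: "\<tau> > 0" using \<kappa> \<tau> by simp
  have lnM: "ln (real M) > 0" using M by simp
  have s2: "s * s = ln (real M) * N0" using lnM N0 by (simp add: s_def power_mult_distrib flip: power2_eq_square)
  have "sqrt \<kappa> \<le> sqrt (4 * \<tau>)" using \<tau> by simp
  then have "sqrt \<kappa> \<le> 2 * sqrt \<tau>" by (simp add: real_sqrt_mult)
  then have "1 - \<epsilon> \<le> (1 - (measure (gauss N0) {..sqrt \<tau> * s - sqrt \<kappa> * s}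
      - exp ((2 * (sqrt \<tau> * s) * (sqrt \<kappa> * s) - (sqrt \<kappa> * s)\<^sup>2) / N0) / real M)) ^ k"
    using E \<kappa> lnM N0 mult_right_mono[of "sqrt \<kappa>" "2 * sqrt \<tau>" s]
    by (intro correct_le_sphere_packing) (auto simp: s_def power_mult_distrib mult_ac)
  also have "sqrt \<tau> * s - sqrt \<kappa> * s = (sqrt \<tau> - sqrt \<kappa>) * sqrt (ln (real M)) * sqrt N0"
    by (simp add: s_def algebra_simps)
  also have "exp ((2 * (sqrt \<tau> * s) * (sqrt \<kappa> * s) - (sqrt \<kappa> * s)\<^sup>2) / N0) / real M
      = exp (- ((sqrt \<kappa> - sqrt \<tau>)\<^sup>2 + (1 - \<tau>)) * ln (real M))"
  proof -
    have "2 * (sqrt \<tau> * s) * (sqrt \<kappa> * s) - (sqrt \<kappa> * s)\<^sup>2 = (2 * sqrt \<tau> * sqrt \<kappa> - (sqrt \<kappa>)\<^sup>2) * (s * s)"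
      by (simp add: algebra_simps power2_eq_square)
    then have "(2 * (sqrt \<tau> * s) * (sqrt \<kappa> * s) - (sqrt \<kappa> * s)\<^sup>2) / N0 = (2 * sqrt \<tau> * sqrt \<kappa> - \<kappa>) * ln (real M)"
      using N0 \<kappa> by (simp add: s2)
    also have "\<dots> = - ((sqrt \<kappa> - sqrt \<tau>)\<^sup>2 + (1 - \<tau>)) * ln (real M) + ln (real M)"
      using \<kappa> \<tau>0 by (simp add: power2_diff algebra_simps)
    finally show ?thesis using M by (simp add: exp_add)
  qed
  finally show ?thesis by (simp only: sphere_packing_error_def)
qed

text \<open>For \<kappa> < \<tau> < 1 the truncation threshold lies above the mean, so the Gaussian
  term is at least 1/2, while the subtracted term is at most 1/4 for large \<open>M\<close>. The
  error of one user is then bounded away from 0.\<close>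

lemma error_exponent_above_capacity:
  assumes N0: "N0 > 0" and \<kappa>: "0 < \<kappa>" "\<kappa> < 1"
  shows "error_exponent_bound N0 \<kappa> 0"
proof -
  define \<tau> where "\<tau> = (\<kappa> + 1) / 2"
  have \<tau>: "\<kappa> < \<tau>" "\<tau> < 1" using \<kappa> by (auto simp: \<tau>_def)
  have \<alpha>: "(1 - \<tau>) > 0" using \<tau> by simp
  have "eventually (\<lambda>M. ln 4 \<le> (1 - \<tau>) * (sqrt (ln (real M)))\<^sup>2) at_top"
    using eventually_compose_filterlim[OF quadratic_dominates[OF \<alpha>, of 0 "ln 4"] sqrt_ln_at_top] by simp
  then have ev: "eventually (\<lambda>M. 1 / 4 * real M powr (- 0) \<le> sphere_packing_error N0 \<kappa> \<tau> M) at_top"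
    using eventually_ge_at_top[of 2]
  proof eventually_elim
    case (elim M)
    then have lnM: "ln (real M) > 0" by simp
    have "1 / 2 \<le> measure (gauss N0) {..(sqrt \<tau> - sqrt \<kappa>) * sqrt (ln (real M)) * sqrt N0}"
      using \<tau> lnM N0 by (intro gauss_lower_half) auto
    moreover have "exp (- ((sqrt \<kappa> - sqrt \<tau>)\<^sup>2 + (1 - \<tau>)) * ln (real M)) \<le> exp (- ln 4)"
    proof -
      have "ln 4 \<le> (1 - \<tau>) * ln (real M)" using elim lnM by simp
      also have "\<dots> \<le> ((sqrt \<kappa> - sqrt \<tau>)\<^sup>2 + (1 - \<tau>)) * ln (real M)"
        using lnM by (intro mult_right_mono) auto
      finally show ?thesis by (simp only: exp_le_cancel_iff minus_mult_left[symmetric] neg_le_iff_le)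
    qed
    moreover have "exp (- ln 4) = (1 / 4 :: real)" by (simp add: exp_minus)
    ultimately show ?case using elim by (simp add: sphere_packing_error_def)
  qed
  show ?thesis
    using \<tau> \<kappa> by (intro error_exponent_boundI[OF N0 \<kappa>(1) _ ev] correct_le_sphere_packing_error
        sphere_packing_error_le_1[OF N0]) auto
qed

text \<open>For \<tau> < 1 the Gaussian tail at (sqrt \<kappa> - sqrt \<tau>) sqrt (ln M) outweighs
  the subtracted term, and its exponent tends to (sqrt \<kappa> - 1)^2 as \<tau> tends to 1 from
  below. The condition \<kappa> \<le> 4 \<tau>, which handles short codewords, then confines
  \<kappa> to values below 4.\<close>

lemma error_exponent_sphere_packing:
  assumes N0: "N0 > 0" and \<kappa>: "1 \<le> \<kappa>" "\<kappa> < 4" and a: "(sqrt \<kappa> - 1)\<^sup>2 < a"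
  shows "error_exponent_bound N0 \<kappa> a"
proof -
  obtain \<tau> where \<tau>: "\<kappa> \<le> 4 * \<tau>" "\<tau> < 1" "(sqrt \<kappa> - sqrt \<tau>)\<^sup>2 < a"
  proof -
    have "((\<lambda>\<tau>. (sqrt \<kappa> - sqrt \<tau>)\<^sup>2) \<longlongrightarrow> (sqrt \<kappa> - sqrt 1)\<^sup>2) (at_left 1)"
      by (intro tendsto_intros)
    then have "eventually (\<lambda>\<tau>. (sqrt \<kappa> - sqrt \<tau>)\<^sup>2 < a) (at_left 1)"
      using a by (intro order_tendstoD(2)) auto
    moreover have "eventually (\<lambda>\<tau>. \<tau> \<in> {\<kappa> / 4<..<1}) (at_left (1::real))"
      using \<kappa> by (intro eventually_at_leftI[of "\<kappa> / 4"]) auto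
    ultimately have "eventually (\<lambda>\<tau>. (sqrt \<kappa> - sqrt \<tau>)\<^sup>2 < a \<and> \<tau> \<in> {\<kappa> / 4<..<1}) (at_left 1)"
      by eventually_elim auto
    then obtain \<tau> where "(sqrt \<kappa> - sqrt \<tau>)\<^sup>2 < a" "\<tau> \<in> {\<kappa> / 4<..<1}"
      using eventually_happens[of _ "at_left (1::real)"] by (auto simp: trivial_limit_at_left_real)
    then show ?thesis using that[of \<tau>] by auto
  qed
  define y where "y = sqrt \<kappa> - sqrt \<tau>"
  have y: "y \<ge> 0" using \<tau> \<kappa> by (simp add: y_def)
  \<comment> \<open>\<open>a'\<close> lies above \<open>y\<^sup>2\<close>, so M^(-a') is eventually
    at most half the Gaussian tail. It is at most \<open>a\<close> and at most the subtracted
    exponent, so the target M^(-a) and the subtracted term are each at most M^(-a').\<close>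
  define a' where "a' = min a (y\<^sup>2 + (1 - \<tau>))"
  have pos: "a' - y\<^sup>2 > 0" using \<tau> by (auto simp: a'_def y_def)
  have "eventually (\<lambda>M. 2 * y * sqrt (ln (real M)) + (1 + ln (2 * sqrt pi)) \<le> (a' - y\<^sup>2) * (sqrt (ln (real M)))\<^sup>2) at_top"
    using eventually_compose_filterlim[OF quadratic_dominates[OF pos, of "2 * y" "1 + ln (2 * sqrt pi)"] sqrt_ln_at_top] by simp
  then have ev: "eventually (\<lambda>M. 1 * real M powr (- a) \<le> sphere_packing_error N0 \<kappa> \<tau> M) at_top"
    using eventually_ge_at_top[of 2]
  proof eventually_elim
    case (elim M)
    define b where "b = sqrt (ln (real M))"
    have lnM: "ln (real M) > 0" using elim by simp
    then have b: "b \<ge> 0" "ln (real M) = b\<^sup>2" by (auto simp: b_def)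
    let ?G = "exp (- (y * b + 1)\<^sup>2) / sqrt pi"
    have "?G \<le> measure (gauss N0) {y * b * sqrt N0..}"
      using y b by (intro gauss_upper_tail_ge[OF N0]) auto
    also have "\<dots> = measure (gauss N0) {..(sqrt \<tau> - sqrt \<kappa>) * b * sqrt N0}"
      by (subst gauss_reflect[OF N0, symmetric]) (simp add: y_def algebra_simps)
    finally have G: "?G \<le> measure (gauss N0) {..(sqrt \<tau> - sqrt \<kappa>) * b * sqrt N0}" .
    have "exp (- a' * b\<^sup>2) \<le> exp (- (y * b + 1)\<^sup>2 - ln (2 * sqrt pi))"
      using elim by (simp add: b_def[symmetric] power2_sum power_mult_distrib algebra_simps)
    also have "\<dots> = ?G / 2" by (simp add: exp_diff)
    finally have a': "exp (- a' * b\<^sup>2) \<le> ?G / 2" .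
    have *: "p \<le> e \<Longrightarrow> r \<le> e \<Longrightarrow> G \<le> m \<Longrightarrow> e \<le> G / 2 \<Longrightarrow> 1 * r \<le> m - p" for p e r G m :: real
      by simp
    have "exp (- (y\<^sup>2 + (1 - \<tau>)) * b\<^sup>2) \<le> exp (- a' * b\<^sup>2)"
    proof -
      have "a' * b\<^sup>2 \<le> (y\<^sup>2 + (1 - \<tau>)) * b\<^sup>2" by (intro mult_right_mono) (auto simp: a'_def)
      then show ?thesis by (simp only: exp_le_cancel_iff minus_mult_left[symmetric] neg_le_iff_le)
    qed
    moreover have "real M powr (- a) \<le> exp (- a' * b\<^sup>2)"
      using elim by (simp add: powr_def b a'_def mult_right_mono)
    ultimately show ?case
      using G a' unfolding sphere_packing_error_def y_def[symmetric] b_def[symmetric]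
      unfolding b(2) by (rule *)
  qed
  show ?thesis
    using \<tau> \<kappa> N0 by (intro error_exponent_boundI[OF N0 _ _ ev] correct_le_sphere_packing_error
        sphere_packing_error_le_1) auto
qed

text \<open>Up to lower order, q is M^(-\<kappa>/4), and one half of the codebook contains a ratio
  of at least 1 with probability at least of order min 1 (q M). Squaring and dividing by
  \<open>M\<close> gives M^(1 - \<kappa>/2) or M^(-1), that is the exponent max 1 (\<kappa>/2 -
  1).\<close>

lemma error_exponent_pairwise:
  assumes N0: "N0 > 0" and \<kappa>: "\<kappa> > 0" and a: "1 \<le> a" "\<kappa> / 2 - 1 < a"
  shows "error_exponent_bound N0 \<kappa> a"
proof -
  interpret prob_space "gauss N0" by (rule prob_space_gauss[OF N0])
  have pos: "a + 1 - \<kappa> / 2 > 0" using a by simp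
  have "eventually (\<lambda>M. 2 * sqrt \<kappa> * sqrt (ln (real M)) + (2 + ln pi) \<le> (a + 1 - \<kappa> / 2) * (sqrt (ln (real M)))\<^sup>2) at_top"
    using eventually_compose_filterlim[OF quadratic_dominates[OF pos, of "2 * sqrt \<kappa>" "2 + ln pi"] sqrt_ln_at_top] by simp
  \<comment> \<open>36 is 9 times 4: half the codebook has at least M / 3 codewords, and 1 - (1 -
    q)^h is at least half of min 1 (q h); both are squared. The \<open>min 1\<close> meets the
    condition \<open>p M \<le> 1\<close> of \<open>error_exponent_boundI\<close> for every
    \<open>M\<close>.\<close>
  then have ev: "eventually (\<lambda>M. 1 / 36 * real M powr (- a) \<le> min 1 (pairwise_error N0 \<kappa> M)) at_top"
    using eventually_ge_at_top[of 2]
  proof eventually_elim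
    case (elim M)
    define b where "b = sqrt (ln (real M))"
    have M0: "real M > 0" "M \<ge> 2" using elim by auto
    have lnM: "ln (real M) > 0" using elim by simp
    then have b: "b \<ge> 0" "ln (real M) = b\<^sup>2" by (auto simp: b_def)
    define q where "q = measure (gauss N0) {sqrt \<kappa> * b / 2 * sqrt N0..}"
    define h where "h = M div 2"
    have h: "real M / 3 \<le> real h" 
    proof -
      have "M \<le> 3 * h" unfolding h_def using elim(2) by presburger
      then show ?thesis by linarith
    qed
    have q01: "0 \<le> q" "q \<le> 1" by (auto simp: q_def)
    have qg: "exp (- (sqrt \<kappa> * b / 2 + 1)\<^sup>2) / sqrt pi \<le> q"
      unfolding q_def using b \<kappa> by (intro gauss_upper_tail_ge[OF N0]) auto
    have "exp (- (a + 1) * b\<^sup>2) \<le> exp (- 2 * (sqrt \<kappa> * b / 2 + 1)\<^sup>2 - ln pi)"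
      using elim \<kappa> by (simp add: b_def[symmetric] power2_sum power_mult_distrib power_divide algebra_simps)
    also have "\<dots> = (exp (- (sqrt \<kappa> * b / 2 + 1)\<^sup>2) / sqrt pi)\<^sup>2"
      by (simp add: exp_diff power_divide flip: exp_double)
    also have "\<dots> \<le> q\<^sup>2" using qg by (intro power_mono) auto
    finally have q2: "exp (- (a + 1) * b\<^sup>2) \<le> q\<^sup>2" .
    have Ma: "real M powr (- a) = exp (- (a + 1) * b\<^sup>2) * real M"
    proof -
      have "exp (- (a + 1) * b\<^sup>2) * real M = exp (- (a + 1) * b\<^sup>2) * exp (b\<^sup>2)"
        using M0 by (simp flip: b(2))
      also have "\<dots> = exp (- a * b\<^sup>2)" by (simp add: algebra_simps flip: exp_add)
      finally show ?thesis using M0 by (simp add: powr_def b)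
    qed
    have "(1 - q) ^ h \<le> exp (- q) ^ h"
      using q01 exp_ge_add_one_self[of "- q"] by (intro power_mono) auto
    also have "\<dots> = exp (- (q * real h))" by (simp add: mult.commute flip: exp_of_nat_mult)
    also have "\<dots> \<le> exp (- (min 1 (q * real h)))" by simp
    also have "\<dots> \<le> 1 - min 1 (q * real h) / 2"
    proof -
      have "exp (- x) \<le> 1 - x / 2" if "0 \<le> x" "x \<le> 1" for x :: real
      proof -
        have "1 \<le> (1 - x / 2) * (1 + x)"
          using that mult_left_mono[of x 1 x] by (simp add: algebra_simps)
        also have "\<dots> \<le> (1 - x / 2) * exp x"
          using that by (intro mult_left_mono exp_ge_add_one_self) auto
        finally show ?thesis by (simp add: exp_minus field_simps)
      qed
      then show ?thesis using q01 by auto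
    qed
    finally have low: "min 1 (q * real h) / 2 \<le> 1 - (1 - q) ^ h" by simp
    have nn: "0 \<le> min 1 (q * real h) / 2" using q01 by simp
    have "(min 1 (q * real h) / 2)\<^sup>2 / real M \<le> (1 - (1 - q) ^ h)\<^sup>2 / real M"
      using low nn by (intro divide_right_mono power_mono) auto
    then have pe: "(min 1 (q * real h) / 2)\<^sup>2 / real M \<le> pairwise_error N0 \<kappa> M"
      by (simp add: pairwise_error_def q_def h_def b_def)
    have "1 / 36 * real M powr (- a) \<le> (min 1 (q * real h) / 2)\<^sup>2 / real M"
    proof (cases "q * real h \<le> 1")
      case True
      have "real M powr (- a) * real M \<le> q\<^sup>2 * real M * real M"
        unfolding Ma using q2 by (intro mult_right_mono) auto
      also have "\<dots> = 9 * (q * (real M / 3))\<^sup>2" by (simp add: power2_eq_square)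
      also have "\<dots> \<le> 9 * (q * real h)\<^sup>2"
        using h q01 by (intro mult_left_mono power_mono) auto
      finally show ?thesis using True M0 by (simp add: field_simps power2_eq_square)
    next
      case False
      have "real M powr (- a) \<le> real M powr (- 1)" using M0 a by (intro powr_mono) auto
      also have "\<dots> = 1 / real M" using M0 by (simp add: powr_minus_divide)
      finally have "1 / 36 * real M powr (- a) \<le> 1 / 36 * (1 / real M)" by simp
      also have "\<dots> \<le> (1 / 2)\<^sup>2 / real M" using M0 by (simp add: field_simps power2_eq_square)
      finally show ?thesis using False by simp
    qed
    also note pe
    finally show ?case using pairwise_error_le_1[OF N0 \<kappa> M0(2)] by simp
  qed
  show ?thesis
  proof (rule error_exponent_boundI[OF N0 \<kappa> _ ev])
    fix k n M E \<epsilon> x g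
    assume "orthogonal_code N0 k n M E \<epsilon> x g" "M \<ge> 2" "E \<le> \<kappa> * N0 * ln (real M)"
    then show "1 - \<epsilon> \<le> (1 - min 1 (pairwise_error N0 \<kappa> M)) ^ k"
      using correct_le_pairwise_error[of N0 k n M E \<epsilon> x g \<kappa>] pairwise_error_le_1[OF N0 \<kappa>, of M] \<kappa> by simp
  qed auto
qed

section \<open>A single-pulse code\<close>

definition pulse :: "nat \<Rightarrow> nat \<Rightarrow> nat \<Rightarrow> nat" where
  "pulse M i w = (i - 1) * M + w"

definition pulse_code :: "nat \<Rightarrow> real \<Rightarrow> codebooks" where
  "pulse_code M E i w j = (if j = pulse M i w then sqrt E else 0)"

text \<open>\<open>LEAST\<close> settles ties between equal maxima in a measurable way; a correct
  decision is only claimed for a strict maximum.\<close>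

definition pulse_decoder :: "nat \<Rightarrow> nat \<Rightarrow> (nat \<Rightarrow> real) \<Rightarrow> nat \<Rightarrow> nat" where
  "pulse_decoder k M Y = (\<lambda>i\<in>{1..k}.
     LEAST w. w \<in> {1..M} \<and> (\<forall>w'\<in>{1..M}. Y (pulse M i w') \<le> Y (pulse M i w)))"

lemma pulse_inj:
  assumes "w \<in> {1..M}" "w' \<in> {1..M}" "i \<ge> 1" "i' \<ge> 1" "pulse M i w = pulse M i' w'"
  shows "i = i' \<and> w = w'"
proof -
  have eq: "(i - 1) * M + (w - 1) = (i' - 1) * M + (w' - 1)"
    using assms by (simp add: pulse_def)
  have lt: "w - 1 < M" "w' - 1 < M" using assms by auto
  have "i - 1 = ((i - 1) * M + (w - 1)) div M" "w - 1 = ((i - 1) * M + (w - 1)) mod M"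
    using lt by auto
  moreover have "i' - 1 = ((i' - 1) * M + (w' - 1)) div M" "w' - 1 = ((i' - 1) * M + (w' - 1)) mod M"
    using lt by auto
  ultimately have "i - 1 = i' - 1" "w - 1 = w' - 1" using eq by simp_all
  then show ?thesis using assms by auto
qed

lemma pulse_range:
  assumes "i \<in> {1..k}" "w \<in> {1..M}" "k * M \<le> n"
  shows "pulse M i w \<in> {1..n}"
proof -
  have "pulse M i w \<le> (i - 1) * M + M" using assms by (simp add: pulse_def)
  also have "\<dots> = i * M" using assms by (cases i) auto
  also have "\<dots> \<le> k * M" using assms by simp
  finally show ?thesis using assms by (simp add: pulse_def)
qed

lemma dot_pulse_code:
  assumes "E \<ge> 0" "pulse M i w \<in> {1..n}"
  shows "dot n (pulse_code M E i w) (pulse_code M E i' w') = (if pulse M i w = pulse M i' w' then E else 0)"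
proof -
  have "dot n (pulse_code M E i w) (pulse_code M E i' w') =
      (\<Sum>j=1..n. if j = pulse M i w then (if pulse M i w = pulse M i' w' then E else 0) else 0)"
    unfolding dot_def pulse_code_def using assms(1) by (intro sum.cong refl) auto
  then show ?thesis using assms(2) by simp
qed

lemma pulse_code_orthogonal:
  assumes "E \<ge> 0" "k * M \<le> n"
  shows "orthogonal_access k n M (pulse_code M E)" "orthogonal_codebooks k n M (pulse_code M E)"
proof -
  show "orthogonal_access k n M (pulse_code M E)"
    unfolding orthogonal_access_def
  proof (intro ballI impI)
    fix i j w w' assume "i \<in> {1..k}" "j \<in> {1..k}" "i \<noteq> j" "w \<in> {1..M}" "w' \<in> {1..M}"
    then show "dot n (pulse_code M E i w) (pulse_code M E j w') = 0"
      using pulse_inj[of w M w' i j] pulse_range[of i k w M n] assms by (auto simp: dot_pulse_code)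
  qed
  show "orthogonal_codebooks k n M (pulse_code M E)"
    unfolding orthogonal_codebooks_def
  proof (intro ballI impI)
    fix i w w' assume "i \<in> {1..k}" "w \<in> {1..M}" "w' \<in> {1..M}" "w \<noteq> w'"
    then show "dot n (pulse_code M E i w) (pulse_code M E i w') = 0"
      using pulse_inj[of w M w' i i] pulse_range[of i k w M n] assms by (auto simp: dot_pulse_code)
  qed
qed

lemma pulse_decoder_is_decoder:
  assumes M: "M \<ge> 1" and n: "k * M \<le> n"
  shows "is_decoder k n M (pulse_decoder k M)"
  unfolding is_decoder_def pulse_decoder_def
proof (rule measurable_restrict)
  fix i assume i: "i \<in> {1..k}"
  let ?B = "Pi\<^sub>M {1..n} (\<lambda>_. borel) :: (nat \<Rightarrow> real) measure"
  let ?P = "\<lambda>Y w. w \<in> {1..M} \<and> (\<forall>w'\<in>{1..M}. Y (pulse M i w') \<le> Y (pulse M i w))"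
  have P: "Measurable.pred ?B (\<lambda>Y. ?P Y w)" for w
  proof (cases "w \<in> {1..M}")
    case True
    have comp: "(\<lambda>Y. Y (pulse M i w)) \<in> borel_measurable ?B" if "w \<in> {1..M}" for w
      using pulse_range[OF i that n] by (intro measurable_component_singleton)
    have "Measurable.pred ?B (\<lambda>Y. \<forall>w'\<in>{1..M}. Y (pulse M i w') \<le> Y (pulse M i w))"
    proof (intro pred_intros_finite)
      fix w' assume "w' \<in> {1..M}"
      from borel_measurable_le[OF comp[OF this] comp[OF True]]
      show "Measurable.pred ?B (\<lambda>Y. Y (pulse M i w') \<le> Y (pulse M i w))" by (simp add: pred_def)
    qed simp
    then show ?thesis by (simp only: True simp_thms)
  next
    case False
    then show ?thesis by (simp only: simp_thms) measurable
  qed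
  have "(\<lambda>Y. LEAST w. ?P Y w) \<in> measurable ?B (count_space UNIV)"
    by (rule measurable_Least) (rule P)
  moreover have "(LEAST w. ?P Y w) \<in> {1..M}" for Y :: "nat \<Rightarrow> real"
  proof -
    have "Max ((\<lambda>w. Y (pulse M i w)) ` {1..M}) \<in> (\<lambda>w. Y (pulse M i w)) ` {1..M}"
      using M by (intro Max_in) auto
    then obtain w where w: "w \<in> {1..M}" "Y (pulse M i w) = Max ((\<lambda>w. Y (pulse M i w)) ` {1..M})" by auto
    have "?P Y w" unfolding w(2) using w(1) by simp
    then have "?P Y (LEAST w. ?P Y w)" by (rule LeastI)
    then show ?thesis by simp
  qed
  ultimately have "(\<lambda>Y. LEAST w. ?P Y w) \<in> measurable ?B (restrict_space (count_space UNIV) {1..M})"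
    by (intro measurable_restrict_space2 funcsetI)
  then show "(\<lambda>Y. LEAST w. ?P Y w) \<in> measurable ?B (count_space {1..M})"
    by (simp only: restrict_count_space Int_UNIV_right)
qed

lemma pulse_decoder_correct:
  assumes W: "W \<in> {1..k} \<rightarrow>\<^sub>E {1..M}" and n: "k * M \<le> n"
    and ok: "\<And>i w. i \<in> {1..k} \<Longrightarrow> w \<in> {1..M} \<Longrightarrow> w \<noteq> W i \<Longrightarrow> Z (pulse M i w) < sqrt E + Z (pulse M i (W i))"
  shows "pulse_decoder k M (channel_output k n (pulse_code M E) W Z) = W"
proof -
  let ?Y = "channel_output k n (pulse_code M E) W Z"
  have out: "?Y (pulse M i w) = (if w = W i then sqrt E else 0) + Z (pulse M i w)"
    if i: "i \<in> {1..k}" and w: "w \<in> {1..M}" for i w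
  proof -
    have "(\<Sum>l=1..k. pulse_code M E l (W l) (pulse M i w)) = (\<Sum>l=1..k. if l = i then (if w = W i then sqrt E else 0) else 0)"
    proof (intro sum.cong refl)
      fix l assume l: "l \<in> {1..k}"
      then have "W l \<in> {1..M}" using W by (auto simp: PiE_iff)
      then show "pulse_code M E l (W l) (pulse M i w) = (if l = i then (if w = W i then sqrt E else 0) else 0)"
        using pulse_inj[OF w, of "W l" i l] i l by (auto simp: pulse_code_def)
    qed
    then show ?thesis using pulse_range[OF i w n] i by (simp add: channel_output_def)
  qed
  show ?thesis
  proof
    fix i
    show "pulse_decoder k M ?Y i = W i"
    proof (cases "i \<in> {1..k}")
      case True
      have Wi: "W i \<in> {1..M}" using W True by (auto simp: PiE_iff)
      have less: "?Y (pulse M i w) < ?Y (pulse M i (W i))" if "w \<in> {1..M}" "w \<noteq> W i" for w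
        using ok[OF True that] out[OF True that(1)] out[OF True Wi] that by simp
      have "(LEAST w. w \<in> {1..M} \<and> (\<forall>w'\<in>{1..M}. ?Y (pulse M i w') \<le> ?Y (pulse M i w))) = W i"
      proof (rule Least_equality)
        show "W i \<in> {1..M} \<and> (\<forall>w'\<in>{1..M}. ?Y (pulse M i w') \<le> ?Y (pulse M i (W i)))"
          using Wi less by (metis less_le order_refl)
        fix w assume "w \<in> {1..M} \<and> (\<forall>w'\<in>{1..M}. ?Y (pulse M i w') \<le> ?Y (pulse M i w))"
        then show "W i \<le> w" using less[of w] Wi by (cases "w = W i") (auto simp: not_le[symmetric])
      qed
      then show ?thesis using True by (simp add: pulse_decoder_def)
    next
      case False
      then have "W i = undefined" using W by (auto simp: PiE_iff extensional_def)
      then show ?thesis by (simp only: pulse_decoder_def restrict_def False if_False)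
    qed
  qed
qed

text \<open>User \<open>i\<close> can only be misled if the noise lifts another position of its own
  block to the level of the transmitted pulse, which is the event of
  \<open>orthogonal_detection_error_le\<close> with \<open>a = sqrt E\<close>. The factor
  \<open>k\<close> is the union bound over the users.\<close>

lemma pulse_code_error_le:
  assumes N0: "N0 > 0" and M: "M \<ge> 2" and E: "E \<ge> 0" and n: "k * M \<le> n" and \<rho>: "0 \<le> \<rho>" "\<rho> \<le> 1"
  shows "error_prob N0 k n M (pulse_code M E) (pulse_decoder k M) \<le>
    real k * (real M powr \<rho> * exp (- (E / N0 * (\<rho> / (1 + \<rho>)))))"
proof -
  let ?G = "gauss_vec N0 {1..n}" and ?S = "{1..k} \<rightarrow>\<^sub>E {1..M}"
  let ?B = "real M powr \<rho> * exp (- (E / N0 * (\<rho> / (1 + \<rho>))))"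
  interpret prob_space ?G by (rule prob_space_gauss_vec[OF N0])
  have dec: "is_decoder k n M (pulse_decoder k M)" using M n by (intro pulse_decoder_is_decoder) auto
  have slice: "prob {Z \<in> space ?G. pulse_decoder k M (channel_output k n (pulse_code M E) W Z) \<noteq> W} \<le> real k * ?B"
    if W: "W \<in> ?S" for W
  proof -
    define T where "T i = pulse M i ` ({1..M} - {W i})" for i
    define A where "A i = {Z \<in> space ?G. \<exists>j\<in>T i. sqrt E + Z (pulse M i (W i)) \<le> Z j}" for i
    have Wi: "W i \<in> {1..M}" if "i \<in> {1..k}" for i using W that by (auto simp: PiE_iff)
    have T: "T i \<subseteq> {1..n} - {pulse M i (W i)}" "T i \<noteq> {}" "card (T i) \<le> M" if i: "i \<in> {1..k}" for i
    proof -
      have "pulse M i w \<noteq> pulse M i (W i)" if "w \<in> {1..M}" "w \<noteq> W i" for w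
        using pulse_inj[OF that(1) Wi[OF i], of i i] that(2) i by auto
      then show "T i \<subseteq> {1..n} - {pulse M i (W i)}" using pulse_range[OF i _ n] by (auto simp: T_def)
      have "(if W i = 1 then 2 else 1) \<in> {1..M} - {W i}" using M by auto
      then show "T i \<noteq> {}" unfolding T_def by blast
      have "card (T i) \<le> card ({1..M} - {W i})" unfolding T_def by (intro card_image_le) auto
      also have "\<dots> \<le> card {1..M}" by (intro card_mono) auto
      finally show "card (T i) \<le> M" by simp
    qed
    have A: "A i \<in> sets ?G" if i: "i \<in> {1..k}" for i
    proof -
      have "{Z \<in> space ?G. sqrt E + Z (pulse M i (W i)) \<le> Z j} \<in> sets ?G" if "j \<in> T i" for j
      proof -
        have "j \<in> {1..n}" "pulse M i (W i) \<in> {1..n}" using T(1)[OF i] that pulse_range[OF i Wi[OF i] n] by auto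
        then show ?thesis by measurable
      qed
      then have "(\<Union>j\<in>T i. {Z \<in> space ?G. sqrt E + Z (pulse M i (W i)) \<le> Z j}) \<in> sets ?G"
        by (intro sets.finite_UN) (auto simp: T_def)
      moreover have "(\<Union>j\<in>T i. {Z \<in> space ?G. sqrt E + Z (pulse M i (W i)) \<le> Z j}) = A i"
        by (auto simp: A_def)
      ultimately show ?thesis by simp
    qed
    have PA: "prob (A i) \<le> ?B" if i: "i \<in> {1..k}" for i
    proof -
      have "prob (A i) \<le> real (card (T i)) powr \<rho> * exp (- ((sqrt E)\<^sup>2 / N0 * (\<rho> / (1 + \<rho>))))"
        unfolding A_def using E \<rho> pulse_range[OF i Wi[OF i] n]
        by (intro orthogonal_detection_error_le[OF N0 _ _ T(1,2)[OF i]]) auto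
      also have "\<dots> \<le> real M powr \<rho> * exp (- ((sqrt E)\<^sup>2 / N0 * (\<rho> / (1 + \<rho>))))"
        using T(3)[OF i] \<rho> by (intro mult_right_mono powr_mono2) auto
      finally show ?thesis using E by simp
    qed
    have "{Z \<in> space ?G. pulse_decoder k M (channel_output k n (pulse_code M E) W Z) \<noteq> W} \<subseteq> (\<Union>i\<in>{1..k}. A i)"
    proof
      fix Z assume Z: "Z \<in> {Z \<in> space ?G. pulse_decoder k M (channel_output k n (pulse_code M E) W Z) \<noteq> W}"
      then obtain i w where "i \<in> {1..k}" "w \<in> {1..M}" "w \<noteq> W i" "\<not> Z (pulse M i w) < sqrt E + Z (pulse M i (W i))"
        using pulse_decoder_correct[OF W n, of Z E] by blast
      then show "Z \<in> (\<Union>i\<in>{1..k}. A i)" using Z by (auto simp: A_def T_def not_less)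
    qed
    then have "prob {Z \<in> space ?G. pulse_decoder k M (channel_output k n (pulse_code M E) W Z) \<noteq> W} \<le> prob (\<Union>i\<in>{1..k}. A i)"
      using A by (intro finite_measure_mono sets.finite_UN) auto
    also have "\<dots> \<le> (\<Sum>i\<in>{1..k}. prob (A i))" using A by (intro finite_measure_subadditive_finite) auto
    also have "\<dots> \<le> (\<Sum>i\<in>{1..k}. ?B)" by (intro sum_mono PA)
    finally show ?thesis by simp
  qed
  have "error_prob N0 k n M (pulse_code M E) (pulse_decoder k M) =
      (\<Sum>W\<in>?S. prob {Z \<in> space ?G. pulse_decoder k M (channel_output k n (pulse_code M E) W Z) \<noteq> W}) / real M ^ k"
    using M by (subst error_prob_eq_average[OF N0 _ dec]) (auto simp: noise_measure_eq)
  also have "\<dots> \<le> (\<Sum>W\<in>?S. real k * ?B) / real M ^ k"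
    by (intro divide_right_mono sum_mono slice) auto
  also have "\<dots> = real k * ?B" using M by (simp add: card_PiE)
  finally show ?thesis .
qed

lemma pulse_code_symmetric_code:
  assumes N0: "N0 > 0" and M: "M \<ge> 2" and E: "E > 0" and n: "k * M \<le> n" and \<rho>: "0 \<le> \<rho>" "\<rho> \<le> 1"
    and \<epsilon>: "real k * (real M powr \<rho> * exp (- (E / N0 * (\<rho> / (1 + \<rho>))))) \<le> \<epsilon>"
  shows "symmetric_code N0 k n M E \<epsilon> (pulse_code M E) (pulse_decoder k M)"
  unfolding symmetric_code_def
proof (intro conjI ballI)
  fix i w assume iw: "i \<in> {1..k}" "w \<in> {1..M}"
  show "(\<Sum>j=1..n. (pulse_code M E i w j)\<^sup>2) \<le> E"
    using dot_pulse_code[of E M i w n i w] pulse_range[OF iw n] E by (simp add: dot_def power2_eq_square)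
next
  show "is_decoder k n M (pulse_decoder k M)" using M n by (intro pulse_decoder_is_decoder) auto
  show "error_prob N0 k n M (pulse_code M E) (pulse_decoder k M) \<le> \<epsilon>"
    using pulse_code_error_le[OF N0 M _ n \<rho>, of E] E \<epsilon> by simp
qed (use M E in auto)

abbreviation "orthogonal_class \<equiv> \<lambda>k n M x. orthogonal_access k n M x \<and> orthogonal_codebooks k n M x"

text \<open>Taking E = ln M / (R ln 2) makes the rate exactly \<open>R\<close> and E / (N0 ln M)
  equal to 1 / (N0 R ln 2). Gallager's bound then becomes the power of \<open>M\<close> whose
  product with \<open>k n\<close> is assumed to vanish in \<open>lim\<close>.\<close>

lemma achievable_rateI:
  fixes k :: "nat \<Rightarrow> nat"
  assumes N0: "N0 > 0" and R: "R > 0" and \<rho>: "0 \<le> \<rho>" "\<rho> \<le> 1"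
    and M: "filterlim (\<lambda>n. n div k n) at_top sequentially"
    and lim: "(\<lambda>n. real (k n) * real (n div k n) powr (\<rho> - \<rho> / (1 + \<rho>) / (N0 * (R * ln 2)))) \<longlonglongrightarrow> 0"
  shows "achievable_rate orthogonal_class N0 k R"
  unfolding achievable_rate_def
proof (intro allI impI)
  fix \<epsilon> \<delta> :: real assume \<epsilon>: "0 < \<epsilon> \<and> \<epsilon> < 1 \<and> 0 < \<delta>"
  have "eventually (\<lambda>n. n div k n \<ge> 2) sequentially"
    using M by (simp add: filterlim_at_top)
  moreover have "eventually (\<lambda>n. real (k n) * real (n div k n) powr (\<rho> - \<rho> / (1 + \<rho>) / (N0 * (R * ln 2))) < \<epsilon>) sequentially"
    using \<epsilon> by (intro order_tendstoD(2)[OF lim]) auto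
  ultimately have "eventually (\<lambda>n. \<exists>M E x g. symmetric_code N0 (k n) n M E \<epsilon> x g \<and> orthogonal_class (k n) n M x \<and>
      log 2 (real M) / E > R - \<delta>) sequentially"
  proof eventually_elim
    case (elim n)
    let ?M = "n div k n"
    define E where "E = ln (real ?M) / (R * ln 2)"
    have lnM: "ln (real ?M) > 0" using elim by simp
    have E: "E > 0" using lnM R by (simp add: E_def)
    have n: "k n * ?M \<le> n" by simp
    have "real ?M powr \<rho> * exp (- (E / N0 * (\<rho> / (1 + \<rho>)))) = real ?M powr (\<rho> - \<rho> / (1 + \<rho>) / (N0 * (R * ln 2)))"
    proof -
      have "real ?M powr \<rho> * exp (- (E / N0 * (\<rho> / (1 + \<rho>)))) = exp (\<rho> * ln (real ?M) - E / N0 * (\<rho> / (1 + \<rho>)))"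
        using elim by (simp add: powr_def exp_diff exp_minus divide_inverse)
      also have "\<rho> * ln (real ?M) - E / N0 * (\<rho> / (1 + \<rho>)) = (\<rho> - \<rho> / (1 + \<rho>) / (N0 * (R * ln 2))) * ln (real ?M)"
        by (simp add: E_def algebra_simps)
      finally show ?thesis using elim by (simp add: powr_def)
    qed
    then have "symmetric_code N0 (k n) n ?M E \<epsilon> (pulse_code ?M E) (pulse_decoder (k n) ?M)"
      using elim by (intro pulse_code_symmetric_code[OF N0 _ E n \<rho>]) auto
    moreover have "orthogonal_class (k n) n ?M (pulse_code ?M E)"
      using pulse_code_orthogonal[OF _ n, of E] E by auto
    moreover have "log 2 (real ?M) / E = R" using lnM R by (simp add: E_def log_def)
    ultimately show ?case using \<epsilon> by (intro exI[of _ ?M] exI[of _ E]) auto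
  qed
  then show "\<exists>n0. \<forall>n\<ge>n0. \<exists>M E x g. symmetric_code N0 (k n) n M E \<epsilon> x g \<and> orthogonal_class (k n) n M x \<and>
      log 2 (real M) / E > R - \<delta>"
    by (simp add: eventually_sequentially)
qed

section \<open>Capacity\<close>

lemma orthogonal_capacity_eqI:
  assumes Rc: "Rc > 0"
    and ach: "\<And>R. 0 < R \<Longrightarrow> R < Rc \<Longrightarrow> achievable_rate orthogonal_class N0 k R"
    and conv: "\<And>R. R > Rc \<Longrightarrow> \<not> achievable_rate orthogonal_class N0 k R"
  shows "orthogonal_capacity N0 k = ereal Rc"
  unfolding orthogonal_capacity_def
proof (rule antisym)
  show "(SUP R \<in> {R. achievable_rate orthogonal_class N0 k R}. ereal R) \<le> ereal Rc"
    using conv by (intro SUP_least) (auto simp: not_less[symmetric])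
  show "ereal Rc \<le> (SUP R \<in> {R. achievable_rate orthogonal_class N0 k R}. ereal R)"
  proof (rule dense_le)
    fix z assume "z < ereal Rc"
    then obtain r where r: "z < ereal r" "ereal r < ereal Rc" using ereal_dense2 by blast
    \<comment> \<open>Only positive rates are known to be achievable, so a possibly nonpositive
      \<open>r\<close> is raised to Rc / 2.\<close>
    let ?R = "max r (Rc / 2)"
    have "achievable_rate orthogonal_class N0 k ?R" using r Rc by (intro ach) auto
    then have "ereal ?R \<le> (SUP R \<in> {R. achievable_rate orthogonal_class N0 k R}. ereal R)"
      by (intro SUP_upper) simp
    moreover have "z \<le> ereal ?R" using r by (meson ereal_less_eq(3) less_imp_le max.cobounded1 order_trans)
    ultimately show "z \<le> (SUP R \<in> {R. achievable_rate orthogonal_class N0 k R}. ereal R)" by (rule order_trans[rotated])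
  qed
qed

text \<open>With \<delta> = R - R' the codes have rate above R', which is the energy bound that
  \<open>error_exponent_bound\<close> asks for. The constant \<open>C\<close> is fixed before
  \<epsilon>, so \<epsilon> may be chosen in terms of it.\<close>

lemma achievable_rate_imp_bounds:
  assumes N0: "N0 > 0" and k: "\<And>n. n \<ge> 1 \<Longrightarrow> k n > 0"
    and ach: "achievable_rate orthogonal_class N0 k R" and R: "0 < R'" "R' < R"
    and exponent: "error_exponent_bound N0 (1 / (N0 * (R' * ln 2))) a"
  obtains C where "C > 0" "\<And>\<epsilon>. 0 < \<epsilon> \<Longrightarrow> \<epsilon> < 1 \<Longrightarrow> eventually (\<lambda>n. \<exists>M\<ge>2.
    1 - \<epsilon> \<le> exp (- (C * real (k n) * real M powr (- a))) \<and> real (k n) * ((1 - \<epsilon>) * real M - 1) \<le> real n) sequentially"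
proof -
  obtain C where C: "C > 0" "\<And>k n M E \<epsilon> x g. orthogonal_code N0 k n M E \<epsilon> x g \<Longrightarrow> M \<ge> 2 \<Longrightarrow>
      E \<le> 1 / (N0 * (R' * ln 2)) * N0 * ln (real M) \<Longrightarrow> 1 - \<epsilon> \<le> exp (- (C * real k * real M powr (- a)))"
    using exponent unfolding error_exponent_bound_def by blast
  have "eventually (\<lambda>n. \<exists>M\<ge>2.
    1 - \<epsilon> \<le> exp (- (C * real (k n) * real M powr (- a))) \<and> real (k n) * ((1 - \<epsilon>) * real M - 1) \<le> real n) sequentially"
    if \<epsilon>: "0 < \<epsilon>" "\<epsilon> < 1" for \<epsilon>
  proof -
    from ach \<epsilon> R obtain n0 where n0: "\<And>n. n \<ge> n0 \<Longrightarrow> \<exists>M E x g. symmetric_code N0 (k n) n M E \<epsilon> x g \<and>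
        orthogonal_class (k n) n M x \<and> log 2 (real M) / E > R - (R - R')"
      unfolding achievable_rate_def by (metis diff_gt_0_iff_gt)
    show ?thesis
      using eventually_ge_at_top[of "max n0 1"]
    proof eventually_elim
      case (elim n)
      then obtain M E x g where c: "symmetric_code N0 (k n) n M E \<epsilon> x g" "orthogonal_access (k n) n M x"
          "orthogonal_codebooks (k n) n M x" "log 2 (real M) / E > R'"
        using n0[of n] by auto
      have code: "orthogonal_code N0 (k n) n M E \<epsilon> x g"
        using N0 k[of n] elim c by unfold_locales auto
      have E: "E > 0" and M1: "M \<ge> 1" using c(1) by (auto simp: symmetric_code_def)
      have "R' * E < log 2 (real M)" using c(4) E by (simp add: pos_less_divide_eq)
      then have RE: "R' * ln 2 * E < ln (real M)" by (simp add: log_def pos_less_divide_eq mult_ac)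
      have "0 < R' * ln 2 * E" using R E by simp
      with RE have "M \<noteq> 1" by auto
      then have M: "M \<ge> 2" using M1 by simp
      have "E \<le> 1 / (N0 * (R' * ln 2)) * N0 * ln (real M)"
        using RE R N0 by (simp add: field_simps)
      from C(2)[OF code M this] orthogonal_code.codebook_size_le[OF code] M
      show ?case by blast
    qed
  qed
  then show thesis using that C(1) by blast
qed

text \<open>A single user already fails: k \<ge> 1 gives a correct probability of at most exp (- C),
  and \<epsilon> is taken so small that 1 - \<epsilon> exceeds it.\<close>

lemma not_achievable_const_exponent:
  assumes N0: "N0 > 0" and k: "\<And>n. n \<ge> 1 \<Longrightarrow> k n > 0" and R: "0 < R'" "R' < R"
    and exponent: "error_exponent_bound N0 (1 / (N0 * (R' * ln 2))) 0"
  shows "\<not> achievable_rate orthogonal_class N0 k R"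
proof
  assume "achievable_rate orthogonal_class N0 k R"
  from achievable_rate_imp_bounds[OF N0 k this R exponent] obtain C where C: "C > 0"
    "\<And>\<epsilon>. 0 < \<epsilon> \<Longrightarrow> \<epsilon> < 1 \<Longrightarrow> eventually (\<lambda>n. \<exists>M\<ge>2. 1 - \<epsilon> \<le> exp (- (C * real (k n) * real M powr (- 0))) \<and>
      real (k n) * ((1 - \<epsilon>) * real M - 1) \<le> real n) sequentially"
    by auto
  define \<epsilon> where "\<epsilon> = (1 - exp (- C)) / 2"
  have \<epsilon>: "0 < \<epsilon>" "\<epsilon> < 1" "exp (- C) < 1 - \<epsilon>" using C(1) by (auto simp: \<epsilon>_def field_simps add_pos_pos)
  have "eventually (\<lambda>n. False) sequentially"
    using C(2)[OF \<epsilon>(1,2)] eventually_ge_at_top[of 1]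
  proof eventually_elim
    case (elim n)
    then obtain M where M: "M \<ge> 2" "1 - \<epsilon> \<le> exp (- (C * real (k n) * real M powr (- 0)))" by blast
    have "real (k n) \<ge> 1" using k[of n] elim by (simp add: Suc_le_eq)
    then have "exp (- (C * real (k n))) \<le> exp (- C)" using C(1) by simp
    moreover have "exp (- (C * real (k n) * real M powr (- 0))) = exp (- (C * real (k n)))" using M(1) by simp
    ultimately show ?case using M(2) \<epsilon>(3) by linarith
  qed
  then show False by simp
qed

lemma nat_powr_at_top:
  assumes "0 < (\<gamma>::real)"
  shows "filterlim (\<lambda>n::nat. real n powr \<gamma>) at_top sequentially"
proof -
  have "filterlim (\<lambda>n::nat. exp (\<gamma> * ln (real n))) at_top sequentially"
    by (intro filterlim_compose[OF exp_at_top] filterlim_tendsto_pos_mult_at_top[OF tendsto_const assms]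
        filterlim_compose[OF ln_at_top] filterlim_real_sequentially)
  moreover have "eventually (\<lambda>n::nat. exp (\<gamma> * ln (real n)) = real n powr \<gamma>) sequentially"
    using eventually_ge_at_top[of 1] by eventually_elim (simp add: powr_def)
  ultimately show ?thesis by (rule filterlim_mono_eventually[OF _ order_refl order_refl])
qed

text \<open>The dimension bound gives M \<le> 4 n / k, so k M^(-a) is at least 4^(-a) k^(1+a)
  n^(-a), hence at least of order n^\<gamma> with \<gamma> = c (1 + a) - a. This \<gamma> is
  positive because a < c / (1 - c), so the bound on the correct probability tends to 0 and cannot
  stay above 1 - \<epsilon> = 3/4.\<close>

lemma not_achievable_exponent:
  assumes N0: "N0 > 0" and k: "\<And>n. n \<ge> 1 \<Longrightarrow> k n > 0" and R: "0 < R'" "R' < R"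
    and c: "0 < c" "c < 1" and kc: "(\<lambda>n. real (k n)) \<in> \<Theta>(\<lambda>n. real n powr c)"
    and a: "0 \<le> a" "a < c / (1 - c)"
    and exponent: "error_exponent_bound N0 (1 / (N0 * (R' * ln 2))) a"
  shows "\<not> achievable_rate orthogonal_class N0 k R"
proof
  assume "achievable_rate orthogonal_class N0 k R"
  from achievable_rate_imp_bounds[OF N0 k this R exponent] obtain C where C: "C > 0"
    "\<And>\<epsilon>. 0 < \<epsilon> \<Longrightarrow> \<epsilon> < 1 \<Longrightarrow> eventually (\<lambda>n. \<exists>M\<ge>2. 1 - \<epsilon> \<le> exp (- (C * real (k n) * real M powr (- a))) \<and>
      real (k n) * ((1 - \<epsilon>) * real M - 1) \<le> real n) sequentially"
    by auto
  obtain c1 where c1: "c1 > 0" "eventually (\<lambda>n. real (k n) \<ge> c1 * real n powr c) sequentially"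
    using landau_omega.bigE[OF bigthetaD2[OF kc]] by auto
  have small: "(\<lambda>n. real (k n)) \<in> o(\<lambda>n. real n)"
  proof -
    have "(\<lambda>n. real n powr c) \<in> o(\<lambda>n. real n powr 1)"
      using c by (intro iffD2[OF powr_smallo_iff[OF filterlim_real_sequentially]]) auto
    also have "(\<lambda>n. real n powr 1) \<in> \<Theta>(\<lambda>n. real n)"
      by (intro bigthetaI_cong eventually_mono[OF eventually_ge_at_top[of 1]]) auto
    finally show ?thesis using bigthetaD1[OF kc] by (rule landau_o.big_small_trans[rotated])
  qed
  have kn: "eventually (\<lambda>n. real (k n) \<le> real n) sequentially"
    using landau_o.smallD[OF small, of 1] by simp
  define \<gamma> where "\<gamma> = c * (1 + a) - a"
  have \<gamma>: "\<gamma> > 0" using a c by (simp add: \<gamma>_def field_simps)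
  define K where "K = ln (4 / 3) / (C * 4 powr (- a) * c1 powr (1 + a))"
  have "filterlim (\<lambda>n::nat. real n powr \<gamma>) at_top sequentially"
    using \<gamma> by (rule nat_powr_at_top)
  then have big: "eventually (\<lambda>n. real n powr \<gamma> > K) sequentially" by (simp add: filterlim_at_top_dense)
  have "eventually (\<lambda>n. False) sequentially"
    using C(2)[of "1 / 4", simplified] c1(2) kn big eventually_ge_at_top[of 1]
  proof eventually_elim
    case (elim n)
    then obtain M where M: "M \<ge> 2" "3 / 4 \<le> exp (- (C * real (k n) * real M powr (- a)))"
      "real (k n) * (3 / 4 * real M - 1) \<le> real n" by auto
    have n: "real n > 0" using elim by simp
    have k0: "real (k n) > 0" using k[of n] elim by simp
    \<comment> \<open>Here 3/4 k M \<le> n + k \<le> 2 n; the last inequality is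
      \<open>k n \<le> n\<close>, which rests on c < 1.\<close>
    have "real (k n) * real M \<le> 4 * real n" using M(3) elim(3) n by (simp add: algebra_simps)
    then have "real M \<le> 4 * real n / real (k n)" using k0 by (simp add: field_simps)
    then have "(4 * real n / real (k n)) powr (- a) \<le> real M powr (- a)"
      using a M by (intro powr_mono2') auto
    then have "real (k n) * (4 * real n / real (k n)) powr (- a) \<le> real (k n) * real M powr (- a)"
      using k0 by (intro mult_left_mono) auto
    also have "real (k n) * (4 * real n / real (k n)) powr (- a) = 4 powr (- a) * real n powr (- a) * real (k n) powr (1 + a)"
      using n k0 by (simp add: powr_divide powr_mult powr_minus powr_add field_simps)
    finally have 1: "4 powr (- a) * real n powr (- a) * real (k n) powr (1 + a) \<le> real (k n) * real M powr (- a)" .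
    have "(c1 * real n powr c) powr (1 + a) \<le> real (k n) powr (1 + a)"
      using elim a c1 by (intro powr_mono2) auto
    then have 2: "c1 powr (1 + a) * real n powr (c * (1 + a)) \<le> real (k n) powr (1 + a)"
      using c1 by (simp add: powr_mult powr_powr)
    have "4 powr (- a) * c1 powr (1 + a) * real n powr \<gamma>
        = 4 powr (- a) * real n powr (- a) * (c1 powr (1 + a) * real n powr (c * (1 + a)))"
      using n by (simp add: \<gamma>_def powr_diff powr_minus field_simps)
    also have "\<dots> \<le> 4 powr (- a) * real n powr (- a) * real (k n) powr (1 + a)"
      using 2 by (intro mult_left_mono) auto
    also note 1
    finally have 3: "4 powr (- a) * c1 powr (1 + a) * real n powr \<gamma> \<le> real (k n) * real M powr (- a)" .
    have "ln (3 / 4) \<le> - (C * real (k n) * real M powr (- a))"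
    proof -
      have "ln (3 / 4) \<le> ln (exp (- (C * real (k n) * real M powr (- a))))"
        using M(2) by (subst ln_le_cancel_iff) auto
      then show ?thesis by simp
    qed
    moreover have "ln (3 / 4 :: real) = - ln (4 / 3)" by (simp add: ln_div)
    ultimately have "C * (real (k n) * real M powr (- a)) \<le> ln (4 / 3)" by simp
    then have "C * (4 powr (- a) * c1 powr (1 + a) * real n powr \<gamma>) \<le> ln (4 / 3)"
      using mult_left_mono[OF 3, of C] C(1) by linarith
    then have "real n powr \<gamma> \<le> K" using C(1) c1(1) by (simp add: K_def field_simps)
    then show ?case using elim by simp
  qed
  then show False by simp
qed

text \<open>The size n div k is at least of order n^(1-c), so the error bound is at most of order
  n^(c - (1-c) \<beta>) and vanishes when \<beta> > c / (1 - c). Asking only for an upper bound on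
  \<open>k\<close> lets subpolynomial growth enter through an arbitrarily small
  \<open>c\<close>.\<close>

lemma achievable_rate_growth:
  assumes N0: "N0 > 0" and k: "\<And>n. n \<ge> 1 \<Longrightarrow> k n > 0" and R: "R > 0" and \<rho>: "0 \<le> \<rho>" "\<rho> \<le> 1"
    and c: "0 < c" "c < 1" and K: "K > 0" and kK: "eventually (\<lambda>n. real (k n) \<le> K * real n powr c) sequentially"
    and \<beta>: "c / (1 - c) < \<rho> / (1 + \<rho>) / (N0 * (R * ln 2)) - \<rho>"
  shows "achievable_rate orthogonal_class N0 k R"
proof -
  define \<beta> where "\<beta> = \<rho> / (1 + \<rho>) / (N0 * (R * ln 2)) - \<rho>"
  have \<beta>c: "c / (1 - c) < \<beta>" using \<beta> by (simp add: \<beta>_def)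
  moreover have "0 < c / (1 - c)" using c by simp
  ultimately have \<beta>0: "\<beta> > 0" by linarith
  have \<gamma>: "c - (1 - c) * \<beta> < 0" using \<beta>c c by (simp add: field_simps)
  have lim1: "filterlim (\<lambda>n::nat. real n powr (1 - c)) at_top sequentially"
    using c by (intro nat_powr_at_top) simp
  \<comment> \<open>The floor in \<open>n div k n\<close> costs at most 1; once n^(1-c) \<ge> 2 K,
    this is covered by giving up a factor 2.\<close>
  then have ev: "eventually (\<lambda>n. real n powr (1 - c) \<ge> 2 * K) sequentially" by (simp add: filterlim_at_top)
  have Mlow: "eventually (\<lambda>n. real n powr (1 - c) / (2 * K) \<le> real (n div k n)) sequentially"
    using kK ev eventually_ge_at_top[of 1]
  proof eventually_elim
    case (elim n)
    have n: "real n > 0" using elim by simp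
    have k0: "real (k n) > 0" using k[of n] elim by simp
    have "real n powr (1 - c) / K = real n / (K * real n powr c)" using n by (simp add: powr_diff)
    also have "\<dots> \<le> real n / real (k n)" using elim k0 n K by (intro divide_left_mono) auto
    also have "\<dots> \<le> real (n div k n) + 1"
    proof -
      have "real n / real (k n) < real_of_int \<lfloor>real n / real (k n)\<rfloor> + 1" by linarith
      also have "\<lfloor>real n / real (k n)\<rfloor> = int (n div k n)" by (simp add: floor_divide_of_nat_eq)
      finally show ?thesis by simp
    qed
    finally have "real n powr (1 - c) / K - 1 \<le> real (n div k n)" by simp
    moreover have "1 \<le> real n powr (1 - c) / (2 * K)" using elim K by simp
    moreover have "real n powr (1 - c) / K = 2 * (real n powr (1 - c) / (2 * K))" by simp
    ultimately show ?case by linarith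
  qed
  have M: "filterlim (\<lambda>n. n div k n) at_top sequentially"
  proof -
    have "filterlim (\<lambda>n::nat. real n powr (1 - c) * (1 / (2 * K))) at_top sequentially"
      using K by (intro filterlim_at_top_mult_tendsto_pos[OF tendsto_const _ lim1, of "1 / (2 * K)"]) auto
    then have "filterlim (\<lambda>n. real (n div k n)) at_top sequentially"
      by (rule filterlim_at_top_mono) (use Mlow in simp)
    then show ?thesis by (simp add: filterlim_sequentially_iff_filterlim_real)
  qed
  have "(\<lambda>n. real (k n) * real (n div k n) powr (- \<beta>)) \<longlonglongrightarrow> 0"
  proof (rule tendsto_sandwich[OF _ _ tendsto_const])
    show "eventually (\<lambda>n. 0 \<le> real (k n) * real (n div k n) powr (- \<beta>)) sequentially" by simp
    have "((\<lambda>n. real n powr (c - (1 - c) * \<beta>)) \<longlongrightarrow> 0) sequentially"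
      using \<gamma> by (intro tendsto_neg_powr filterlim_real_sequentially)
    then show "(\<lambda>n. K * (2 * K) powr \<beta> * real n powr (c - (1 - c) * \<beta>)) \<longlonglongrightarrow> 0"
      by (rule tendsto_mult_right_zero)
    show "eventually (\<lambda>n. real (k n) * real (n div k n) powr (- \<beta>) \<le> K * (2 * K) powr \<beta> * real n powr (c - (1 - c) * \<beta>)) sequentially"
      using kK Mlow eventually_ge_at_top[of 1]
    proof eventually_elim
      case (elim n)
      have n: "real n > 0" using elim by simp
      have "real (n div k n) powr (- \<beta>) \<le> (real n powr (1 - c) / (2 * K)) powr (- \<beta>)"
        using elim K n \<beta>0 by (intro powr_mono2') auto
      then have "real (k n) * real (n div k n) powr (- \<beta>) \<le> (K * real n powr c) * (real n powr (1 - c) / (2 * K)) powr (- \<beta>)"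
        using elim K by (intro mult_mono) auto
      also have "(real n powr (1 - c) / (2 * K)) powr (- \<beta>) = real n powr (- ((1 - c) * \<beta>)) * (2 * K) powr \<beta>"
        using K n by (simp add: powr_divide powr_powr powr_minus_divide)
      also have "(K * real n powr c) * (real n powr (- ((1 - c) * \<beta>)) * (2 * K) powr \<beta>)
          = K * (2 * K) powr \<beta> * (real n powr c * real n powr (- ((1 - c) * \<beta>)))" by simp
      also have "real n powr c * real n powr (- ((1 - c) * \<beta>)) = real n powr (c - (1 - c) * \<beta>)"
        by (simp flip: powr_add)
      finally show ?case .
    qed
  qed
  then have "(\<lambda>n. real (k n) * real (n div k n) powr (\<rho> - \<rho> / (1 + \<rho>) / (N0 * (R * ln 2)))) \<longlonglongrightarrow> 0"
    by (simp add: \<beta>_def)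
  then show ?thesis by (rule achievable_rateI[OF N0 R \<rho> M])
qed

lemma rate_less_iff_kappa:
  assumes "N0 > 0" "R > 0" "\<kappa> > 0"
  shows "R < log 2 (exp 1) / N0 * (1 / \<kappa>) \<longleftrightarrow> \<kappa> < 1 / (N0 * (R * ln 2))"
    and "R > log 2 (exp 1) / N0 * (1 / \<kappa>) \<longleftrightarrow> \<kappa> > 1 / (N0 * (R * ln 2))"
  using assms by (auto simp: log_def field_simps)

theorem theorem2:
  fixes N0 :: real and k :: "nat \<Rightarrow> nat"
  assumes N0_pos: "N0 > 0"
    and k_pos: "\<And>n. n \<ge> 1 \<Longrightarrow> k n > 0"
  shows
    "((\<forall>c::real. c > 0 \<longrightarrow> (\<lambda>n. real (k n)) \<in> o(\<lambda>n. real n powr c)) \<longrightarrow>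
        orthogonal_capacity N0 k = ereal (log 2 (exp 1) / N0)) \<and>
     (\<forall>c::real. 0 < c \<and> c < 1 \<and> (\<lambda>n. real (k n)) \<in> \<Theta>(\<lambda>n. real n powr c) \<longrightarrow>
        orthogonal_capacity N0 k =
          ereal (if c \<le> 1 / 2
                 then log 2 (exp 1) / N0 * (1 / (1 + sqrt (c / (1 - c)))\<^sup>2)
                 else log 2 (exp 1) / (2 * N0) * (1 - c)))"
proof (intro conjI impI allI)
  have log: "log 2 (exp 1) > 0" by simp
  assume sub: "\<forall>c::real. c > 0 \<longrightarrow> (\<lambda>n. real (k n)) \<in> o(\<lambda>n. real n powr c)"
  show "orthogonal_capacity N0 k = ereal (log 2 (exp 1) / N0)"
  proof (rule orthogonal_capacity_eqI)
    show "log 2 (exp 1) / N0 > 0" using log N0_pos by simp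
  next
    fix R assume R: "0 < R" "R < log 2 (exp 1) / N0"
    define \<kappa> where "\<kappa> = 1 / (N0 * (R * ln 2))"
    have \<kappa>: "\<kappa> > 1" using rate_less_iff_kappa(1)[OF N0_pos R(1), of 1] R by (simp add: \<kappa>_def)
    \<comment> \<open>Gallager's exponent is \<rho> (\<kappa> - 1 - \<rho>) / (1 + \<rho>), positive
      as soon as \<rho> < \<kappa> - 1; here any positive exponent will do.\<close>
    define \<rho> where "\<rho> = min 1 ((\<kappa> - 1) / 2)"
    have \<rho>: "0 < \<rho>" "\<rho> \<le> 1" "1 + \<rho> < \<kappa>" using \<kappa> by (auto simp: \<rho>_def min_def field_simps)
    define \<beta> where "\<beta> = \<rho> / (1 + \<rho>) * \<kappa> - \<rho>"
    have "\<beta> = \<rho> * (\<kappa> - (1 + \<rho>)) / (1 + \<rho>)" using \<rho> by (simp add: \<beta>_def field_simps)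
    then have \<beta>: "\<beta> > 0" using \<rho> by simp
    \<comment> \<open>The growth exponent with d / (1 - d) = \<beta>; taking half of it as
      \<open>c\<close> makes the required inequality strict.\<close>
    define d where "d = \<beta> / (1 + \<beta>)"
    have d: "0 < d" "d < 1" "d * (1 + \<beta>) = \<beta>" using \<beta> by (auto simp: d_def)
    define c where "c = d / 2"
    have c: "0 < c" "c < 1" using d by (auto simp: c_def)
    have "c * (1 + \<beta>) < \<beta>" using d \<beta> by (simp add: c_def)
    then have "c / (1 - c) < \<beta>" using c by (simp add: field_simps)
    moreover have "eventually (\<lambda>n. real (k n) \<le> 1 * real n powr c) sequentially"
      using landau_o.smallD[OF sub[rule_format, OF c(1)], of 1] by simp
    ultimately show "achievable_rate orthogonal_class N0 k R"
      using \<rho> c by (intro achievable_rate_growth[OF N0_pos k_pos R(1), where \<rho>=\<rho> and c=c and K=1]) (auto simp: \<beta>_def \<kappa>_def)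
  next
    fix R assume R: "R > log 2 (exp 1) / N0"
    then obtain R' where R': "R' > log 2 (exp 1) / N0" "R' < R" using dense by blast
    have "log 2 (exp 1) / N0 > 0" using log N0_pos by simp
    then have R'0: "0 < R'" using R'(1) by (rule less_trans)
    have "1 / (N0 * (R' * ln 2)) < 1" using rate_less_iff_kappa(2)[OF N0_pos R'0, of 1] R' by simp
    then show "\<not> achievable_rate orthogonal_class N0 k R"
      using N0_pos R'0 by (intro not_achievable_const_exponent[OF N0_pos k_pos R'0 R'(2)] error_exponent_above_capacity) auto
  qed
next
  fix c :: real assume c': "0 < c \<and> c < 1 \<and> (\<lambda>n. real (k n)) \<in> \<Theta>(\<lambda>n. real n powr c)"
  then have c: "0 < c" "c < 1" and kc: "(\<lambda>n. real (k n)) \<in> \<Theta>(\<lambda>n. real n powr c)" by auto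
  define s where "s = sqrt (c / (1 - c))"
  have s: "s > 0" "s\<^sup>2 = c / (1 - c)" using c by (auto simp: s_def)
  \<comment> \<open>The critical energy: the solution \<kappa> of a = c / (1 - c) for the exponent a
    = (sqrt \<kappa> - 1)^2 up to \<kappa> = 4 and a = \<kappa>/2 - 1 beyond it.\<close>
  define \<kappa>c where "\<kappa>c = (if c \<le> 1 / 2 then (1 + s)\<^sup>2 else 2 / (1 - c))"
  have \<kappa>c: "\<kappa>c > 0" using s c by (auto simp: \<kappa>c_def)
  have Rc: "(if c \<le> 1 / 2 then log 2 (exp 1) / N0 * (1 / (1 + sqrt (c / (1 - c)))\<^sup>2)
                 else log 2 (exp 1) / (2 * N0) * (1 - c)) = log 2 (exp 1) / N0 * (1 / \<kappa>c)"
    by (simp add: \<kappa>c_def s_def power_one_over)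
  have log: "log 2 (exp 1) > 0" by simp
  have Rpos: "log 2 (exp 1) / N0 * (1 / \<kappa>c) > 0" using log N0_pos \<kappa>c by simp
  obtain K where K: "K > 0" "eventually (\<lambda>n. real (k n) \<le> K * real n powr c) sequentially"
    using landau_o.bigE[OF bigthetaD1[OF kc]] by auto
  have s1: "s \<le> 1" if "c \<le> 1 / 2"
  proof -
    have "c / (1 - c) \<le> 1" using that c by simp
    then show ?thesis by (simp add: s_def)
  qed
  show "orthogonal_capacity N0 k = ereal (if c \<le> 1 / 2 then log 2 (exp 1) / N0 * (1 / (1 + sqrt (c / (1 - c)))\<^sup>2)
                 else log 2 (exp 1) / (2 * N0) * (1 - c))"
    unfolding Rc
  proof (rule orthogonal_capacity_eqI[OF Rpos])
    fix R assume R: "0 < R" "R < log 2 (exp 1) / N0 * (1 / \<kappa>c)"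
    define \<kappa> where "\<kappa> = 1 / (N0 * (R * ln 2))"
    have \<kappa>: "\<kappa> > \<kappa>c" using rate_less_iff_kappa(1)[OF N0_pos R(1) \<kappa>c] R by (simp add: \<kappa>_def)
    \<comment> \<open>The maximizer of \<rho> \<kappa>c / (1 + \<rho>) - \<rho> on [0, 1]: sqrt
      \<kappa>c - 1 = s while this is at most 1, and the end point 1 beyond.\<close>
    define \<rho> where "\<rho> = (if c \<le> 1 / 2 then s else 1)"
    have \<rho>: "0 < \<rho>" "\<rho> \<le> 1" using s s1 by (auto simp: \<rho>_def)
    have "c / (1 - c) = \<rho> / (1 + \<rho>) * \<kappa>c - \<rho>"
    proof (cases "c \<le> 1 / 2")
      case True
      then have "\<rho> / (1 + \<rho>) * \<kappa>c - \<rho> = s\<^sup>2" using s by (simp add: \<rho>_def \<kappa>c_def power2_eq_square field_simps)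
      then show ?thesis using s by simp
    next
      case False
      then show ?thesis using c by (simp add: \<rho>_def \<kappa>c_def field_simps)
    qed
    also have "\<dots> < \<rho> / (1 + \<rho>) * \<kappa> - \<rho>"
      using \<kappa> \<rho> by (intro diff_strict_right_mono mult_strict_left_mono divide_pos_pos) auto
    finally show "achievable_rate orthogonal_class N0 k R"
      using \<rho> by (intro achievable_rate_growth[OF N0_pos k_pos R(1) _ _ c K, where \<rho>=\<rho>]) (auto simp: \<kappa>_def)
  next
    fix R assume R: "R > log 2 (exp 1) / N0 * (1 / \<kappa>c)"
    then obtain R' where R': "R' > log 2 (exp 1) / N0 * (1 / \<kappa>c)" "R' < R" using dense by blast
    have R'0: "0 < R'" using Rpos R'(1) by (rule less_trans)
    define \<kappa> where "\<kappa> = 1 / (N0 * (R' * ln 2))"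
    have \<kappa>: "\<kappa> < \<kappa>c" "\<kappa> > 0"
      using rate_less_iff_kappa(2)[OF N0_pos R'0 \<kappa>c] R' R'0 N0_pos by (auto simp: \<kappa>_def)
    \<comment> \<open>Below the critical energy the exponent of the lower bound is less than c / (1
      - c). For c > 1/2 the latter exceeds 1, so the pairwise bound, whose exponent is never below
      1, covers every such \<kappa> at once.\<close>
    have "\<exists>a\<ge>0. a < c / (1 - c) \<and> error_exponent_bound N0 \<kappa> a"
    proof (cases "c \<le> 1 / 2")
      case True
      show ?thesis
      proof (cases "\<kappa> < 1")
        case True
        then show ?thesis using error_exponent_above_capacity[OF N0_pos \<kappa>(2)] c by (intro exI[of _ 0]) auto
      next
        case False
        have "sqrt \<kappa> < sqrt ((1 + s)\<^sup>2)"
          using \<kappa> \<open>c \<le> 1 / 2\<close> by (intro real_sqrt_less_mono) (simp add: \<kappa>c_def)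
        then have "sqrt \<kappa> - 1 < s" using s by simp
        then have lt: "(sqrt \<kappa> - 1)\<^sup>2 < s\<^sup>2" using False by (intro power_strict_mono) auto
        have "(1 + s)\<^sup>2 \<le> 2\<^sup>2" using s1[OF \<open>c \<le> 1 / 2\<close>] s by (intro power_mono) auto
        then have "\<kappa> < 4" using \<kappa> \<open>c \<le> 1 / 2\<close> by (simp add: \<kappa>c_def)
        from lt obtain a where a: "(sqrt \<kappa> - 1)\<^sup>2 < a" "a < s\<^sup>2" using dense by blast
        have "0 \<le> a" using a(1) zero_le_power2[of "sqrt \<kappa> - 1"] by linarith
        moreover have "error_exponent_bound N0 \<kappa> a"
          using False a \<open>\<kappa> < 4\<close> by (intro error_exponent_sphere_packing N0_pos) auto
        ultimately show ?thesis using a s by (intro exI[of _ a]) auto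
      qed
    next
      case False
      have 1: "1 < c / (1 - c)" using False c by simp
      have "\<kappa> / 2 < 1 / (1 - c)" using \<kappa> False by (simp add: \<kappa>c_def)
      moreover have "1 / (1 - c) - 1 = c / (1 - c)" using c by (simp add: field_simps)
      ultimately have 2: "\<kappa> / 2 - 1 < c / (1 - c)" by linarith
      have "max 1 (\<kappa> / 2 - 1) < c / (1 - c)" using 1 2 by simp
      then obtain a where "max 1 (\<kappa> / 2 - 1) < a" "a < c / (1 - c)" using dense by blast
      then have a: "1 \<le> a" "\<kappa> / 2 - 1 < a" "a < c / (1 - c)" by auto
      then show ?thesis using error_exponent_pairwise[OF N0_pos \<kappa>(2), of a] by (intro exI[of _ a]) auto
    qed
    then show "\<not> achievable_rate orthogonal_class N0 k R"
      using not_achievable_exponent[OF N0_pos k_pos R'0 R'(2) c kc] by (auto simp: \<kappa>_def)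
  qed
qed

end
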